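(* Let $k$ be an algebraically closed field of characteristic $0$, let $K$ be a field finitely generated over $k$, let $N$ be a simple $\mathcal D_K$-module (of finite dimension over $K$), and let $\pi:\operatorname{Spec}L\to\operatorname{Spec}K$ correspond to a finite Galois field extension $L/K$ such that $\pi^!(N)=\Lambda^e$ for some integer $e$ and some $\mathcal D_L$-module $\Lambda$ of rank $1$ over $L$. If $\pi$ can be factorised into field extensions $K=L_0\subset L_1\subset L_2\subset\dots\subset L_n=L$ such that each $L_i/L_{i-1}$ is Galois, then $\operatorname{rk}(N)=\dim_KN$ divides the degree $[L:K]$.
   Context: $\mathcal D_L$, $\mathcal D_K$ are the rings of $k$-linear differential operators of $L$ and $K$. $\pi^!(N)=L\otimes_KN$ with its natural structure of module over $\mathcal D_L=L\otimes_K\mathcal D_K$. *)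

theory Defs
  imports
    "Jordan_Normal_Form.VS_Connect"
    "HOL-Algebra.Generated_Fields"
    "HOL-Algebra.Finite_Extensions"
    "HOL-Algebra.Free_Abelian_Groups"
begin

section \<open>Fields\<close>

text \<open>
  A field extension \<open>L / K\<close> is given by a field homomorphism \<open>i\<close> from the type of \<open>K\<close> to the
  type of \<open>L\<close>; subfields of \<open>L\<close> are sets, and \<open>class_ring\<close> turns a type of class
  \<^class>\<open>field\<close> into the ring record that the notions of HOL-Algebra refer to.
\<close>

definition finitely_generated_field :: "('k::field \<Rightarrow> 'a::field) \<Rightarrow> bool" where
  "finitely_generated_field j \<longleftrightarrow>
     (\<exists>S. finite S \<and> generate_field (class_ring :: 'a ring) (range j \<union> S) = UNIV)"

definition field_automorphisms :: "'a::field set \<Rightarrow> 'a set \<Rightarrow> ('a \<Rightarrow> 'a) set" where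
  "field_automorphisms E F =
     {\<sigma> \<in> ring_iso ((class_ring :: 'a ring)\<lparr>carrier := F\<rparr>) ((class_ring :: 'a ring)\<lparr>carrier := F\<rparr>).
        \<forall>a\<in>E. \<sigma> a = a}"

text \<open>
  Bourbaki's (and Artin's) definition: \<open>F / E\<close> is algebraic and the only elements of \<open>F\<close> fixed by
  all \<open>E\<close>-automorphisms of \<open>F\<close> are those of \<open>E\<close>.
\<close>
definition galois_extension :: "'a::field set \<Rightarrow> 'a set \<Rightarrow> bool" where
  "galois_extension E F \<longleftrightarrow>
     subfield E (class_ring :: 'a ring) \<and> subfield F (class_ring :: 'a ring) \<and> E \<subseteq> F \<and>
     (\<forall>x\<in>F. \<not> ring.transcendental (class_ring :: 'a ring) E x) \<and>
     {x \<in> F. \<forall>\<sigma>\<in>field_automorphisms E F. \<sigma> x = x} = E"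

definition extension_space :: "('K::field \<Rightarrow> 'L::field) \<Rightarrow> ('K, 'L) module" where
  "extension_space i =
     \<lparr>carrier = UNIV, monoid.mult = (*), monoid.one = 1, ring.zero = 0, ring.add = (+),
      smult = (\<lambda>c a. i c * a)\<rparr>"

section \<open>Left modules over a ring that need not be commutative\<close>

locale left_module = R?: ring R + M?: abelian_group M
  for R :: "('r, 'c) ring_scheme" (structure) and M :: "('r, 'm, 'd) module_scheme" (structure) +
  assumes smult_closed:
      "\<lbrakk>a \<in> carrier R; x \<in> carrier M\<rbrakk> \<Longrightarrow> a \<odot>\<^bsub>M\<^esub> x \<in> carrier M"
    and smult_l_distr:
      "\<lbrakk>a \<in> carrier R; b \<in> carrier R; x \<in> carrier M\<rbrakk> \<Longrightarrow>
       (a \<oplus> b) \<odot>\<^bsub>M\<^esub> x = a \<odot>\<^bsub>M\<^esub> x \<oplus>\<^bsub>M\<^esub> b \<odot>\<^bsub>M\<^esub> x"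
    and smult_r_distr:
      "\<lbrakk>a \<in> carrier R; x \<in> carrier M; y \<in> carrier M\<rbrakk> \<Longrightarrow>
       a \<odot>\<^bsub>M\<^esub> (x \<oplus>\<^bsub>M\<^esub> y) = a \<odot>\<^bsub>M\<^esub> x \<oplus>\<^bsub>M\<^esub> a \<odot>\<^bsub>M\<^esub> y"
    and smult_assoc:
      "\<lbrakk>a \<in> carrier R; b \<in> carrier R; x \<in> carrier M\<rbrakk> \<Longrightarrow>
       (a \<otimes> b) \<odot>\<^bsub>M\<^esub> x = a \<odot>\<^bsub>M\<^esub> (b \<odot>\<^bsub>M\<^esub> x)"
    and smult_one: "x \<in> carrier M \<Longrightarrow> \<one> \<odot>\<^bsub>M\<^esub> x = x"

definition left_submodule ::
    "'m set \<Rightarrow> ('r, 'c) ring_scheme \<Rightarrow> ('r, 'm, 'd) module_scheme \<Rightarrow> bool" where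
  "left_submodule S R M \<longleftrightarrow>
     additive_subgroup S M \<and> (\<forall>a\<in>carrier R. \<forall>x\<in>S. a \<odot>\<^bsub>M\<^esub> x \<in> S)"

definition simple_left_module ::
    "('r, 'c) ring_scheme \<Rightarrow> ('r, 'm, 'd) module_scheme \<Rightarrow> bool" where
  "simple_left_module R M \<longleftrightarrow>
     left_module R M \<and> carrier M \<noteq> {\<zero>\<^bsub>M\<^esub>} \<and>
     (\<forall>S. left_submodule S R M \<longrightarrow> S = {\<zero>\<^bsub>M\<^esub>} \<or> S = carrier M)"

definition left_module_isomorphic ::
    "('r, 'c) ring_scheme \<Rightarrow> ('r, 'm, 'd) module_scheme \<Rightarrow> ('r, 'n, 'e) module_scheme \<Rightarrow> bool" where
  "left_module_isomorphic R M N \<longleftrightarrow>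
     (\<exists>f \<in> iso (add_monoid M) (add_monoid N).
        \<forall>a\<in>carrier R. \<forall>x\<in>carrier M. f (a \<odot>\<^bsub>M\<^esub> x) = a \<odot>\<^bsub>N\<^esub> f x)"

text \<open>The direct sum of \<open>e\<close> copies of \<open>M\<close>. The ring multiplication carried by a module record is
  irrelevant for modules.\<close>
definition power_module :: "('r, 'm) module \<Rightarrow> nat \<Rightarrow> ('r, nat \<Rightarrow> 'm) module" where
  "power_module M e =
     \<lparr>carrier = {..<e} \<rightarrow>\<^sub>E carrier M, monoid.mult = undefined, monoid.one = undefined,
      ring.zero = (\<lambda>l\<in>{..<e}. \<zero>\<^bsub>M\<^esub>),
      ring.add = (\<lambda>v w. \<lambda>l\<in>{..<e}. v l \<oplus>\<^bsub>M\<^esub> w l),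
      smult = (\<lambda>a v. \<lambda>l\<in>{..<e}. a \<odot>\<^bsub>M\<^esub> v l)\<rparr>"

section \<open>Differential operators\<close>

text \<open>
  Grothendieck's definition: an operator of order at most \<open>0\<close> commutes with the multiplications,
  and \<open>P\<close> has order at most \<open>n + 1\<close> if all commutators \<open>[P, a]\<close> have order at most \<open>n\<close>.
  The field \<open>'a\<close> is a \<open>'k\<close>-algebra via \<open>j\<close>.
\<close>
fun diff_ops_of_order :: "('k::field \<Rightarrow> 'a::field) \<Rightarrow> nat \<Rightarrow> ('a \<Rightarrow> 'a) set" where
  "diff_ops_of_order j 0 =
     {P. Vector_Spaces.linear (\<lambda>c x. j c * x) (\<lambda>c x. j c * x) P \<and> (\<forall>a x. P (a * x) - a * P x = 0)}"
| "diff_ops_of_order j (Suc n) =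
     {P. Vector_Spaces.linear (\<lambda>c x. j c * x) (\<lambda>c x. j c * x) P \<and>
         (\<forall>a. (\<lambda>x. P (a * x) - a * P x) \<in> diff_ops_of_order j n)}"

definition diff_op_ring :: "('k::field \<Rightarrow> 'a::field) \<Rightarrow> ('a \<Rightarrow> 'a) ring" where
  "diff_op_ring j =
     \<lparr>carrier = (\<Union>n. diff_ops_of_order j n), monoid.mult = (\<circ>), monoid.one = id,
      ring.zero = (\<lambda>x. 0), ring.add = (\<lambda>P Q x. P x + Q x)\<rparr>"

text \<open>Restriction of scalars of a module over the differential operators to the field, which is
  contained in them as the operators of order \<open>0\<close>.\<close>
definition underlying_space :: "('a::field \<Rightarrow> 'a, 'm) module \<Rightarrow> ('a, 'm) module" where
  "underlying_space M =
     \<lparr>carrier = carrier M, monoid.mult = monoid.mult M, monoid.one = monoid.one M,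
      ring.zero = ring.zero M, ring.add = ring.add M,
      smult = (\<lambda>c x. (\<lambda>z. c * z) \<odot>\<^bsub>M\<^esub> x)\<rparr>"

section \<open>The inverse image along a field extension\<close>

text \<open>
  The group underlying \<open>L \<otimes>\<^sub>K V\<close>, where \<open>i\<close> is the embedding of \<open>K\<close> in \<open>L\<close>: the free abelian group
  on \<open>L \<times> V\<close> modulo the usual relations. It is written multiplicatively, like all quotient groups in
  HOL-Algebra.
\<close>
definition tensor_free :: "('K, 'v) module \<Rightarrow> ('L \<times> 'v \<Rightarrow>\<^sub>0 int) monoid" where
  "tensor_free V = free_Abelian_group (UNIV \<times> carrier V)"

definition tensor_relations ::
    "('K::field \<Rightarrow> 'L::field) \<Rightarrow> ('K, 'v) module \<Rightarrow> ('L \<times> 'v \<Rightarrow>\<^sub>0 int) set" where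
  "tensor_relations i V =
     {frag_of (a + b, x) - frag_of (a, x) - frag_of (b, x) | a b x. x \<in> carrier V} \<union>
     {frag_of (a, x \<oplus>\<^bsub>V\<^esub> y) - frag_of (a, x) - frag_of (a, y) | a x y.
        x \<in> carrier V \<and> y \<in> carrier V} \<union>
     {frag_of (a * i c, x) - frag_of (a, c \<odot>\<^bsub>V\<^esub> x) | a c x. x \<in> carrier V}"

definition tensor_kernel ::
    "('K::field \<Rightarrow> 'L::field) \<Rightarrow> ('K, 'v) module \<Rightarrow> ('L \<times> 'v \<Rightarrow>\<^sub>0 int) set" where
  "tensor_kernel i V = generate (tensor_free V) (tensor_relations i V)"

definition tensor_group ::
    "('K::field \<Rightarrow> 'L::field) \<Rightarrow> ('K, 'v) module \<Rightarrow> ('L \<times> 'v \<Rightarrow>\<^sub>0 int) set monoid" where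
  "tensor_group i V = tensor_free V Mod tensor_kernel i V"

definition pure_tensor ::
    "('K::field \<Rightarrow> 'L::field) \<Rightarrow> ('K, 'v) module \<Rightarrow> 'L \<Rightarrow> 'v \<Rightarrow> ('L \<times> 'v \<Rightarrow>\<^sub>0 int) set" where
  "pure_tensor i V a x = tensor_kernel i V #>\<^bsub>tensor_free V\<^esub> frag_of (a, x)"

text \<open>
  Write \<open>D\<^sub>K\<close>, \<open>D\<^sub>L\<close> for the rings of differential operators; \<open>L\<close> is a \<open>k\<close>-algebra via \<open>i \<circ> j\<close>. Under
  \<open>D\<^sub>L = L \<otimes>\<^sub>K D\<^sub>K\<close> an operator \<open>Q\<close> of \<open>D\<^sub>L\<close> corresponds to \<open>\<Sum> b\<^sub>l \<otimes> P\<^sub>l\<close> precisely if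
  \<open>Q (i c) = \<Sum> b\<^sub>l i (P\<^sub>l c)\<close> for all \<open>c\<close> in \<open>K\<close>, and such a \<open>Q\<close> maps \<open>1 \<otimes> x\<close> to \<open>\<Sum> b\<^sub>l \<otimes> P\<^sub>l x\<close>.
  As \<open>a \<otimes> x = a (1 \<otimes> x)\<close>, the value of \<open>Q\<close> on \<open>a \<otimes> x\<close> is obtained by decomposing the operator
  \<open>Q a\<close>, i.e. the one mapping \<open>z\<close> to \<open>Q (a z)\<close>. If \<open>L / K\<close> is finite, every operator in \<open>D\<^sub>L\<close> has such
  a decomposition (take coordinates with respect to a \<open>K\<close>-basis of \<open>L\<close>), and the value does not depend
  on it; hence the additive map below exists and is unique on the tensor product.
\<close>
definition represents_action ::
    "('k::field \<Rightarrow> 'K::field) \<Rightarrow> ('K \<Rightarrow> 'L::field) \<Rightarrow> ('K \<Rightarrow> 'K, 'n) module \<Rightarrow> ('L \<Rightarrow> 'L) \<Rightarrow>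
     (('L \<times> 'n \<Rightarrow>\<^sub>0 int) set \<Rightarrow> ('L \<times> 'n \<Rightarrow>\<^sub>0 int) set) \<Rightarrow> bool" where
  "represents_action j i N Q f \<longleftrightarrow>
     (let V = underlying_space N; T = tensor_group i V in
      f \<in> hom T T \<and>
      (\<forall>a. \<forall>x\<in>carrier N. \<forall>m::nat. \<forall>b P.
         (\<forall>l<m. P l \<in> carrier (diff_op_ring j)) \<and>
         (\<forall>c. Q (a * i c) = (\<Sum>l<m. b l * i (P l c))) \<longrightarrow>
         f (pure_tensor i V a x) =
           finprod T (\<lambda>l. pure_tensor i V (b l) (P l \<odot>\<^bsub>N\<^esub> x)) {..<m}))"

definition inverse_image ::
    "('k::field \<Rightarrow> 'K::field) \<Rightarrow> ('K \<Rightarrow> 'L::field) \<Rightarrow> ('K \<Rightarrow> 'K, 'n) module \<Rightarrow>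
     ('L \<Rightarrow> 'L, ('L \<times> 'n \<Rightarrow>\<^sub>0 int) set) module" where
  "inverse_image j i N =
     (let T = tensor_group i (underlying_space N) in
      \<lparr>carrier = carrier T, monoid.mult = undefined, monoid.one = undefined,
       ring.zero = monoid.one T, ring.add = monoid.mult T,
       smult = (\<lambda>Q t. THE s. \<exists>f. represents_action j i N Q f \<and> s = f t)\<rparr>)"

end

(*
  Choose a generator of Lambda. A K-basis of N then gives an invertible matrix B of "periods" over L.
  For g in the Galois group G the matrix A_g = B g(B)^-1 intertwines the operators of D_L up to a
  twist, so that the ratio of two of its entries is killed by all k-derivations of L and hence lies
  in k: A_g is a multiple of a matrix U_g over k, and the U_g form a projective representation of G.
  A matrix Y over k commuting with all U_g descends to a D_K-linear endomorphism B^-1 Y B of N; it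
  has an eigenvalue in k, so that by simplicity of N it is a scalar.

  With z = |G| / r, Schur orthogonality for the representation normalised to determinant 1 reads
  z x_sb y_pd = sum_g (U_g x)_pb (U_g^-1 y)_sd. Here x, y range over a finite group of matrices, so z
  multiplies a finite set of elements of k into its integral span. Hence z is an algebraic integer,
  i.e. r divides |G| = [L : K].
*)
theory Submission
  imports Defs "Jordan_Normal_Form.Char_Poly"
begin

text \<open>Concluding that an element killed by all derivations lies in \<open>k\<close> needs
  enough derivations: as \<open>k\<close> is algebraically closed, an element outside
  \<open>k\<close> is transcendental over it, so it may be given derivative 1, and in characteristic
  0 this derivation extends to all of \<open>L\<close>.

  The delicate point is that B^-1 Y B commutes with D_K. The periods are governed by operators on
  \<open>L\<close>, and operators are given by iterated commutators, not as polynomials in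
  derivations. Each P of order n on \<open>K\<close> is therefore matched with some Q of order n on
  \<open>L\<close> that restricts to P up to terms of order below n. Such a Q arises by averaging a
  coordinatewise extension of P against the separability idempotent of L / K. The action of Q on the
  coordinates is k-linear, so it commutes with Y, and induction on the order disposes of the
  correction terms.

  Normalising to determinant 1 leaves only r-th roots of unity as ambiguity, which makes the group
  of matrices finite. The constant z is the trace of an averaged matrix, |G|, divided by the size
  r.\<close>

hide_const (open) up_ring.coeff up_ring.monom Polynomials.degree Polynomials.lead_coeff

section \<open>Extension of derivations\<close>

text \<open>A derivation defined on a subring is encoded by its graph: a subring of the dual numbers \<open>'a[\<epsilon>]\<close>
  that meets \<open>\<epsilon>'a\<close> trivially. Extending derivations is then inclusion of graphs.\<close>
definition derivation_graph :: "('a::field \<times> 'a) set \<Rightarrow> bool" where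
  "derivation_graph D \<longleftrightarrow>
     (1, 0) \<in> D \<and> (-1, 0) \<in> D \<and>
     (\<forall>a a' b b'. (a, a') \<in> D \<longrightarrow> (b, b') \<in> D \<longrightarrow>
        (a + b, a' + b') \<in> D \<and> (a * b, a * b' + a' * b) \<in> D) \<and>
     (\<forall>y. (0, y) \<in> D \<longrightarrow> y = 0)"

lemma derivation_graphD:
  assumes "derivation_graph D"
  shows "(1, 0) \<in> D" "(-1, 0) \<in> D" "(0, 0) \<in> D"
    and "(a, a') \<in> D \<Longrightarrow> (b, b') \<in> D \<Longrightarrow> (a + b, a' + b') \<in> D"
    and "(a, a') \<in> D \<Longrightarrow> (b, b') \<in> D \<Longrightarrow> (a * b, a * b' + a' * b) \<in> D"
    and "(a, a') \<in> D \<Longrightarrow> (- a, - a') \<in> D"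
    and "(0, y) \<in> D \<Longrightarrow> y = 0"
    and "(a, a') \<in> D \<Longrightarrow> (a, a'') \<in> D \<Longrightarrow> a' = a''"
proof -
  show 1: "(1, 0) \<in> D" "(-1, 0) \<in> D" and k: "\<And>y. (0, y) \<in> D \<Longrightarrow> y = 0"
    and add: "\<And>a a' b b'. (a, a') \<in> D \<Longrightarrow> (b, b') \<in> D \<Longrightarrow> (a + b, a' + b') \<in> D"
    and mult: "\<And>a a' b b'. (a, a') \<in> D \<Longrightarrow> (b, b') \<in> D \<Longrightarrow> (a * b, a * b' + a' * b) \<in> D"
    using assms unfolding derivation_graph_def by blast+
  show "(0, 0) \<in> D" using add[OF 1] by simp
  show uminus: "\<And>a a'. (a, a') \<in> D \<Longrightarrow> (- a, - a') \<in> D"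
    using mult[OF 1(2)] by fastforce
  show "a' = a''" if "(a, a') \<in> D" "(a, a'') \<in> D"
    using k add[OF that(1) uminus[OF that(2)]] by fastforce
qed

lemma derivation_graph_sum:
  assumes "derivation_graph D" "\<And>i. i \<in> I \<Longrightarrow> (f i, g i) \<in> D"
  shows "(sum f I, sum g I) \<in> D"
  using assms(2) by (induction I rule: infinite_finite_induct)
    (auto intro!: derivation_graphD[OF assms(1)])

definition maximal_derivation_graph :: "('a::field \<times> 'a) set \<Rightarrow> bool" where
  "maximal_derivation_graph D \<longleftrightarrow> derivation_graph D \<and> (\<forall>D'. derivation_graph D' \<longrightarrow> D \<subseteq> D' \<longrightarrow> D' = D)"

text \<open>Zorn's lemma applies because each closure condition involves at most two elements of the
  graph, and two elements of the union of a chain lie in one member.\<close>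

lemma maximal_derivation_graph_exists:
  assumes "derivation_graph D"
  obtains M where "maximal_derivation_graph M" "D \<subseteq> M"
proof -
  let ?A = "{D'. derivation_graph D' \<and> D \<subseteq> D'}"
  have "\<exists>M\<in>?A. \<forall>Y\<in>?A. (M \<subseteq> Y) \<longrightarrow> Y = M"
  proof (rule subset_Zorn_nonempty)
    show "?A \<noteq> {}" using assms by auto
    fix C assume C: "C \<noteq> {}" "subset.chain ?A C"
    have dg: "\<And>Y. Y \<in> C \<Longrightarrow> derivation_graph Y" and sub: "\<And>Y. Y \<in> C \<Longrightarrow> D \<subseteq> Y"
      using C(2) unfolding subset_chain_def by auto
    have common: "\<exists>Y\<in>C. u \<in> Y \<and> v \<in> Y" if "u \<in> \<Union>C" "v \<in> \<Union>C" for u v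
      using that C(2) unfolding subset_chain_def by (elim UnionE) (meson subsetD)
    have "derivation_graph (\<Union>C)"
      unfolding derivation_graph_def
    proof (intro conjI allI impI)
      show "(1, 0) \<in> \<Union>C" "(-1, 0) \<in> \<Union>C"
        using C(1) derivation_graphD(1,2)[OF dg] by blast+
      show "y = 0" if "(0, y) \<in> \<Union>C" for y
        using that derivation_graphD(7)[OF dg] by blast
      fix a a' b b' assume ab: "(a, a') \<in> \<Union>C" "(b, b') \<in> \<Union>C"
      then obtain Y where Y: "Y \<in> C" "(a, a') \<in> Y" "(b, b') \<in> Y" using common by metis
      show "(a + b, a' + b') \<in> \<Union>C" "(a * b, a * b' + a' * b) \<in> \<Union>C"
        using derivation_graphD(4,5)[OF dg[OF Y(1)] Y(2,3)] Y(1) by blast+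
    qed
    then show "\<Union>C \<in> ?A" using sub C(1) by blast
  qed
  then show thesis using that unfolding maximal_derivation_graph_def
    by (metis (no_types, lifting) mem_Collect_eq subset_trans)
qed

text \<open>Pairs \<open>(p, q)\<close> of polynomials are polynomials over \<open>D\<close>, viewed inside the dual numbers \<open>'a[\<epsilon>]\<close>;
  the value at \<open>x + \<epsilon>y\<close> is \<open>p(x) + \<epsilon>(q(x) + p'(x) y)\<close>.\<close>
definition graph_polys :: "('a::field \<times> 'a) set \<Rightarrow> ('a poly \<times> 'a poly) set" where
  "graph_polys D = {(p, q). \<forall>n. (coeff p n, coeff q n) \<in> D}"

lemma graph_polysI: "(\<And>n. (coeff p n, coeff q n) \<in> D) \<Longrightarrow> (p, q) \<in> graph_polys D"
  unfolding graph_polys_def by blast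

lemma graph_polysD: "(p, q) \<in> graph_polys D \<Longrightarrow> (coeff p n, coeff q n) \<in> D"
  unfolding graph_polys_def by blast

context
  fixes D :: "('a::field \<times> 'a) set"
  assumes D: "derivation_graph D"
begin

lemma graph_polys_add:
  "(p, q) \<in> graph_polys D \<Longrightarrow> (r, s) \<in> graph_polys D \<Longrightarrow> (p + r, q + s) \<in> graph_polys D"
  by (auto intro!: graph_polysI derivation_graphD(4)[OF D] dest: graph_polysD)

lemma graph_polys_monom: "(a, a') \<in> D \<Longrightarrow> (monom a n, monom a' n) \<in> graph_polys D"
  by (auto intro!: graph_polysI derivation_graphD[OF D])

lemma graph_polys_mult:
  assumes "(p, q) \<in> graph_polys D" "(r, s) \<in> graph_polys D"
  shows "(p * r, p * s + q * r) \<in> graph_polys D"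
  using assms unfolding coeff_mult coeff_add
  by (intro graph_polysI, unfold coeff_mult coeff_add sum.distrib[symmetric])
    (intro derivation_graph_sum[OF D] derivation_graphD(5)[OF D] graph_polysD)

lemma graph_polys_diff:
  assumes "(p, q) \<in> graph_polys D" "(r, s) \<in> graph_polys D"
  shows "(p - r, q - s) \<in> graph_polys D"
proof -
  have "(- r, - s) \<in> graph_polys D"
    using assms(2) by (auto intro!: graph_polysI derivation_graphD(6)[OF D] dest: graph_polysD)
  from graph_polys_add[OF assms(1) this] show ?thesis by simp
qed

lemma graph_polys_fst_0: "(0, q) \<in> graph_polys D \<Longrightarrow> q = 0"
  using derivation_graphD(7)[OF D] by (intro poly_eqI) (auto simp: graph_polys_def)

text \<open>The enlarged graph consists of the values at x + \<epsilon>y of all polynomials over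
  \<open>D\<close>. The hypothesis says exactly that a value with first component 0 is 0, which is
  the only condition that could fail.\<close>

lemma derivation_graph_adjoin:
  assumes root: "\<And>p q. (p, q) \<in> graph_polys D \<Longrightarrow> poly p x = 0 \<Longrightarrow> poly q x + poly (pderiv p) x * y = 0"
  shows "\<exists>E. derivation_graph E \<and> D \<subseteq> E \<and> (x, y) \<in> E"
proof -
  define E where "E = {(poly p x, poly q x + poly (pderiv p) x * y) | p q. (p, q) \<in> graph_polys D}"
  have const: "(a, a') \<in> E" if "(a, a') \<in> D" for a a'
  proof -
    have "(a, a') = (poly (monom a 0) x, poly (monom a' 0) x + poly (pderiv (monom a 0)) x * y)"
      by (simp add: poly_monom pderiv_monom)
    then show ?thesis using graph_polys_monom[OF that, of 0] unfolding E_def by blast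
  qed
  have "derivation_graph E"
    unfolding derivation_graph_def
  proof (intro conjI allI impI)
    show "(1, 0) \<in> E" "(-1, 0) \<in> E" using const derivation_graphD(1,2)[OF D] by blast+
    show "z = 0" if "(0, z) \<in> E" for z
      using that root unfolding E_def by auto
    fix a a' b b' assume "(a, a') \<in> E" "(b, b') \<in> E"
    then obtain p q r s where a: "a = poly p x" "a' = poly q x + poly (pderiv p) x * y" "(p, q) \<in> graph_polys D"
      and b: "b = poly r x" "b' = poly s x + poly (pderiv r) x * y" "(r, s) \<in> graph_polys D"
      unfolding E_def by blast
    have "a + b = poly (p + r) x" "a' + b' = poly (q + s) x + poly (pderiv (p + r)) x * y"
      unfolding a b by (simp_all add: pderiv_add algebra_simps)
    then show "(a + b, a' + b') \<in> E" using graph_polys_add[OF a(3) b(3)] unfolding E_def by blast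
    have "a * b = poly (p * r) x" "a * b' + a' * b = poly (p * s + q * r) x + poly (pderiv (p * r)) x * y"
      unfolding a b by (simp_all add: pderiv_mult algebra_simps)
    then show "(a * b, a * b' + a' * b) \<in> E" using graph_polys_mult[OF a(3) b(3)] unfolding E_def by blast
  qed
  moreover have "(x, y) \<in> E"
  proof -
    have "(x, y) = (poly (monom 1 1) x, poly (monom 0 1) x + poly (pderiv (monom 1 1)) x * y)"
      by (simp add: poly_monom pderiv_monom)
    then show ?thesis using graph_polys_monom[OF derivation_graphD(1)[OF D], of 1] unfolding E_def by blast
  qed
  ultimately show ?thesis using const by auto
qed

end

text \<open>If no nonzero polynomial over \<open>D\<close> vanishes at \<open>x\<close>, every
  \<open>y\<close> is admissible. Otherwise a polynomial \<open>m\<close> of least degree dictates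
  \<open>y\<close>: its derivative is nonzero in characteristic 0 and of smaller degree, so it does
  not vanish at \<open>x\<close> and the linear equation for \<open>y\<close> is solvable.\<close>

lemma maximal_derivation_graph_total:
  fixes D :: "('a::field \<times> 'a) set"
  assumes max: "maximal_derivation_graph D" and char: "\<And>n. n > 0 \<Longrightarrow> (of_nat n :: 'a) \<noteq> 0"
  shows "\<exists>y. (x, y) \<in> D"
proof -
  have D: "derivation_graph D" using max unfolding maximal_derivation_graph_def by blast
  define val where "val y p q = poly q x + poly (pderiv p) x * y" for y p q
  have "\<exists>y. \<forall>p q. (p, q) \<in> graph_polys D \<longrightarrow> poly p x = 0 \<longrightarrow> val y p q = 0"
  proof (cases "\<exists>p q. (p, q) \<in> graph_polys D \<and> poly p x = 0 \<and> p \<noteq> 0")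
    case False
    then show ?thesis using graph_polys_fst_0[OF D] unfolding val_def by fastforce
  next
    case True
    let ?P = "\<lambda>n. \<exists>p q. (p, q) \<in> graph_polys D \<and> poly p x = 0 \<and> p \<noteq> 0 \<and> degree p = n"
    define d where "d = (LEAST n. ?P n)"
    have "?P d" unfolding d_def by (rule LeastI_ex) (use True in blast)
    then obtain m m' where m: "(m, m') \<in> graph_polys D" "poly m x = 0" "m \<noteq> 0" "degree m = d" by blast
    have least: "d \<le> degree p" if "(p, q) \<in> graph_polys D" "poly p x = 0" "p \<noteq> 0" for p q
      unfolding d_def by (rule Least_le) (use that in blast)
    have "d > 0" using m by (metis degree_eq_zeroE gr0I pCons_eq_0_iff poly_0 poly_pCons mult_zero_right add_0_right)
    have "coeff (pderiv m) (d - 1) \<noteq> 0"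
      using char[of d] \<open>d > 0\<close> m(3,4) by (auto simp: coeff_pderiv)
    then have "pderiv m \<noteq> 0" by auto
    \<comment> \<open>Minimality speaks about \<open>pderiv m\<close> only once it is the first half
      of a pair over \<open>D\<close>. Its coefficients are natural multiples of those of
      \<open>m\<close>, and natural numbers have derivative 0.\<close>
    obtain pm' where "(pderiv m, pm') \<in> graph_polys D"
    proof
      show "(pderiv m, pderiv m') \<in> graph_polys D"
      proof (rule graph_polysI)
        fix n
        have nat: "(of_nat k, 0) \<in> D" for k
          by (induction k) (auto simp: derivation_graphD[OF D] dest: derivation_graphD(4)[OF D derivation_graphD(1)[OF D]])
        from derivation_graphD(5)[OF D nat graph_polysD[OF m(1)], of "Suc n" "Suc n"]
        show "(coeff (pderiv m) n, coeff (pderiv m') n) \<in> D" by (simp add: coeff_pderiv)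
      qed
    qed
    moreover have "degree (pderiv m) < d"
      using \<open>d > 0\<close> m(4)
      by (intro order.strict_trans1[OF degree_le[of "d - 1" "pderiv m"]]) (auto simp: coeff_pderiv coeff_eq_0)
    ultimately have dm: "poly (pderiv m) x \<noteq> 0" using least \<open>pderiv m \<noteq> 0\<close> by fastforce
    define y where "y = - poly m' x / poly (pderiv m) x"
    have vm: "val y m m' = 0" unfolding val_def y_def using dm by simp
    have "val y p q = 0" if "(p, q) \<in> graph_polys D" "poly p x = 0" for p q
      using that
    proof (induction "degree p" arbitrary: p q rule: less_induct)
      case (less p q)
      show ?case
      proof (cases "p = 0")
        case True
        then show ?thesis using graph_polys_fst_0[OF D, of q] less(2) unfolding val_def by simp
      next
        case False
        then have dp: "d \<le> degree p" using least less by blast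
        obtain u where u: "(lead_coeff m, u) \<in> D" using graph_polysD[OF m(1)] by blast
        obtain v where v: "(lead_coeff p, v) \<in> D" using graph_polysD[OF less(2)] by blast
        have lm: "lead_coeff m \<noteq> 0" using m(3) by simp
        let ?a = "lead_coeff m" and ?n = "degree p - d"
        \<comment> \<open>One step of pseudo-division by \<open>m\<close>: the domain of
          \<open>D\<close> is only known to be a ring, so \<open>p\<close> is multiplied by the
          leading coefficient of \<open>m\<close> instead of dividing by it. \<open>?q\<close> is
          the \<epsilon>-part of the same expression.\<close>
        let ?p = "monom ?a 0 * p - monom (lead_coeff p) ?n * m"
        let ?q = "(monom ?a 0 * q + monom u 0 * p) - (monom (lead_coeff p) ?n * m' + monom v ?n * m)"
        have pq: "(?p, ?q) \<in> graph_polys D"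
          by (intro graph_polys_diff[OF D] graph_polys_mult[OF D] graph_polys_monom[OF D] u v m(1) less(2))
        have root: "poly ?p x = 0" using less(3) m(2) by simp
        have "degree p \<noteq> 0"
          using less(3) False
          by (metis degree_eq_zeroE pCons_eq_0_iff poly_0 poly_pCons mult_zero_right add_0_right)
        have "degree ?p < degree p" if "?p \<noteq> 0"
        proof (rule degree_less_if_less_eqI[OF _ _ that])
          have deg: "degree p = degree (monom (lead_coeff p) ?n) + degree m"
            using dp m(4) False by (simp add: degree_monom_eq)
          then have "degree (monom (lead_coeff p) ?n * m) \<le> degree p" using degree_mult_le by metis
          moreover have "degree (monom ?a 0 * p) \<le> degree p"
            by (simp add: monom_0)
          ultimately show "degree ?p \<le> degree p" by (intro degree_diff_le)
          have "coeff (monom (lead_coeff p) ?n * m) (degree p) = lead_coeff (monom (lead_coeff p) ?n) * ?a"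
            using deg by (metis coeff_mult_degree_sum)
          then show "coeff ?p (degree p) = 0" using False by (simp add: degree_monom_eq monom_0)
        qed
        then have "val y ?p ?q = 0" if "?p \<noteq> 0" using less(1)[OF _ pq root] that by blast
        moreover have "?q = 0" if "?p = 0" using graph_polys_fst_0[OF D] pq[unfolded that] by blast
        ultimately have "val y ?p ?q = 0" by (cases "?p = 0") (auto simp: val_def)
        \<comment> \<open>The product rule yields further terms, all with a factor
          \<open>poly p x\<close> or \<open>poly m x\<close>; these vanish.\<close>
        moreover have "val y ?p ?q = ?a * val y p q - poly (monom (lead_coeff p) ?n) x * val y m m'"
          unfolding val_def using less(3) m(2)
          by (simp add: pderiv_diff pderiv_mult pderiv_smult monom_0 pderiv_pCons algebra_simps)
        ultimately show ?thesis using vm lm by simp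
      qed
    qed
    then show ?thesis by blast
  qed
  then obtain y where "\<And>p q. (p, q) \<in> graph_polys D \<Longrightarrow> poly p x = 0 \<Longrightarrow> val y p q = 0" by blast
  from derivation_graph_adjoin[OF D this[unfolded val_def]] obtain E where
    "derivation_graph E" "D \<subseteq> E" "(x, y) \<in> E" by blast
  then show ?thesis using max unfolding maximal_derivation_graph_def by blast
qed

text \<open>As \<open>c\<close> is transcendental over the algebraically closed \<open>k\<close>,
  the zero derivation of \<open>k\<close> may be continued with value 1 at \<open>c\<close>; a
  maximal continuation is defined everywhere.\<close>

lemma derivation_exists:
  fixes h :: "'k::{alg_closed_field, field_char_0} \<Rightarrow> 'a::field"
  assumes "field_hom h" "c \<notin> range h"
  obtains \<theta> where "\<And>x y. \<theta> (x + y) = \<theta> x + \<theta> y" "\<And>x y. \<theta> (x * y) = x * \<theta> y + \<theta> x * y"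
    "\<And>a. \<theta> (h a) = 0" "\<theta> c = 1"
proof -
  interpret h: field_hom h by fact
  interpret hp: map_poly_comm_ring_hom h ..
  \<comment> \<open>Splitting off a root \<open>z\<close> of \<open>p\<close> contributes the factor
    \<open>c - h z\<close>, which is nonzero because \<open>c\<close> lies outside the image of
    \<open>h\<close>. By induction on the degree no nonzero polynomial over \<open>k\<close>
    vanishes at \<open>c\<close>.\<close>
  have trans: "p = 0" if "poly (map_poly h p) c = 0" for p
  proof -
    have "poly (map_poly h p) c \<noteq> 0" if "p \<noteq> 0"
      using that
    proof (induction "degree p" arbitrary: p rule: less_induct)
      case less
      show ?case
      proof (cases "degree p = 0")
        case True
        then obtain a where "p = [:a:]" using degree_eq_zeroE by blast
        then show ?thesis using less(2) by (simp add: map_poly_pCons)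
      next
        case False
        then obtain z where "poly p z = 0" using alg_closed_imp_poly_has_root[of p] by blast
        then obtain q where q: "p = [:- z, 1:] * q" using poly_eq_0_iff_dvd by blast
        then have "q \<noteq> 0" using less(2) by auto
        then have "degree q < degree p" unfolding q by (subst degree_mult_eq) auto
        then have "poly (map_poly h q) c \<noteq> 0" using less(1) \<open>q \<noteq> 0\<close> by blast
        moreover have "c - h z \<noteq> 0" using assms(2) by (metis eq_iff_diff_eq_0 rangeI)
        moreover have "poly (map_poly h p) c = (c - h z) * poly (map_poly h q) c"
          unfolding q hp.hom_mult by (simp add: map_poly_pCons hom_distribs algebra_simps)
        ultimately show ?thesis by simp
      qed
    qed
    then show ?thesis using that by blast
  qed
  define D0 where "D0 = range (\<lambda>a. (h a, 0 :: 'a))"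
  have D0: "derivation_graph D0"
    unfolding derivation_graph_def D0_def
    by (auto simp: image_iff simp flip: h.hom_add h.hom_mult)
      (metis h.hom_one h.hom_uminus)
  have coeffs: "\<exists>r. p = map_poly h r" "q = 0" if "(p, q) \<in> graph_polys D0" for p q
  proof -
    have "\<forall>n. coeff p n \<in> range h" "\<forall>n. coeff q n = 0"
      using that unfolding graph_polys_def D0_def by auto
    show "q = 0" using \<open>\<forall>n. coeff q n = 0\<close> by (intro poly_eqI) simp
    have "p = map_poly h (map_poly (inv_into UNIV h) p)"
      using \<open>\<forall>n. coeff p n \<in> range h\<close> h.hom_zero
      by (intro poly_eqI) (metis (no_types, lifting) coeff_map_poly f_inv_into_f h.injectivity inv_f_f injI)
    then show "\<exists>r. p = map_poly h r" by blast
  qed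
  have "poly q c + poly (pderiv p) c * 1 = 0" if "(p, q) \<in> graph_polys D0" "poly p c = 0" for p q
  proof -
    note pq = coeffs[OF that(1)]
    from pq(1) obtain r where "p = map_poly h r" by blast
    moreover from this have "r = 0" using trans that(2) by blast
    moreover note pq(2)
    ultimately show ?thesis by simp
  qed
  from derivation_graph_adjoin[OF D0 this] obtain E where
    E: "derivation_graph E" "D0 \<subseteq> E" "(c, 1) \<in> E" by blast
  obtain D where max: "maximal_derivation_graph D" and ED: "E \<subseteq> D"
    using maximal_derivation_graph_exists[OF E(1)] by blast
  have D: "derivation_graph D" using max unfolding maximal_derivation_graph_def by blast
  have char: "(of_nat n :: 'a) \<noteq> 0" if "n > 0" for n
    using that by (metis h.hom_of_nat h.hom_0_iff of_nat_eq_0_iff less_irrefl)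
  obtain \<theta> where \<theta>: "\<And>x. (x, \<theta> x) \<in> D"
    using maximal_derivation_graph_total[OF max char] by metis
  have eq: "\<theta> x = y" if "(x, y) \<in> D" for x y
    using derivation_graphD(8)[OF D \<theta> that] .
  show thesis
  proof (rule that)
    show "\<theta> (x + y) = \<theta> x + \<theta> y" "\<theta> (x * y) = x * \<theta> y + \<theta> x * y" for x y
      by (intro eq derivation_graphD[OF D] \<theta>)+
    show "\<theta> (h a) = 0" for a using E(2) ED by (intro eq) (auto simp: D0_def)
    show "\<theta> c = 1" using E(3) ED by (intro eq) auto
  qed
qed

section \<open>Degrees of projective representations\<close>

text \<open>Enumerate \<open>S\<close> as a vector. Multiplication by \<open>z\<close> acts on it
  through an integer matrix, so \<open>z\<close> is an eigenvalue of that matrix and a root of its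
  monic integral characteristic polynomial. The element \<open>s\<^sub>0\<close> ensures that the
  vector is nonzero.\<close>

lemma algebraic_int_if_finite_invariant:
  fixes z :: "'a::field_char_0"
  assumes "finite S" "s\<^sub>0 \<in> S" "s\<^sub>0 \<noteq> 0"
    and "\<And>s. s \<in> S \<Longrightarrow> \<exists>I (f :: 'i \<Rightarrow> 'a). finite I \<and> f ` I \<subseteq> S \<and> z * s = sum f I"
  shows "algebraic_int z"
proof -
  obtain I and f :: "'a \<Rightarrow> 'i \<Rightarrow> 'a" where
    If: "\<And>s. s \<in> S \<Longrightarrow> finite (I s) \<and> f s ` I s \<subseteq> S \<and> z * s = sum (f s) (I s)"
    using assms(4) by metis
  obtain h where h: "bij_betw h {0..<card S} S" using ex_bij_betw_nat_finite[OF assms(1)] by blast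
  define n where "n = card S"
  \<comment> \<open>The same element of \<open>S\<close> may occur several times among the summands
    of \<open>z * h i\<close>; the entries record these multiplicities.\<close>
  define A :: "int mat" where "A = mat n n (\<lambda>(i, l). int (card {x \<in> I (h i). f (h i) x = h l}))"
  define v where "v = vec n h"
  let ?B = "map_mat of_int A :: 'a mat"
  have A: "A \<in> carrier_mat n n" unfolding A_def by simp
  have "?B *\<^sub>v v = z \<cdot>\<^sub>v v"
  proof (rule eq_vecI)
    fix i assume "i < dim_vec (z \<cdot>\<^sub>v v)"
    then have i: "i < n" unfolding v_def by simp
    then have hi: "h i \<in> S" using h unfolding n_def bij_betw_def by auto
    have "(?B *\<^sub>v v) $ i = (\<Sum>l=0..<n. of_nat (card {x \<in> I (h i). f (h i) x = h l}) * h l)"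
      using i unfolding A_def v_def by (simp add: scalar_prod_def)
    also have "\<dots> = (\<Sum>y\<in>S. of_nat (card {x \<in> I (h i). f (h i) x = y}) * y)"
      using sum.reindex_bij_betw[OF h] unfolding n_def .
    also have "\<dots> = (\<Sum>y\<in>S. \<Sum>x\<in>{x \<in> I (h i). f (h i) x = y}. f (h i) x)"
      by simp
    also have "\<dots> = sum (f (h i)) (I (h i))"
      using If[OF hi] assms(1) by (intro sum.group) auto
    also have "\<dots> = z * h i" using If[OF hi] by simp
    finally show "(?B *\<^sub>v v) $ i = (z \<cdot>\<^sub>v v) $ i" using i unfolding v_def by simp
  qed (use A v_def in auto)
  moreover have "v \<noteq> 0\<^sub>v n"
  proof -
    have "s\<^sub>0 \<in> h ` {0..<n}" using h assms(2) unfolding n_def bij_betw_def by simp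
    then obtain i where "i < n" "h i = s\<^sub>0" by auto
    then show ?thesis using assms(3) unfolding v_def by (metis index_vec index_zero_vec(1))
  qed
  ultimately have "eigenvalue ?B z"
    unfolding eigenvalue_def eigenvector_def using A by (intro exI[of _ v]) (auto simp: v_def)
  then have "poly (char_poly ?B) z = 0"
    using eigenvalue_root_char_poly[of ?B n z] A by simp
  then have root: "poly (map_poly of_int (char_poly A)) z = 0"
    using of_int_hom.char_poly_hom[OF A, where ?'a='a] by simp
  have "lead_coeff (char_poly A) = 1" using degree_monic_char_poly[OF A] by simp
  then have "lead_coeff (map_poly of_int (char_poly A) :: 'a poly) = 1"
    by simp
  then show ?thesis using root by (intro algebraic_int.intros[of "map_poly of_int (char_poly A)"]) auto
qed

lemma finite_nth_roots:
  fixes b :: "'a::idom"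
  assumes "n > 0"
  shows "finite {a. a ^ n = b}"
proof -
  have "degree (monom (1 :: 'a) n) \<noteq> degree [:b:]" using assms by (simp add: degree_monom_eq)
  then have "monom 1 n - [:b:] \<noteq> 0" by (metis eq_iff_diff_eq_0)
  from poly_roots_finite[OF this] show ?thesis by (simp add: poly_monom)
qed

lemma smult_smult_mat: "(a :: 'a::semigroup_mult) \<cdot>\<^sub>m (b \<cdot>\<^sub>m A) = (a * b) \<cdot>\<^sub>m A"
  by (intro eq_matI) (auto simp: mult.assoc)

lemma one_smult_mat: "(1 :: 'a::monoid_mult) \<cdot>\<^sub>m A = A"
  by (intro eq_matI) auto

lemma index_mult_mat_sum:
  assumes "A \<in> carrier_mat n m" "B \<in> carrier_mat m l" "i < n" "k < l"
  shows "(A * B) $$ (i, k) = (\<Sum>t<m. A $$ (i, t) * B $$ (t, k))"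
  using assms by (simp add: scalar_prod_def lessThan_atLeast0)

text \<open>Irreducibility enters as \<open>commutant\<close>, the conclusion of Schur's lemma,
  which is the form that Galois descent delivers. Working with matrix entries instead of characters
  makes it unnecessary to pass to a linear representation of a central extension.\<close>

theorem projective_representation_degree_dvd:
  fixes G :: "('g, 'c) monoid_scheme" and U :: "'g \<Rightarrow> 'k::{alg_closed_field, field_char_0} mat"
  assumes "group G" "finite (carrier G)" "r > 0"
    and U: "\<And>g. g \<in> carrier G \<Longrightarrow> U g \<in> carrier_mat r r"
    and det: "\<And>g. g \<in> carrier G \<Longrightarrow> det (U g) \<noteq> 0"
    and proj: "\<And>g h. g \<in> carrier G \<Longrightarrow> h \<in> carrier G \<Longrightarrow> \<exists>c. U g * U h = c \<cdot>\<^sub>m U (g \<otimes>\<^bsub>G\<^esub> h)"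
    and commutant: "\<And>Y. Y \<in> carrier_mat r r \<Longrightarrow> (\<And>g. g \<in> carrier G \<Longrightarrow> U g * Y = Y * U g) \<Longrightarrow>
      \<exists>c. Y = c \<cdot>\<^sub>m 1\<^sub>m r"
  shows "r dvd card (carrier G)"
proof -
  interpret G: group G by fact
  \<comment> \<open>All multiples of determinant 1 are taken rather than one for each
    \<open>g\<close>; this makes the set closed under products and inverses. It stays finite because
    the scalars satisfy \<open>a ^ r = inverse (det (U g))\<close>.\<close>
  define \<Gamma> where "\<Gamma> = {M \<in> carrier_mat r r. det M = 1 \<and> (\<exists>g\<in>carrier G. \<exists>a. M = a \<cdot>\<^sub>m U g)}"
  have \<Gamma>_carrier: "M \<in> carrier_mat r r" if "M \<in> \<Gamma>" for M using that unfolding \<Gamma>_def by blast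
  have \<Gamma>I: "M \<in> \<Gamma>" if "M \<in> carrier_mat r r" "det M = 1" "g \<in> carrier G" "M = a \<cdot>\<^sub>m U g" for M g a
    using that unfolding \<Gamma>_def by blast
  have det_smult: "det (a \<cdot>\<^sub>m U g) = a ^ r * det (U g)" if "g \<in> carrier G" for a g
    using U[OF that] by simp
  have "finite \<Gamma>"
  proof (rule finite_subset)
    show "\<Gamma> \<subseteq> (\<Union>g\<in>carrier G. (\<lambda>a. a \<cdot>\<^sub>m U g) ` {a. a ^ r = inverse (det (U g))})"
    proof
      fix M assume "M \<in> \<Gamma>"
      then obtain g a where g: "g \<in> carrier G" "M = a \<cdot>\<^sub>m U g" "det M = 1" unfolding \<Gamma>_def by blast
      then have "a ^ r = inverse (det (U g))"
        using det_smult[OF g(1)] det[OF g(1)] by (simp add: field_simps)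
      then show "M \<in> (\<Union>g\<in>carrier G. (\<lambda>a. a \<cdot>\<^sub>m U g) ` {a. a ^ r = inverse (det (U g))})"
        using g by blast
    qed
  qed (use assms(2) finite_nth_roots[OF assms(3)] in auto)
  have \<Gamma>_mult: "M * M' \<in> \<Gamma>" if M: "M \<in> \<Gamma>" "M' \<in> \<Gamma>" for M M'
  proof -
    obtain g a h b where g: "g \<in> carrier G" "M = a \<cdot>\<^sub>m U g" and h: "h \<in> carrier G" "M' = b \<cdot>\<^sub>m U h"
      using M unfolding \<Gamma>_def by blast
    obtain c where c: "U g * U h = c \<cdot>\<^sub>m U (g \<otimes>\<^bsub>G\<^esub> h)" using proj g h by blast
    have "M * M' = (a * b * c) \<cdot>\<^sub>m U (g \<otimes>\<^bsub>G\<^esub> h)"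
      unfolding g(2) h(2) using U[OF g(1)] U[OF h(1)] c
      by (simp add: mult_smult_assoc_mat[of _ r r _ r] mult_smult_distrib[of _ r r _ r] smult_smult_mat ac_simps)
    moreover have "det (M * M') = 1" using M det_mult[of M r M'] unfolding \<Gamma>_def by auto
    moreover have "M * M' \<in> carrier_mat r r" using \<Gamma>_carrier[OF M(1)] \<Gamma>_carrier[OF M(2)] by simp
    ultimately show ?thesis using \<Gamma>I G.m_closed[OF g(1) h(1)] by simp
  qed
  have \<Gamma>_inv: "\<exists>M'\<in>\<Gamma>. M * M' = 1\<^sub>m r \<and> M' * M = 1\<^sub>m r" if M: "M \<in> \<Gamma>" for M
  proof -
    obtain g a where g: "g \<in> carrier G" "M = a \<cdot>\<^sub>m U g" "det M = 1" using M unfolding \<Gamma>_def by blast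
    have Mc: "M \<in> carrier_mat r r" using \<Gamma>_carrier[OF M] .
    note adj = adj_mat[OF Mc, unfolded g(3)]
    have inv: "M * adj_mat M = 1\<^sub>m r" "adj_mat M * M = 1\<^sub>m r" "adj_mat M \<in> carrier_mat r r" using adj by auto
    let ?h = "inv\<^bsub>G\<^esub> g"
    have h: "?h \<in> carrier G" using g by simp
    obtain c where c: "U g * U ?h = c \<cdot>\<^sub>m U \<one>\<^bsub>G\<^esub>" using proj[OF g(1) h] g(1) by auto
    obtain d where d: "U \<one>\<^bsub>G\<^esub> * U \<one>\<^bsub>G\<^esub> = d \<cdot>\<^sub>m U \<one>\<^bsub>G\<^esub>" using proj[of "\<one>\<^bsub>G\<^esub>" "\<one>\<^bsub>G\<^esub>"] by auto
    let ?E = "U \<one>\<^bsub>G\<^esub>"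
    have E: "?E \<in> carrier_mat r r" "det ?E \<noteq> 0" using U det by auto
    then obtain E' where E': "E' \<in> carrier_mat r r" "?E * E' = 1\<^sub>m r"
      using det_non_zero_imp_unit[OF E] by (auto simp: Units_def ring_mat_def)
    \<comment> \<open>For the unit of the group, projectivity only gives
      \<open>?E * ?E = d ?E\<close>. Cancelling the invertible matrix \<open>?E\<close> shows that
      it is the scalar \<open>d\<close>.\<close>
    have "?E = ?E * (?E * E')" unfolding E'(2) using E by simp
    also have "\<dots> = ?E * ?E * E'" by (rule assoc_mult_mat[OF E(1) E(1) E'(1), symmetric])
    also have "\<dots> = d \<cdot>\<^sub>m 1\<^sub>m r" unfolding d using E E' by (simp add: mult_smult_assoc_mat[of _ r r _ r])
    finally have Ed: "?E = d \<cdot>\<^sub>m 1\<^sub>m r" .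
    define k where "k = a * c * d"
    have MU: "M * U ?h = k \<cdot>\<^sub>m 1\<^sub>m r"
      unfolding g(2) k_def using U[OF g(1)] U[OF h] c Ed
      by (simp add: mult_smult_assoc_mat[of _ r r _ r] smult_smult_mat ac_simps)
    have "U ?h = adj_mat M * M * U ?h" unfolding inv(2) using U[OF h] by simp
    also have "\<dots> = adj_mat M * (M * U ?h)" by (rule assoc_mult_mat[OF inv(3) Mc U[OF h]])
    also have "\<dots> = k \<cdot>\<^sub>m adj_mat M" unfolding MU using inv by (simp add: mult_smult_distrib[of _ r r _ r])
    finally have Uh: "U ?h = k \<cdot>\<^sub>m adj_mat M" .
    then have "k \<noteq> 0" using det[OF h] inv(3) \<open>r > 0\<close> by auto
    then have "adj_mat M = inverse k \<cdot>\<^sub>m U ?h" unfolding Uh by (intro eq_matI) auto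
    moreover have "det (adj_mat M) = 1"
      using det_mult[OF Mc inv(3)] inv(1) g(3) by simp
    ultimately have "adj_mat M \<in> \<Gamma>" using \<Gamma>I[OF inv(3) _ h] by simp
    then show ?thesis using inv by blast
  qed
  have "\<exists>a. a \<cdot>\<^sub>m U g \<in> \<Gamma>" if g: "g \<in> carrier G" for g
  proof -
    obtain a where "a ^ r = inverse (det (U g))" using nth_root_exists[OF assms(3)] by blast
    then have "det (a \<cdot>\<^sub>m U g) = 1" using det_smult[OF g] det[OF g] by simp
    then show ?thesis using U[OF g] g unfolding \<Gamma>_def by auto
  qed
  then obtain \<alpha> where \<alpha>: "\<And>g. g \<in> carrier G \<Longrightarrow> \<alpha> g \<cdot>\<^sub>m U g \<in> \<Gamma>" by metis
  define V where "V g = \<alpha> g \<cdot>\<^sub>m U g" for g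
  have V\<Gamma>: "V g \<in> \<Gamma>" if "g \<in> carrier G" for g using \<alpha> that unfolding V_def by blast
  define W where "W g = (SOME M'. M' \<in> \<Gamma> \<and> V g * M' = 1\<^sub>m r \<and> M' * V g = 1\<^sub>m r)" for g
  have W: "W g \<in> \<Gamma> \<and> V g * W g = 1\<^sub>m r \<and> W g * V g = 1\<^sub>m r" if g: "g \<in> carrier G" for g
  proof -
    have "\<exists>M'. M' \<in> \<Gamma> \<and> V g * M' = 1\<^sub>m r \<and> M' * V g = 1\<^sub>m r"
      using \<Gamma>_inv[OF V\<Gamma>[OF g]] by blast
    then show ?thesis unfolding W_def by (rule someI_ex)
  qed
  note Vc = \<Gamma>_carrier[OF V\<Gamma>]
  have Wc: "W g \<in> carrier_mat r r" if "g \<in> carrier G" for g using W[OF that] \<Gamma>_carrier by blast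
  have \<alpha>0: "\<alpha> g \<noteq> 0" if "g \<in> carrier G" for g
    using V\<Gamma>[OF that] U[OF that] \<open>r > 0\<close> unfolding \<Gamma>_def V_def by (auto simp: zero_power)
  \<comment> \<open>The same factor \<zeta> occurs in both equations. It can therefore be moved from
    the \<open>V\<close>-part to the \<open>W\<close>-part of a product, so the averaging below
    works although \<open>V\<close> is multiplicative only up to scalars.\<close>
  have cocycle: "\<exists>\<zeta>. V h * V g = \<zeta> \<cdot>\<^sub>m V (h \<otimes>\<^bsub>G\<^esub> g) \<and> W (h \<otimes>\<^bsub>G\<^esub> g) * V h = \<zeta> \<cdot>\<^sub>m W g"
    if h: "h \<in> carrier G" and g: "g \<in> carrier G" for h g
  proof -
    let ?hg = "h \<otimes>\<^bsub>G\<^esub> g"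
    have hg: "?hg \<in> carrier G" using g h by simp
    obtain c where c: "U h * U g = c \<cdot>\<^sub>m U ?hg" using proj g h by blast
    define \<zeta> where "\<zeta> = \<alpha> h * \<alpha> g * c / \<alpha> ?hg"
    have 1: "V h * V g = \<zeta> \<cdot>\<^sub>m V ?hg"
      unfolding V_def \<zeta>_def using U[OF g] U[OF h] c \<alpha>0[OF hg]
      by (simp add: mult_smult_assoc_mat[of _ r r _ r] mult_smult_distrib[of _ r r _ r] smult_smult_mat ac_simps)
    have "W ?hg * V h = W ?hg * V h * (V g * W g)"
      unfolding conjunct1[OF conjunct2[OF W[OF g]]] using Wc[OF hg] Vc[OF h] by simp
    also have "\<dots> = W ?hg * (V h * V g) * W g"
      using Wc[OF hg] Wc[OF g] Vc[OF g] Vc[OF h] by (simp add: assoc_mult_mat[of _ r r _ r _ r])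
    also have "\<dots> = \<zeta> \<cdot>\<^sub>m (W ?hg * V ?hg) * W g"
      unfolding 1 using Wc[OF hg] Vc[OF hg] by (simp add: mult_smult_distrib[of _ r r _ r])
    also have "\<dots> = \<zeta> \<cdot>\<^sub>m W g"
      using W[OF hg] Wc[OF g] by (simp add: mult_smult_assoc_mat[of _ r r _ r])
    finally show ?thesis using 1 by blast
  qed
  define z :: 'k where "z = of_nat (card (carrier G)) / of_nat r"
  have schur: "(\<Sum>g\<in>carrier G. V g $$ (a, b) * W g $$ (c, d)) = (if a = d \<and> b = c then z else 0)"
    if lt: "a < r" "b < r" "c < r" "d < r" for a b c d
  proof -
    \<comment> \<open>This is the average of \<open>V g * X * W g\<close> over the group for the
      matrix unit X with entry 1 at \<open>(b, c)\<close>. It commutes with every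
      \<open>V h\<close>, so \<open>commutant\<close> makes it a scalar.\<close>
    define Y where "Y = mat r r (\<lambda>(a, d). \<Sum>g\<in>carrier G. V g $$ (a, b) * W g $$ (c, d))"
    have Yc: "Y \<in> carrier_mat r r" unfolding Y_def by simp
    have comm: "V h * Y = Y * V h" if h: "h \<in> carrier G" for h
    proof (rule eq_matI)
      fix p q assume "p < dim_row (Y * V h)" "q < dim_col (Y * V h)"
      then have p: "p < r" and q: "q < r" using Yc Vc[OF h] by auto
      have "(V h * Y) $$ (p, q) = (\<Sum>t<r. V h $$ (p, t) * (\<Sum>g\<in>carrier G. V g $$ (t, b) * W g $$ (c, q)))"
        using index_mult_mat_sum[OF Vc[OF h] Yc p q] q unfolding Y_def by simp
      also have "\<dots> = (\<Sum>g\<in>carrier G. (\<Sum>t<r. V h $$ (p, t) * V g $$ (t, b)) * W g $$ (c, q))"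
        by (simp add: sum_distrib_left sum_distrib_right mult.assoc) (rule sum.swap)
      also have "\<dots> = (\<Sum>g\<in>carrier G. (V h * V g) $$ (p, b) * W g $$ (c, q))"
        using index_mult_mat_sum[OF Vc[OF h] Vc p lt(2)] by simp
      also have "\<dots> = (\<Sum>g\<in>carrier G. V (h \<otimes>\<^bsub>G\<^esub> g) $$ (p, b) * (W (h \<otimes>\<^bsub>G\<^esub> g) * V h) $$ (c, q))"
      proof (rule sum.cong)
        fix g assume g: "g \<in> carrier G"
        then have hg: "h \<otimes>\<^bsub>G\<^esub> g \<in> carrier G" using h by simp
        from cocycle[OF h g] Vc[OF hg] Wc[OF g] p q lt
        show "(V h * V g) $$ (p, b) * W g $$ (c, q) =
            V (h \<otimes>\<^bsub>G\<^esub> g) $$ (p, b) * (W (h \<otimes>\<^bsub>G\<^esub> g) * V h) $$ (c, q)"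
          by auto
      qed simp
      also have "\<dots> = (\<Sum>g\<in>carrier G. V g $$ (p, b) * (W g * V h) $$ (c, q))"
      proof (rule sum.reindex_bij_betw)
        show "bij_betw ((\<otimes>\<^bsub>G\<^esub>) h) (carrier G) (carrier G)"
        proof (rule bij_betw_byWitness[where f' = "(\<otimes>\<^bsub>G\<^esub>) (inv\<^bsub>G\<^esub> h)"])
        qed (use h in \<open>auto simp: G.m_assoc[symmetric]\<close>)
      qed
      also have "\<dots> = (\<Sum>g\<in>carrier G. V g $$ (p, b) * (\<Sum>t<r. W g $$ (c, t) * V h $$ (t, q)))"
        using index_mult_mat_sum[OF Wc Vc[OF h] lt(3) q] by simp
      also have "\<dots> = (\<Sum>t<r. (\<Sum>g\<in>carrier G. V g $$ (p, b) * W g $$ (c, t)) * V h $$ (t, q))"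
        by (simp add: sum_distrib_left sum_distrib_right mult.assoc) (rule sum.swap)
      also have "\<dots> = (Y * V h) $$ (p, q)"
        using index_mult_mat_sum[OF Yc Vc[OF h] p q] p unfolding Y_def by simp
      finally show "(V h * Y) $$ (p, q) = (Y * V h) $$ (p, q)" .
    qed (use Yc Vc[OF h] in auto)
    have "U h * Y = Y * U h" if h: "h \<in> carrier G" for h
    proof -
      have "\<alpha> h \<cdot>\<^sub>m (U h * Y) = \<alpha> h \<cdot>\<^sub>m (Y * U h)"
        using comm[OF h] U[OF h] Yc unfolding V_def
        by (simp add: mult_smult_assoc_mat[of _ r r _ r] mult_smult_distrib[of _ r r _ r])
      then have "inverse (\<alpha> h) \<cdot>\<^sub>m (\<alpha> h \<cdot>\<^sub>m (U h * Y)) = inverse (\<alpha> h) \<cdot>\<^sub>m (\<alpha> h \<cdot>\<^sub>m (Y * U h))" by simp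
      then show ?thesis using \<alpha>0[OF h] by (simp add: smult_smult_mat one_smult_mat)
    qed
    then obtain s where s: "Y = s \<cdot>\<^sub>m 1\<^sub>m r" using commutant[OF Yc] by blast
    \<comment> \<open>The scalar is found from the trace of \<open>Y\<close>: cyclic rearrangement
      turns each summand into an entry of \<open>W g * V g\<close>, the identity matrix.\<close>
    have "of_nat r * s = (\<Sum>t<r. Y $$ (t, t))" unfolding s by simp
    also have "\<dots> = (\<Sum>t<r. \<Sum>g\<in>carrier G. W g $$ (c, t) * V g $$ (t, b))" unfolding Y_def by (simp add: ac_simps)
    also have "\<dots> = (\<Sum>g\<in>carrier G. \<Sum>t<r. W g $$ (c, t) * V g $$ (t, b))" by (rule sum.swap)
    also have "\<dots> = (\<Sum>g\<in>carrier G. (W g * V g) $$ (c, b))"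
      using index_mult_mat_sum[OF Wc Vc lt(3,2)] by simp
    also have "\<dots> = (\<Sum>g\<in>carrier G. if b = c then 1 else 0)" using W lt by (intro sum.cong) auto
    also have "\<dots> = (if b = c then of_nat (card (carrier G)) else 0)" by simp
    finally have "s = (if b = c then z else 0)"
      using \<open>r > 0\<close> unfolding z_def by (auto simp: field_simps)
    moreover have "(\<Sum>g\<in>carrier G. V g $$ (a, b) * W g $$ (c, d)) = Y $$ (a, d)" unfolding Y_def using lt by simp
    ultimately show ?thesis using lt unfolding s by auto
  qed
  \<comment> \<open>Products of two entries, since the orthogonality relation is bilinear: one
    factor absorbs \<open>V g\<close> and the other \<open>W g\<close>.\<close>
  define S where "S = (\<lambda>(M, M', p, b, s, d). M $$ (p, b) * M' $$ (s, d)) ` (\<Gamma> \<times> \<Gamma> \<times> {..<r} \<times> {..<r} \<times> {..<r} \<times> {..<r})"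
  let ?M = "V \<one>\<^bsub>G\<^esub>"
  have M: "?M \<in> \<Gamma>" "?M \<in> carrier_mat r r" using V\<Gamma> Vc by auto
  have "\<exists>p<r. \<exists>b<r. ?M $$ (p, b) \<noteq> 0"
  proof (rule ccontr)
    assume "\<not> ?thesis"
    then have "?M = 0\<^sub>m r r" using M(2) by (intro eq_matI) auto
    moreover have "det ?M = 1" using M(1) unfolding \<Gamma>_def by blast
    ultimately show False using \<open>r > 0\<close> by simp
  qed
  then obtain p b where pb: "p < r" "b < r" "?M $$ (p, b) \<noteq> 0" by blast
  have "algebraic_int z"
  proof (rule algebraic_int_if_finite_invariant[where ?'i = 'g and S = S])
    show "finite S" unfolding S_def using \<open>finite \<Gamma>\<close> by simp
    show "?M $$ (p, b) * ?M $$ (p, b) \<noteq> 0" using pb by simp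
    show "?M $$ (p, b) * ?M $$ (p, b) \<in> S" unfolding S_def using pb M
      by (intro image_eqI[of _ _ "(?M, ?M, p, b, p, b)"]) auto
    fix x assume "x \<in> S"
    then obtain M M' s b p d where MM: "M \<in> \<Gamma>" "M' \<in> \<Gamma>" and lt: "s < r" "b < r" "p < r" "d < r"
      and x: "x = M $$ (s, b) * M' $$ (p, d)" unfolding S_def by auto
    note Mc = \<Gamma>_carrier[OF MM(1)] \<Gamma>_carrier[OF MM(2)]
    \<comment> \<open>Row indices \<open>p\<close> and \<open>s\<close> trade places compared with
      \<open>x\<close>. The orthogonality relation pairs the outer index of \<open>V g\<close> with
      the inner one of \<open>W g\<close>, and vice versa, so that summing \<open>?f\<close>
      restores \<open>x\<close> up to the factor \<open>z\<close>.\<close>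
    let ?f = "\<lambda>g. (V g * M) $$ (p, b) * (W g * M') $$ (s, d)"
    have "sum ?f (carrier G) = (\<Sum>g\<in>carrier G. (\<Sum>q<r. V g $$ (p, q) * M $$ (q, b)) * (\<Sum>t<r. W g $$ (s, t) * M' $$ (t, d)))"
      using index_mult_mat_sum[OF Vc Mc(1) lt(3,2)] index_mult_mat_sum[OF Wc Mc(2) lt(1,4)] by simp
    also have "\<dots> = (\<Sum>g\<in>carrier G. \<Sum>q<r. \<Sum>t<r. V g $$ (p, q) * W g $$ (s, t) * (M $$ (q, b) * M' $$ (t, d)))"
      by (simp only: sum_product) (simp add: ac_simps)
    also have "\<dots> = (\<Sum>q<r. \<Sum>t<r. (\<Sum>g\<in>carrier G. V g $$ (p, q) * W g $$ (s, t)) * (M $$ (q, b) * M' $$ (t, d)))"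
      by (subst sum.swap, intro sum.cong refl, subst sum.swap) (simp add: sum_distrib_right)
    also have "\<dots> = (\<Sum>q<r. \<Sum>t<r. if p = t \<and> q = s then z * (M $$ (q, b) * M' $$ (t, d)) else 0)"
      using schur lt by (intro sum.cong refl) auto
    also have "\<dots> = (\<Sum>q<r. if q = s then z * (M $$ (q, b) * M' $$ (p, d)) else 0)"
      using lt by (intro sum.cong refl) (auto simp: if_distrib cong: if_cong)
    also have "\<dots> = z * x" unfolding x using lt by simp
    finally have "z * x = sum ?f (carrier G)" by simp
    moreover have "?f ` carrier G \<subseteq> S"
    proof
      fix y assume "y \<in> ?f ` carrier G"
      then obtain g where g: "g \<in> carrier G" "y = ?f g" by blast
      have "V g * M \<in> \<Gamma>" "W g * M' \<in> \<Gamma>" using \<Gamma>_mult MM V\<Gamma> W g(1) by auto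
      then show "y \<in> S" unfolding S_def g(2) using lt
        by (intro image_eqI[of _ _ "(V g * M, W g * M', p, b, s, d)"]) auto
    qed
    ultimately show "\<exists>I (f :: 'g \<Rightarrow> 'k). finite I \<and> f ` I \<subseteq> S \<and> z * x = sum f I"
      using assms(2) by - (rule exI[of _ "carrier G"], rule exI[of _ ?f], intro conjI)
  qed
  moreover have "z \<in> \<rat>" unfolding z_def by (intro Rats_divide) auto
  ultimately have "z \<in> \<int>" by (rule rational_algebraic_int_is_int)
  then obtain m where "z = of_int m" by (elim Ints_cases)
  then have "(of_int (int (card (carrier G))) :: 'k) = of_int (m * int r)"
    using \<open>r > 0\<close> unfolding z_def by (simp add: field_simps)
  then have "int r dvd int (card (carrier G))" by (metis dvd_triv_right of_int_eq_iff)
  then show ?thesis by simp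
qed

section \<open>Differential operators along a finite separable extension\<close>

locale field_basis = field_hom i
  for i :: "'K::field \<Rightarrow> 'L::field" +
  fixes w :: "nat \<Rightarrow> 'L" and \<phi> :: "'L \<Rightarrow> nat \<Rightarrow> 'K" and d :: nat
  assumes expand: "(\<Sum>s<d. i (\<phi> y s) * w s) = y"
    and coord: "s < d \<Longrightarrow> \<phi> (\<Sum>t<d. i (c t) * w t) s = c s"
begin

lemma coord_eqI:
  assumes "(\<Sum>t<d. i (c t) * w t) = y" "s < d"
  shows "\<phi> y s = c s"
  using coord[OF assms(2)] assms(1) by metis

lemma coord_add: "s < d \<Longrightarrow> \<phi> (x + y) s = \<phi> x s + \<phi> y s"
  by (rule coord_eqI[where c = "\<lambda>s. \<phi> x s + \<phi> y s"])
    (simp_all add: hom_distribs distrib_right sum.distrib expand)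

lemma coord_mult: "s < d \<Longrightarrow> \<phi> (i c * y) s = c * \<phi> y s"
proof (rule coord_eqI[where c = "\<lambda>s. c * \<phi> y s"])
  have "(\<Sum>t<d. i (c * \<phi> y t) * w t) = i c * (\<Sum>t<d. i (\<phi> y t) * w t)"
    by (simp add: sum_distrib_left hom_distribs mult.assoc)
  then show "(\<Sum>t<d. i (c * \<phi> y t) * w t) = i c * y" unfolding expand .
qed

lemma coord_0: "s < d \<Longrightarrow> \<phi> 0 s = 0"
  using coord_mult[of s 0 0] by simp

lemma coord_uminus: "s < d \<Longrightarrow> \<phi> (- y) s = - \<phi> y s"
  using coord_mult[of s "-1" y] by (simp add: hom_distribs)

lemma coord_diff: "s < d \<Longrightarrow> \<phi> (x - y) s = \<phi> x s - \<phi> y s"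
  using coord_add[of s x "- y"] coord_uminus[of s y] by simp

lemma coord_sum: "s < d \<Longrightarrow> \<phi> (sum f I) s = (\<Sum>x\<in>I. \<phi> (f x) s)"
  by (induction I rule: infinite_finite_induct) (auto simp: coord_0 coord_add)

lemma coord_mult_expand: "s < d \<Longrightarrow> \<phi> (b * y) s = (\<Sum>t<d. \<phi> y t * \<phi> (b * w t) s)"
proof -
  assume s: "s < d"
  have "b * y = (\<Sum>t<d. i (\<phi> y t) * (b * w t))"
    by (subst expand[of y, symmetric]) (simp add: sum_distrib_left ac_simps)
  then show ?thesis using s by (simp add: coord_sum coord_mult)
qed

lemma coord_basis: "s < d \<Longrightarrow> t < d \<Longrightarrow> \<phi> (w t) s = (if s = t then 1 else 0)"
proof (rule coord_eqI[where c = "\<lambda>s. if s = t then 1 else 0"])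
  assume "t < d"
  have "(\<Sum>q<d. i (if q = t then 1 else 0) * w q) = (\<Sum>q<d. if q = t then w q else 0)"
    by (intro sum.cong) auto
  then show "(\<Sum>q<d. i (if q = t then 1 else 0) * w q) = w t" using \<open>t < d\<close> by simp
qed

lemma d_pos: "d > 0"
  using expand[of 1] by (cases d) auto

section \<open>The trace of multiplication operators and its dual basis\<close>

definition tr :: "'L \<Rightarrow> 'K" where "tr y = (\<Sum>s<d. \<phi> (y * w s) s)"

lemma tr_add: "tr (x + y) = tr x + tr y"
  unfolding tr_def by (simp add: distrib_right coord_add sum.distrib)

lemma tr_mult: "tr (i c * y) = c * tr y"
  unfolding tr_def by (simp add: mult.assoc coord_mult sum_distrib_left)

lemma tr_sum: "tr (sum f I) = (\<Sum>x\<in>I. tr (f x))"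
  using tr_mult[of 0 0] by (induction I rule: infinite_finite_induct) (auto simp: tr_add)

lemma tr_diff: "tr (x - y) = tr x - tr y"
  using tr_add[of x "i (-1) * y"] tr_mult[of "-1" y] by (simp add: hom_distribs)

text \<open>An element \<open>y \<noteq> 0\<close> orthogonal to a basis is orthogonal to its own
  inverse, so \<open>tr 1 = 0\<close>; but \<open>tr 1\<close> is the degree \<open>d\<close>,
  assumed nonzero in \<open>K\<close>.\<close>

lemma tr_nondegenerate:
  assumes "of_nat d \<noteq> (0 :: 'K)" "\<And>s. s < d \<Longrightarrow> tr (y * w s) = 0"
  shows "y = 0"
proof (rule ccontr)
  assume "y \<noteq> 0"
  have "tr (y * z) = 0" for z
  proof -
    have "y * z = (\<Sum>s<d. i (\<phi> z s) * (y * w s))"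
      by (subst expand[of z, symmetric]) (simp add: sum_distrib_left ac_simps)
    then show ?thesis using assms(2) by (simp add: tr_sum tr_mult)
  qed
  from this[of "inverse y"] have "tr 1 = 0" using \<open>y \<noteq> 0\<close> by simp
  moreover have "tr 1 = of_nat d" unfolding tr_def by (simp add: coord_basis)
  ultimately show False using assms(1) by simp
qed

text \<open>A kernel vector of the Gram matrix of the trace form would give an element orthogonal to
  the basis. Hence the matrix is invertible, and the rows of its inverse are the coordinates of the
  dual basis.\<close>

lemma trace_dual_basis_exists:
  assumes "of_nat d \<noteq> (0 :: 'K)"
  obtains u where "\<And>s t. s < d \<Longrightarrow> t < d \<Longrightarrow> tr (u s * w t) = (if s = t then 1 else 0)"
proof -
  define M where "M = mat d d (\<lambda>(s, t). tr (w s * w t))"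
  have M: "M \<in> carrier_mat d d" unfolding M_def by simp
  have "det M \<noteq> 0"
  proof
    assume "det M = 0"
    then obtain v where v: "v \<in> carrier_vec d" "v \<noteq> 0\<^sub>v d" "M *\<^sub>v v = 0\<^sub>v d"
      using det_0_iff_vec_prod_zero_field[OF M] by blast
    define y where "y = (\<Sum>t<d. i (v $ t) * w t)"
    have "tr (y * w s) = 0" if s: "s < d" for s
    proof -
      have "tr (y * w s) = (\<Sum>t<d. M $$ (s, t) * v $ t)"
      proof -
        have "y * w s = (\<Sum>t<d. i (v $ t) * (w s * w t))"
          unfolding y_def by (subst sum_distrib_right) (simp add: ac_simps)
        then show ?thesis unfolding M_def using s by (simp add: tr_sum tr_mult mult.commute)
      qed
      also have "\<dots> = (M *\<^sub>v v) $ s"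
        using s v(1) M by (simp add: scalar_prod_def lessThan_atLeast0)
      also have "\<dots> = 0" using v(3) s by simp
      finally show ?thesis .
    qed
    then have "y = 0" using tr_nondegenerate[OF assms] by blast
    then have "v $ t = 0" if "t < d" for t
      using coord[OF that, of "\<lambda>t. v $ t"] coord_0[OF that] unfolding y_def by metis
    then show False using v(1,2) by (auto intro: eq_vecI)
  qed
  then obtain N where N: "N \<in> carrier_mat d d" "N * M = 1\<^sub>m d"
    using det_non_zero_imp_unit[OF M] by (auto simp: Units_def ring_mat_def)
  show thesis
  proof (rule that)
    fix s t assume st: "s < d" "t < d"
    have "tr ((\<Sum>q<d. i (N $$ (s, q)) * w q) * w t) = (\<Sum>q<d. N $$ (s, q) * M $$ (q, t))"
      unfolding M_def using st by (simp add: sum_distrib_right tr_sum tr_mult mult.assoc)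
    also have "\<dots> = (N * M) $$ (s, t)"
      using st N(1) M by (simp add: scalar_prod_def lessThan_atLeast0)
    finally show "tr ((\<Sum>q<d. i (N $$ (s, q)) * w q) * w t) = (if s = t then 1 else 0)"
      using N(2) st by simp
  qed
qed

text \<open>The element \<open>\<Sum> u\<^sub>s \<otimes> w\<^sub>s\<close> of \<open>L \<otimes>\<^sub>K L\<close> is the separability idempotent.\<close>
lemma separability_idempotent_exists:
  assumes "of_nat d \<noteq> (0 :: 'K)"
  obtains u where "(\<Sum>s<d. u s * w s) = 1"
    "\<And>b t. t < d \<Longrightarrow> (\<Sum>s<d. u s * i (\<phi> (b * w s) t)) = b * u t"
proof -
  obtain u where u: "\<And>s t. s < d \<Longrightarrow> t < d \<Longrightarrow> tr (u s * w t) = (if s = t then 1 else 0)"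
    using trace_dual_basis_exists[OF assms] by blast
  \<comment> \<open>Pairing with the dual basis reads off coordinates. Both claimed identities are
    then tested against the basis under the trace form.\<close>
  have tru: "tr (u s * y) = \<phi> y s" if "s < d" for s y
  proof -
    have "u s * y = (\<Sum>t<d. i (\<phi> y t) * (u s * w t))"
      by (subst expand[of y, symmetric]) (simp add: sum_distrib_left ac_simps)
    then have "tr (u s * y) = (\<Sum>t<d. \<phi> y t * tr (u s * w t))" by (simp add: tr_sum tr_mult)
    also have "\<dots> = (\<Sum>t<d. if s = t then \<phi> y t else 0)" using u[OF that] by (intro sum.cong) auto
    finally show ?thesis using that by simp
  qed
  show thesis
  proof (rule that)
    have "tr (((\<Sum>s<d. u s * w s) - 1) * w t) = 0" if "t < d" for t
    proof -
      have "tr ((\<Sum>s<d. u s * w s) * w t) = (\<Sum>s<d. \<phi> (w t * w s) s)"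
      proof -
        have "(\<Sum>s<d. u s * w s) * w t = (\<Sum>s<d. u s * (w t * w s))"
          by (subst sum_distrib_right) (simp add: ac_simps)
        then show ?thesis by (simp add: tr_sum tru)
      qed
      also have "\<dots> = tr (w t)" unfolding tr_def ..
      finally show ?thesis by (simp add: left_diff_distrib tr_diff)
    qed
    from tr_nondegenerate[OF assms this] show "(\<Sum>s<d. u s * w s) = 1" by simp
    fix b t assume t: "t < d"
    have "tr (((\<Sum>s<d. u s * i (\<phi> (b * w s) t)) - b * u t) * w q) = 0" if q: "q < d" for q
    proof -
      have "(\<Sum>s<d. u s * i (\<phi> (b * w s) t)) * w q = (\<Sum>s<d. i (\<phi> (b * w s) t) * (u s * w q))"
        by (subst sum_distrib_right) (simp add: ac_simps)
      then have "tr ((\<Sum>s<d. u s * i (\<phi> (b * w s) t)) * w q) = (\<Sum>s<d. \<phi> (b * w s) t * tr (u s * w q))"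
        by (simp add: tr_sum tr_mult)
      also have "\<dots> = (\<Sum>s<d. if s = q then \<phi> (b * w s) t else 0)" using u q by (intro sum.cong) auto
      also have "\<dots> = \<phi> (b * w q) t" using q by simp
      also have "\<dots> = tr (b * u t * w q)" using tru[OF t, of "b * w q"] by (simp add: ac_simps)
      finally show ?thesis by (simp add: left_diff_distrib tr_diff)
    qed
    from tr_nondegenerate[OF assms this] show "(\<Sum>s<d. u s * i (\<phi> (b * w s) t)) = b * u t" by simp
  qed
qed

end

section \<open>Linear operators and the order filtration\<close>

definition linear_operator :: "('k::field \<Rightarrow> 'a::field) \<Rightarrow> ('a \<Rightarrow> 'a) \<Rightarrow> bool" where
  "linear_operator j P \<longleftrightarrow> (\<forall>x y. P (x + y) = P x + P y) \<and> (\<forall>c x. P (j c * x) = j c * P x)"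

lemma linear_operatorD:
  assumes "linear_operator j P"
  shows "P (x + y) = P x + P y" "P (j c * x) = j c * P x" "P 0 = 0" "P (- x) = - P x"
    "P (x - y) = P x - P y" "P (sum f I) = (\<Sum>t\<in>I. P (f t))"
proof -
  show add: "P (x + y) = P x + P y" for x y using assms unfolding linear_operator_def by blast
  show "P (j c * x) = j c * P x" using assms unfolding linear_operator_def by blast
  show zero: "P 0 = 0" using add[of 0 0] by (metis add.right_neutral add_left_cancel)
  show uminus: "P (- x) = - P x" for x using add[of x "- x"] zero by (simp add: eq_neg_iff_add_eq_0 add.commute)
  show "P (x - y) = P x - P y" using add[of x "- y"] uminus[of y] by simp
  show "P (sum f I) = (\<Sum>t\<in>I. P (f t))"
    by (induction I rule: infinite_finite_induct) (auto simp: add zero)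
qed

lemma linear_operatorI:
  "(\<And>x y. P (x + y) = P x + P y) \<Longrightarrow> (\<And>c x. P (j c * x) = j c * P x) \<Longrightarrow> linear_operator j P"
  unfolding linear_operator_def by blast

lemma linear_iff_linear_operator:
  assumes "field_hom j"
  shows "Vector_Spaces.linear (\<lambda>c x. j c * x) (\<lambda>c x. j c * x) P \<longleftrightarrow> linear_operator j P"
proof -
  interpret field_hom j by fact
  have "vector_space (\<lambda>c x. j c * x)"
    by unfold_locales (auto simp: algebra_simps hom_distribs)
  then show ?thesis
    unfolding Vector_Spaces.linear_def module_hom_def module_hom_axioms_def linear_operator_def
    by (auto simp: module_iff_vector_space)
qed

lemma linear_operator_add:
  assumes "linear_operator j P" "linear_operator j Q"
  shows "linear_operator j (\<lambda>x. P x + Q x)"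
  by (rule linear_operatorI)
    (simp_all add: linear_operatorD[OF assms(1)] linear_operatorD[OF assms(2)] distrib_left)

lemma linear_operator_lmult:
  assumes "linear_operator j P"
  shows "linear_operator j (\<lambda>x. b * P x)"
  by (rule linear_operatorI) (simp_all add: linear_operatorD[OF assms] distrib_left mult.left_commute)

declare diff_ops_of_order.simps [simp del]

context
  fixes j :: "'k::field \<Rightarrow> 'a::field"
  assumes j: "field_hom j"
begin

lemma diff_ops_0_iff:
  "P \<in> diff_ops_of_order j 0 \<longleftrightarrow> linear_operator j P \<and> (\<forall>a x. P (a * x) = a * P x)"
  by (simp add: diff_ops_of_order.simps linear_iff_linear_operator[OF j])

lemma diff_ops_Suc_iff:
  "P \<in> diff_ops_of_order j (Suc n) \<longleftrightarrow>
     linear_operator j P \<and> (\<forall>a. (\<lambda>x. P (a * x) - a * P x) \<in> diff_ops_of_order j n)"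
  by (simp add: diff_ops_of_order.simps linear_iff_linear_operator[OF j])

lemma diff_ops_linear: "P \<in> diff_ops_of_order j n \<Longrightarrow> linear_operator j P"
  by (cases n) (simp_all only: diff_ops_0_iff diff_ops_Suc_iff)

lemma diff_ops_mult: "(\<lambda>x. a * x) \<in> diff_ops_of_order j 0"
  unfolding diff_ops_0_iff by (auto intro!: linear_operatorI simp: algebra_simps)

lemma diff_ops_derivation:
  assumes "\<And>x y. \<theta> (x + y) = \<theta> x + \<theta> y" "\<And>x y. \<theta> (x * y) = x * \<theta> y + \<theta> x * y" "\<And>a. \<theta> (j a) = 0"
  shows "\<theta> \<in> diff_ops_of_order j (Suc 0)"
  unfolding diff_ops_Suc_iff
proof (intro conjI allI)
  show "linear_operator j \<theta>" by (intro linear_operatorI) (simp_all add: assms)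
  fix a
  show "(\<lambda>x. \<theta> (a * x) - a * \<theta> x) \<in> diff_ops_of_order j 0"
    using diff_ops_mult[of "\<theta> a"] by (simp add: assms)
qed

lemma diff_ops_add:
  "P \<in> diff_ops_of_order j n \<Longrightarrow> Q \<in> diff_ops_of_order j n \<Longrightarrow> (\<lambda>x. P x + Q x) \<in> diff_ops_of_order j n"
proof (induction n arbitrary: P Q)
  case 0
  then show ?case unfolding diff_ops_0_iff by (simp add: linear_operator_add distrib_left)
next
  case (Suc n)
  have "(\<lambda>x. (P (a * x) - a * P x) + (Q (a * x) - a * Q x)) \<in> diff_ops_of_order j n" for a
    using Suc unfolding diff_ops_Suc_iff by blast
  moreover have "linear_operator j (\<lambda>x. P x + Q x)"
    using Suc(2,3) unfolding diff_ops_Suc_iff by (simp add: linear_operator_add)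
  ultimately show ?case unfolding diff_ops_Suc_iff by (simp add: algebra_simps)
qed

lemma diff_ops_lmult: "P \<in> diff_ops_of_order j n \<Longrightarrow> (\<lambda>x. b * P x) \<in> diff_ops_of_order j n"
proof (induction n arbitrary: P)
  case 0
  then show ?case unfolding diff_ops_0_iff by (simp add: linear_operator_lmult mult.left_commute)
next
  case (Suc n)
  have "(\<lambda>x. b * (P (a * x) - a * P x)) \<in> diff_ops_of_order j n" for a
    using Suc unfolding diff_ops_Suc_iff by blast
  moreover have "linear_operator j (\<lambda>x. b * P x)"
    using Suc(2) unfolding diff_ops_Suc_iff by (simp add: linear_operator_lmult)
  ultimately show ?case unfolding diff_ops_Suc_iff by (simp add: algebra_simps)
qed

lemma diff_ops_zero: "(\<lambda>x. 0) \<in> diff_ops_of_order j n"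
  by (induction n) (auto simp: diff_ops_0_iff diff_ops_Suc_iff intro!: linear_operatorI)

lemma diff_ops_sum:
  "(\<And>t. t \<in> I \<Longrightarrow> P t \<in> diff_ops_of_order j n) \<Longrightarrow> (\<lambda>x. \<Sum>t\<in>I. P t x) \<in> diff_ops_of_order j n"
  by (induction I rule: infinite_finite_induct) (simp_all add: diff_ops_zero diff_ops_add)

text \<open>The commutator of \<open>\<sigma> \<circ> P \<circ> \<tau>\<close> with \<open>a\<close>
  is the conjugate of the commutator of \<open>P\<close> with \<open>\<tau> a\<close>, so the order
  is preserved by induction.\<close>

lemma diff_ops_conjugate:
  assumes \<sigma>: "\<And>x y. \<sigma> (x + y) = \<sigma> x + \<sigma> y" "\<And>x y. \<sigma> (x * y) = \<sigma> x * \<sigma> y" "\<And>c. \<sigma> (j c) = j c"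
    and \<tau>: "\<And>x. \<sigma> (\<tau> x) = x" "\<And>x. \<tau> (\<sigma> x) = x"
  shows "P \<in> diff_ops_of_order j n \<Longrightarrow> (\<lambda>x. \<sigma> (P (\<tau> x))) \<in> diff_ops_of_order j n"
proof -
  have \<tau>h: "\<tau> (x + y) = \<tau> x + \<tau> y" "\<tau> (x * y) = \<tau> x * \<tau> y" "\<tau> (j c) = j c" for x y c
    using \<sigma> \<tau> by metis+
  have \<sigma>d: "\<sigma> (x - y) = \<sigma> x - \<sigma> y" for x y using \<sigma>(1)[of "x - y" y] by simp
  show "P \<in> diff_ops_of_order j n \<Longrightarrow> (\<lambda>x. \<sigma> (P (\<tau> x))) \<in> diff_ops_of_order j n"
  proof (induction n arbitrary: P)
    case 0
    then show ?case unfolding diff_ops_0_iff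
      by (auto intro!: linear_operatorI simp: linear_operatorD \<sigma> \<tau> \<tau>h)
  next
    case (Suc n)
    have "(\<lambda>x. \<sigma> (P (\<tau> a * \<tau> x) - \<tau> a * P (\<tau> x))) \<in> diff_ops_of_order j n" for a
      using Suc(1)[of "\<lambda>x. P (\<tau> a * x) - \<tau> a * P x"] Suc(2) unfolding diff_ops_Suc_iff by blast
    moreover have "linear_operator j (\<lambda>x. \<sigma> (P (\<tau> x)))"
      using Suc(2) unfolding diff_ops_Suc_iff by (auto intro!: linear_operatorI simp: linear_operatorD \<sigma> \<tau>h)
    ultimately show ?case unfolding diff_ops_Suc_iff by (simp add: \<sigma> \<sigma>d \<tau> \<tau>h)
  qed
qed

end

section \<open>Restricting operators from L to K and lifting them from K to L\<close>

locale diff_op_extension = field_basis i w \<phi> d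
  for i :: "'K::field \<Rightarrow> 'L::field" and w \<phi> d +
  fixes j :: "'k::field \<Rightarrow> 'K"
  assumes j_hom: "field_hom j" and degree_nonzero: "of_nat d \<noteq> (0 :: 'K)"
begin

lemma ij_hom: "field_hom (i \<circ> j)"
proof -
  interpret j: field_hom j by (rule j_hom)
  show ?thesis by unfold_locales (auto simp: hom_distribs)
qed

lemma linear_operator_coord:
  assumes "s < d" and lin: "linear_operator (i \<circ> j) Q"
  shows "linear_operator j (\<lambda>c. \<phi> (Q (i c)) s)"
proof (rule linear_operatorI)
  show "\<phi> (Q (i (x + y))) s = \<phi> (Q (i x)) s + \<phi> (Q (i y)) s" for x y
    using assms(1) by (simp add: hom_distribs linear_operatorD[OF lin] coord_add)
  show "\<phi> (Q (i (j c * x))) s = j c * \<phi> (Q (i x)) s" for c x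
    using assms(1) linear_operatorD(2)[OF lin] by (simp add: hom_distribs coord_mult)
qed

text \<open>Coordinates are \<open>K\<close>-linear, so forming them commutes with taking
  commutators by elements of \<open>K\<close>. This provides the \<open>K\<close>-operators in the
  decomposition of an operator on \<open>L\<close>.\<close>

lemma diff_ops_coord:
  assumes s: "s < d"
  shows "Q \<in> diff_ops_of_order (i \<circ> j) n \<Longrightarrow> (\<lambda>c. \<phi> (Q (i c)) s) \<in> diff_ops_of_order j n"
proof (induction n arbitrary: Q)
  case 0
  then show ?case unfolding diff_ops_0_iff[OF ij_hom] diff_ops_0_iff[OF j_hom] using linear_operator_coord[OF s] s
    by (simp add: hom_distribs coord_mult)
next
  case (Suc n)
  have "(\<lambda>c. \<phi> (Q (i a * i c) - i a * Q (i c)) s) \<in> diff_ops_of_order j n" for a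
    using Suc(1)[of "\<lambda>x. Q (i a * x) - i a * Q x"] Suc(2) unfolding diff_ops_Suc_iff[OF ij_hom] by blast
  moreover have "linear_operator j (\<lambda>c. \<phi> (Q (i c)) s)"
    by (rule linear_operator_coord[OF s diff_ops_linear[OF ij_hom Suc(2)]])
  ultimately show ?case unfolding diff_ops_Suc_iff[OF j_hom]
    using s by (simp add: hom_distribs coord_mult coord_diff)
qed

text \<open>Operators of order at most \<open>n\<close> with respect to \<open>K\<close> only. Averaging such an operator against the
  separability idempotent projects the \<open>K\<close>-linear ones to \<open>L\<close>, so that \<open>n + 1\<close> averagings turn it into
  a differential operator of \<open>L\<close>.\<close>
fun relative_ops :: "nat \<Rightarrow> ('L \<Rightarrow> 'L) set" where
  "relative_ops 0 = {R. linear_operator (i \<circ> j) R \<and> (\<forall>a x. R (i a * x) = i a * R x)}"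
| "relative_ops (Suc n) =
     {R. linear_operator (i \<circ> j) R \<and> (\<forall>a. (\<lambda>x. R (i a * x) - i a * R x) \<in> relative_ops n)}"

lemma relative_ops_linear: "R \<in> relative_ops n \<Longrightarrow> linear_operator (i \<circ> j) R"
  by (cases n) auto

definition average :: "(nat \<Rightarrow> 'L) \<Rightarrow> ('L \<Rightarrow> 'L) \<Rightarrow> 'L \<Rightarrow> 'L" where
  "average u R y = (\<Sum>s<d. u s * R (w s * y))"

lemma average_linear:
  assumes "linear_operator (i \<circ> j) R"
  shows "linear_operator (i \<circ> j) (average u R)"
proof (rule linear_operatorI)
  show "average u R (x + y) = average u R x + average u R y" for x y
    unfolding average_def by (simp add: distrib_left linear_operatorD[OF assms] sum.distrib)
  show "average u R ((i \<circ> j) c * x) = (i \<circ> j) c * average u R x" for c x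
    unfolding average_def
    by (simp only: mult.left_commute[of "w _"] linear_operatorD(2)[OF assms] sum_distrib_left)
      (simp add: ac_simps)
qed

text \<open>The inner factors \<open>w s\<close> commute with \<open>b\<close>, so averaging
  commutes with taking the commutator by any element of \<open>L\<close>.\<close>

lemma average_commutator:
  "average u R (b * x) - b * average u R x = average u (\<lambda>x. R (b * x) - b * R x) x"
proof -
  have eq: "w s * (b * x) = b * (w s * x)" "b * (u s * y) = u s * (b * y)" for s y
    by (simp_all add: mult.left_commute)
  show ?thesis
    unfolding average_def by (simp add: eq sum_distrib_left sum_subtractf right_diff_distrib)
qed

lemma commutator_linear:
  assumes "linear_operator (i \<circ> j) R"
  shows "linear_operator (i \<circ> j) (\<lambda>x. R (b * x) - b * R x)"
proof (rule linear_operatorI)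
  show "R (b * (x + y)) - b * R (x + y) = R (b * x) - b * R x + (R (b * y) - b * R y)" for x y
    by (simp add: distrib_left linear_operatorD[OF assms])
  show "R (b * ((i \<circ> j) c * x)) - b * R ((i \<circ> j) c * x) = (i \<circ> j) c * (R (b * x) - b * R x)" for c x
    by (simp only: mult.left_commute[of b] linear_operatorD(2)[OF assms] right_diff_distrib)
qed

context
  fixes u :: "nat \<Rightarrow> 'L"
  assumes u1: "(\<Sum>s<d. u s * w s) = 1"
    and u2: "\<And>b t. t < d \<Longrightarrow> (\<Sum>s<d. u s * i (\<phi> (b * w s) t)) = b * u t"
begin

text \<open>For a \<open>K\<close>-linear \<open>R\<close> the average depends only on the element
  of the tensor product over \<open>K\<close> formed from \<open>u\<close> and \<open>w\<close>, and
  \<open>u2\<close> says that multiplying this element by \<open>b\<close> on either side gives the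
  same result.\<close>

lemma average_commutator_0:
  assumes "R \<in> relative_ops 0"
  shows "average u R (b * x) - b * average u R x = 0"
proof -
  have lin: "linear_operator (i \<circ> j) R" and K: "\<And>a x. R (i a * x) = i a * R x" using assms by auto
  have "R (w s * (b * x)) = (\<Sum>t<d. i (\<phi> (b * w s) t) * R (w t * x))" for s
  proof -
    have "w s * (b * x) = (\<Sum>t<d. i (\<phi> (b * w s) t) * w t) * x" unfolding expand by (simp add: ac_simps)
    then show ?thesis by (simp add: sum_distrib_right linear_operatorD(6)[OF lin] K mult.assoc)
  qed
  then have "average u R (b * x) = (\<Sum>s<d. \<Sum>t<d. u s * i (\<phi> (b * w s) t) * R (w t * x))"
    unfolding average_def by (simp add: sum_distrib_left mult.assoc)
  also have "\<dots> = (\<Sum>t<d. b * u t * R (w t * x))"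
    by (subst sum.swap) (simp add: sum_distrib_right[symmetric] u2)
  finally show ?thesis unfolding average_def by (simp add: sum_distrib_left mult.assoc)
qed

text \<open>Commutators with \<open>i a\<close> and with \<open>b\<close> commute with each other
  and with averaging. Replacing \<open>R\<close> by its commutator with \<open>i a\<close> therefore
  lowers the order, down to the \<open>K\<close>-linear case, where the commutator with
  \<open>b\<close> vanishes.\<close>

lemma average_commutator_Suc:
  "R \<in> relative_ops (Suc n) \<Longrightarrow> (\<lambda>x. average u R (b * x) - b * average u R x) \<in> relative_ops n"
proof (induction n arbitrary: R)
  case 0
  let ?S = "\<lambda>a x. R (i a * x) - i a * R x"
  have "average u (?S a) (b * x) - b * average u (?S a) x = 0" for a x
    using average_commutator_0[of "?S a"] 0 by auto
  then have "(average u R (i a * (b * x)) - i a * average u R (b * x))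
      - b * (average u R (i a * x) - i a * average u R x) = 0" for a x
    unfolding average_commutator .
  note eq = this
  have "average u R (b * (i a * x)) - b * average u R (i a * x)
      = i a * (average u R (b * x) - b * average u R x)" for a x
    using eq[of a x] by (simp add: algebra_simps)
  then show ?case using 0 average_linear commutator_linear by auto
next
  case (Suc n)
  let ?S = "\<lambda>a x. R (i a * x) - i a * R x"
  have "(\<lambda>x. average u (?S a) (b * x) - b * average u (?S a) x) \<in> relative_ops n" for a
    using Suc(1)[of "?S a"] Suc(2) by (auto simp del: relative_ops.simps simp: relative_ops.simps(2)[of "Suc n"])
  then have "(\<lambda>x. (average u R (i a * (b * x)) - i a * average u R (b * x))
      - b * (average u R (i a * x) - i a * average u R x)) \<in> relative_ops n" for a
    unfolding average_commutator .
  moreover have "(average u R (i a * (b * x)) - i a * average u R (b * x))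
      - b * (average u R (i a * x) - i a * average u R x) =
      (average u R (b * (i a * x)) - b * average u R (i a * x))
      - i a * (average u R (b * x) - b * average u R x)" for a x
    by (simp add: algebra_simps)
  ultimately show ?case
    using Suc(2) average_linear commutator_linear relative_ops_linear by (auto simp: relative_ops.simps(2))
qed

lemma funpow_average_commutator:
  "(average u ^^ k) R (b * x) - b * (average u ^^ k) R x = (average u ^^ k) (\<lambda>x. R (b * x) - b * R x) x"
proof (induction k arbitrary: x)
  case (Suc k)
  have "(average u ^^ k) (\<lambda>x. R (b * x) - b * R x) = (\<lambda>x. (average u ^^ k) R (b * x) - b * (average u ^^ k) R x)"
    using Suc by metis
  then show ?case by (simp add: average_commutator)
qed simp

lemma funpow_average_linear:
  "linear_operator (i \<circ> j) R \<Longrightarrow> linear_operator (i \<circ> j) ((average u ^^ k) R)"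
  by (induction k) (auto intro: average_linear)

text \<open>After one averaging, a commutator with an element of \<open>L\<close> has relative order
  one less. A \<open>K\<close>-linear operator already needs one averaging to become
  \<open>L\<close>-linear, hence \<open>Suc n\<close> of them for relative order
  \<open>n\<close>.\<close>

lemma funpow_average_diff_op:
  "R \<in> relative_ops n \<Longrightarrow> (average u ^^ Suc n) R \<in> diff_ops_of_order (i \<circ> j) n"
proof (induction n arbitrary: R)
  case 0
  then show ?case unfolding diff_ops_0_iff[OF ij_hom]
    using average_commutator_0[OF 0] average_linear by simp
next
  case (Suc n)
  have "(\<lambda>x. (average u ^^ Suc (Suc n)) R (b * x) - b * (average u ^^ Suc (Suc n)) R x) \<in> diff_ops_of_order (i \<circ> j) n" for b
  proof -
    have "(average u ^^ Suc (Suc n)) R = (average u ^^ Suc n) (average u R)" by (simp only: funpow_Suc_right o_apply)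
    then show ?thesis using Suc(1)[OF average_commutator_Suc[OF Suc(2)]]
      by (simp only: funpow_average_commutator)
  qed
  then show ?case unfolding diff_ops_Suc_iff[OF ij_hom]
    using funpow_average_linear[OF relative_ops_linear[OF Suc(2)]] by blast
qed

end

text \<open>Operators of order less than \<open>n\<close>. Below order 0 there is only the zero
  operator, so a commutator with an element of \<open>K\<close> drops the order for every
  \<open>n\<close>.\<close>

definition lower_ops :: "nat \<Rightarrow> ('K \<Rightarrow> 'K) set" where
  "lower_ops n = (case n of 0 \<Rightarrow> {\<lambda>x. 0} | Suc m \<Rightarrow> diff_ops_of_order j m)"

lemma lower_ops_commutator:
  "P \<in> diff_ops_of_order j n \<Longrightarrow> (\<lambda>c. P (a * c) - a * P c) \<in> lower_ops n"
  unfolding lower_ops_def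
  by (cases n) (auto simp: diff_ops_0_iff[OF j_hom] diff_ops_Suc_iff[OF j_hom])

lemma lower_ops_sum:
  "(\<And>t. t \<in> I \<Longrightarrow> P t \<in> lower_ops n) \<Longrightarrow> (\<lambda>x. \<Sum>t\<in>I. P t x) \<in> lower_ops n"
  unfolding lower_ops_def by (cases n) (auto simp: diff_ops_sum[OF j_hom])

lemma lower_ops_lmult: "P \<in> lower_ops n \<Longrightarrow> (\<lambda>x. b * P x) \<in> lower_ops n"
  unfolding lower_ops_def by (cases n) (auto simp: diff_ops_lmult[OF j_hom])

definition lower_maps :: "nat \<Rightarrow> ('K \<Rightarrow> 'L) set" where
  "lower_maps n = {f. \<forall>s<d. (\<lambda>c. \<phi> (f c) s) \<in> lower_ops n}"

lemma lower_maps_sum: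
  "(\<And>t. t \<in> I \<Longrightarrow> f t \<in> lower_maps n) \<Longrightarrow> (\<lambda>x. \<Sum>t\<in>I. f t x) \<in> lower_maps n"
  unfolding lower_maps_def by (auto simp: coord_sum intro!: lower_ops_sum)

lemma lower_maps_lmult: "f \<in> lower_maps n \<Longrightarrow> (\<lambda>x. b * f x) \<in> lower_maps n"
proof -
  assume f: "f \<in> lower_maps n"
  have "(\<lambda>c. \<phi> (b * f c) s) \<in> lower_ops n" if s: "s < d" for s
  proof -
    have "(\<lambda>c. \<phi> (b * f c) s) = (\<lambda>c. \<Sum>t<d. \<phi> (b * w t) s * \<phi> (f c) t)"
      by (rule ext) (simp only: coord_mult_expand[OF s, of b "f _"] mult.commute)
    moreover have "(\<lambda>c. \<Sum>t<d. \<phi> (b * w t) s * \<phi> (f c) t) \<in> lower_ops n"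
      using f unfolding lower_maps_def by (intro lower_ops_sum lower_ops_lmult) auto
    ultimately show ?thesis by simp
  qed
  then show ?thesis unfolding lower_maps_def by blast
qed

lemma lower_maps_basis: "P \<in> lower_ops n \<Longrightarrow> (\<lambda>c. b * i (P c)) \<in> lower_maps n"
proof -
  assume P: "P \<in> lower_ops n"
  have "(\<lambda>c. \<phi> (b * i (P c)) s) \<in> lower_ops n" if s: "s < d" for s
  proof -
    have "(\<lambda>c. \<phi> (b * i (P c)) s) = (\<lambda>c. \<phi> b s * P c)"
      using coord_mult[OF s, of _ b] by (simp add: mult.commute)
    then show ?thesis using lower_ops_lmult[OF P] by simp
  qed
  then show ?thesis unfolding lower_maps_def by blast
qed

text \<open>The extension of \<open>P\<close> coordinate by coordinate. It depends on the basis and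
  need not be a differential operator of \<open>L\<close>, but its order relative to
  \<open>K\<close> is that of \<open>P\<close>.\<close>

definition basis_extension :: "('K \<Rightarrow> 'K) \<Rightarrow> 'L \<Rightarrow> 'L" where
  "basis_extension P y = (\<Sum>t<d. w t * i (P (\<phi> y t)))"

lemma basis_extension_relative: "P \<in> diff_ops_of_order j n \<Longrightarrow> basis_extension P \<in> relative_ops n"
proof (induction n arbitrary: P)
  have lin: "linear_operator (i \<circ> j) (basis_extension P)" if "linear_operator j P" for P
    unfolding basis_extension_def
    by (rule linear_operatorI)
      (simp_all add: coord_add coord_mult linear_operatorD[OF that] hom_distribs distrib_left sum.distrib
        sum_distrib_left mult.left_commute)
  {
    case 0
    then have P: "linear_operator j P" "\<And>a x. P (a * x) = a * P x"
      unfolding diff_ops_0_iff[OF j_hom] by auto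
    have "basis_extension P (i a * x) = i a * basis_extension P x" for a x
      unfolding basis_extension_def
      by (simp add: coord_mult P(2) hom_distribs sum_distrib_left mult.left_commute)
    then show ?case using lin[OF P(1)] by simp
  next
    case (Suc n)
    have "basis_extension (\<lambda>x. P (a * x) - a * P x) \<in> relative_ops n" for a
      using Suc unfolding diff_ops_Suc_iff[OF j_hom] by blast
    moreover have "basis_extension (\<lambda>x. P (a * x) - a * P x) =
        (\<lambda>x. basis_extension P (i a * x) - i a * basis_extension P x)" for a
      by (rule ext) (simp add: basis_extension_def coord_mult hom_distribs sum_distrib_left
          sum_subtractf right_diff_distrib mult.left_commute)
    ultimately show ?case using lin Suc(2) unfolding diff_ops_Suc_iff[OF j_hom] by auto
  }
qed

text \<open>Without averaging the defect is a sum of commutators of \<open>P\<close> with elements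
  of \<open>K\<close>. Averaging preserves the leading part since the \<open>u s * w s\<close> add
  up to 1. Only \<open>y = 1\<close> is wanted in the end, but each averaging inserts factors
  \<open>w s\<close>, so the induction must run over all \<open>y\<close>.\<close>

lemma funpow_average_basis_extension:
  assumes P: "P \<in> diff_ops_of_order j n" and u1: "(\<Sum>s<d. u s * w s) = 1"
  shows "(\<lambda>c. (average u ^^ k) (basis_extension P) (y * i c) - y * i (P c)) \<in> lower_maps n"
proof (induction k arbitrary: y)
  case 0
  have "basis_extension P (y * i c) - y * i (P c) =
      (\<Sum>t<d. w t * i (P (\<phi> y t * c) - \<phi> y t * P c))" for c
  proof -
    have "y * i (P c) = (\<Sum>t<d. w t * i (\<phi> y t * P c))"
      by (subst expand[of y, symmetric]) (simp add: sum_distrib_right hom_distribs ac_simps)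
    moreover have "basis_extension P (y * i c) = (\<Sum>t<d. w t * i (P (\<phi> y t * c)))"
      unfolding basis_extension_def by (simp add: mult.commute[of y] coord_mult mult.commute[of c])
    ultimately show ?thesis by (simp add: sum_subtractf right_diff_distrib hom_distribs)
  qed
  then show ?case
    using lower_maps_sum[OF lower_maps_basis[OF lower_ops_commutator[OF P]]] by simp
next
  case (Suc k)
  let ?R = "(average u ^^ k) (basis_extension P)"
  have "average u ?R (y * i c) - y * i (P c) =
      (\<Sum>s<d. u s * (?R ((w s * y) * i c) - (w s * y) * i (P c)))" for c
  proof -
    have "y * i (P c) = (\<Sum>s<d. u s * w s) * (y * i (P c))" unfolding u1 by simp
    then show ?thesis unfolding average_def
      by (simp add: sum_distrib_right sum_subtractf right_diff_distrib mult.assoc)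
  qed
  then show ?case using lower_maps_sum[OF lower_maps_lmult[OF Suc]] by simp
qed

theorem diff_op_lift_mod_lower:
  assumes P: "P \<in> diff_ops_of_order j n"
  obtains Q R where "Q \<in> diff_ops_of_order (i \<circ> j) n" "\<And>s. s < d \<Longrightarrow> R s \<in> lower_ops n"
    "\<And>c. Q (i c) = i (P c) + (\<Sum>s<d. w s * i (R s c))"
proof -
  obtain u where u: "(\<Sum>s<d. u s * w s) = 1"
    "\<And>b t. t < d \<Longrightarrow> (\<Sum>s<d. u s * i (\<phi> (b * w s) t)) = b * u t"
    using separability_idempotent_exists[OF degree_nonzero] by blast
  define Q where "Q = (average u ^^ Suc n) (basis_extension P)"
  show thesis
  proof (rule that)
    show "Q \<in> diff_ops_of_order (i \<circ> j) n"
      unfolding Q_def by (rule funpow_average_diff_op[OF u basis_extension_relative[OF P]])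
    show "(\<lambda>c. \<phi> (Q (i c) - i (P c)) s) \<in> lower_ops n" if "s < d" for s
      using funpow_average_basis_extension[OF P u(1), of "Suc n" 1] that unfolding Q_def lower_maps_def by simp
    show "Q (i c) = i (P c) + (\<Sum>s<d. w s * i (\<phi> (Q (i c) - i (P c)) s))" for c
      using expand[of "Q (i c) - i (P c)"] by (simp add: mult.commute)
  qed
qed

end

section \<open>Finite Galois extensions\<close>

text \<open>Padding the equations with zero rows gives a square matrix. Row \<open>n\<close> is
  zero, so every product in the Leibniz formula vanishes and the determinant is 0.\<close>

lemma homogeneous_system_nontrivial_solution:
  fixes f :: "nat \<Rightarrow> nat \<Rightarrow> 'a::field"
  assumes "n < m"
  obtains v where "\<exists>t<m. v t \<noteq> 0" "\<And>s. s < n \<Longrightarrow> (\<Sum>t<m. f s t * v t) = 0"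
proof -
  define A where "A = mat m m (\<lambda>(s, t). if s < n then f s t else 0)"
  have A: "A \<in> carrier_mat m m" unfolding A_def by simp
  have "(\<Prod>s=0..<m. A $$ (s, p s)) = 0" if "p permutes {0..<m}" for p
    using assms permutes_in_image[OF that, of n] unfolding A_def
    by (intro prod_zero) (auto intro!: bexI[of _ n])
  then have "det A = 0" unfolding det_def'[OF A] by (intro sum.neutral) simp
  then obtain x where x: "x \<in> carrier_vec m" "x \<noteq> 0\<^sub>v m" "A *\<^sub>v x = 0\<^sub>v m"
    using det_0_iff_vec_prod_zero_field[OF A] by blast
  show thesis
  proof (rule that[of "\<lambda>t. x $ t"])
    show "\<exists>t<m. x $ t \<noteq> 0" using x(1,2) by (metis carrier_vecD eq_vecI index_zero_vec(1) index_zero_vec(2))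
    fix s assume s: "s < n"
    have "(\<Sum>t<m. f s t * x $ t) = (A *\<^sub>v x) $ s"
      using s assms x(1) unfolding A_def by (simp add: scalar_prod_def lessThan_atLeast0)
    then show "(\<Sum>t<m. f s t * x $ t) = 0" using x(3) s assms by simp
  qed
qed

text \<open>Subtracting \<open>\<tau> x\<close> times the relation at \<open>y\<close> from the
  relation at \<open>x * y\<close> eliminates \<tau>. The shorter relation has coefficients
  \<open>c \<sigma> * (\<sigma> x - \<tau> x)\<close>, and some \<open>x\<close> separates \<sigma>
  from \<tau>.\<close>

lemma dedekind_independence:
  fixes A :: "('a::field \<Rightarrow> 'b::field) set"
  assumes "finite A" "\<And>\<sigma> x y. \<sigma> \<in> A \<Longrightarrow> \<sigma> (x * y) = \<sigma> x * \<sigma> y" "\<And>\<sigma>. \<sigma> \<in> A \<Longrightarrow> \<sigma> 1 = 1"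
    and "\<And>y. (\<Sum>\<sigma>\<in>A. c \<sigma> * \<sigma> y) = 0" "\<sigma> \<in> A"
  shows "c \<sigma> = 0"
  using assms
proof (induction A arbitrary: c \<sigma> rule: finite_induct)
  case (insert \<tau> A)
  have A0: "c \<sigma> = 0" if \<sigma>: "\<sigma> \<in> A" for \<sigma>
  proof -
    have "c \<sigma> * (\<sigma> x - \<tau> x) = 0" for x
    proof (rule insert.IH[of "\<lambda>\<sigma>. c \<sigma> * (\<sigma> x - \<tau> x)"])
      fix y
      have "(\<Sum>\<sigma>\<in>insert \<tau> A. c \<sigma> * \<sigma> (x * y)) - \<tau> x * (\<Sum>\<sigma>\<in>insert \<tau> A. c \<sigma> * \<sigma> y) =
          (\<Sum>\<sigma>\<in>insert \<tau> A. c \<sigma> * (\<sigma> x - \<tau> x) * \<sigma> y)"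
        unfolding sum_distrib_left sum_subtractf[symmetric]
        by (intro sum.cong refl) (simp add: insert.prems(1) algebra_simps)
      then have "(\<Sum>\<sigma>\<in>insert \<tau> A. c \<sigma> * (\<sigma> x - \<tau> x) * \<sigma> y) = 0" unfolding insert.prems(3) by simp
      then show "(\<Sum>\<sigma>\<in>A. c \<sigma> * (\<sigma> x - \<tau> x) * \<sigma> y) = 0" using insert.hyps by simp
    qed (use insert.prems \<sigma> in auto)
    moreover have "\<exists>x. \<sigma> x \<noteq> \<tau> x" using insert.hyps(2) \<sigma> by (metis ext)
    ultimately show ?thesis by auto
  qed
  have "c \<tau> * \<tau> 1 = 0" using insert.prems(3)[of 1] insert.hyps A0 by simp
  then have "c \<tau> = 0" using insert.prems(2)[of \<tau>] by simp
  then show ?case using A0 insert.prems(4) by blast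
qed simp

lemma field_automorphisms_UNIV_iff:
  fixes \<sigma> :: "'a::field \<Rightarrow> 'a"
  shows "\<sigma> \<in> field_automorphisms E UNIV \<longleftrightarrow> bij \<sigma> \<and> (\<forall>x y. \<sigma> (x + y) = \<sigma> x + \<sigma> y) \<and>
    (\<forall>x y. \<sigma> (x * y) = \<sigma> x * \<sigma> y) \<and> \<sigma> 1 = 1 \<and> (\<forall>a\<in>E. \<sigma> a = a)"
  unfolding field_automorphisms_def ring_iso_def Ring.ring_hom_def by auto

locale galois_basis = field_basis i w \<phi> d
  for i :: "'K::field \<Rightarrow> 'L::field" and w \<phi> d +
  assumes fixed_field: "(\<And>\<sigma>. \<sigma> \<in> field_automorphisms (range i) UNIV \<Longrightarrow> \<sigma> x = x) \<Longrightarrow> x \<in> range i"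
begin

abbreviation galois_group :: "('L \<Rightarrow> 'L) set" where
  "galois_group \<equiv> field_automorphisms (range i) UNIV"

lemma galois_groupD:
  assumes "\<sigma> \<in> galois_group"
  shows "bij \<sigma>" "\<sigma> (x + y) = \<sigma> x + \<sigma> y" "\<sigma> (x * y) = \<sigma> x * \<sigma> y" "\<sigma> 1 = 1" "\<sigma> (i c) = i c"
    and "\<sigma> 0 = 0" "\<sigma> (sum f I) = (\<Sum>t\<in>I. \<sigma> (f t))"
proof -
  show "bij \<sigma>" and add: "\<And>x y. \<sigma> (x + y) = \<sigma> x + \<sigma> y" and "\<sigma> (x * y) = \<sigma> x * \<sigma> y" "\<sigma> 1 = 1"
    and ic: "\<And>c. \<sigma> (i c) = i c"
    using assms unfolding field_automorphisms_UNIV_iff by auto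
  show "\<sigma> 0 = 0" using ic[of 0] by simp
  then show "\<sigma> (sum f I) = (\<Sum>t\<in>I. \<sigma> (f t))"
    by (induction I rule: infinite_finite_induct) (auto simp: add)
qed

lemma galois_independence:
  assumes "A \<subseteq> galois_group" "finite A" "\<And>y. (\<Sum>\<sigma>\<in>A. c \<sigma> * \<sigma> y) = 0" "\<sigma> \<in> A"
  shows "c \<sigma> = 0"
  using dedekind_independence[OF assms(2) _ _ assms(3,4)] galois_groupD(3,4) assms(1) by blast

text \<open>More than \<open>d\<close> automorphisms satisfy a nontrivial linear relation on the
  \<open>d\<close> basis vectors; as they fix \<open>K\<close>, the relation holds on all of
  \<open>L\<close>, against their independence.\<close>

lemma card_galois_subset_le:
  assumes "A \<subseteq> galois_group" "finite A"
  shows "card A \<le> d"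
proof (rule ccontr)
  assume "\<not> card A \<le> d"
  then have "d < card A" by simp
  obtain h where h: "bij_betw h {..<card A} A"
    using ex_bij_betw_nat_finite[OF assms(2)] by (auto simp: lessThan_atLeast0)
  obtain v where v: "\<exists>t<card A. v t \<noteq> 0" "\<And>s. s < d \<Longrightarrow> (\<Sum>t<card A. h t (w s) * v t) = 0"
    using homogeneous_system_nontrivial_solution[OF \<open>d < card A\<close>, of "\<lambda>s t. h t (w s)"] by blast
  define c where "c \<sigma> = v (inv_into {..<card A} h \<sigma>)" for \<sigma>
  have c: "c (h t) = v t" if "t < card A" for t
    unfolding c_def using that h by (simp add: bij_betw_def)
  have hG: "h t \<in> galois_group" if "t < card A" for t
    using that h assms(1) unfolding bij_betw_def by blast
  have w0: "(\<Sum>\<sigma>\<in>A. c \<sigma> * \<sigma> (w s)) = 0" if "s < d" for s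
    using sum.reindex_bij_betw[OF h, of "\<lambda>\<sigma>. c \<sigma> * \<sigma> (w s)"] v(2)[OF that] by (simp add: c mult.commute)
  have "(\<Sum>\<sigma>\<in>A. c \<sigma> * \<sigma> y) = 0" for y
  proof -
    have "(\<Sum>\<sigma>\<in>A. c \<sigma> * \<sigma> y) = (\<Sum>\<sigma>\<in>A. \<Sum>s<d. i (\<phi> y s) * (c \<sigma> * \<sigma> (w s)))"
    proof (rule sum.cong)
      fix \<sigma> assume "\<sigma> \<in> A"
      then have \<sigma>: "\<sigma> \<in> galois_group" using assms(1) by blast
      show "c \<sigma> * \<sigma> y = (\<Sum>s<d. i (\<phi> y s) * (c \<sigma> * \<sigma> (w s)))"
        by (subst expand[of y, symmetric]) (simp add: galois_groupD[OF \<sigma>] sum_distrib_left mult.left_commute)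
    qed simp
    also have "\<dots> = (\<Sum>s<d. i (\<phi> y s) * (\<Sum>\<sigma>\<in>A. c \<sigma> * \<sigma> (w s)))"
      by (subst sum.swap) (simp add: sum_distrib_left)
    finally show ?thesis using w0 by simp
  qed
  from galois_independence[OF assms this] have "v t = 0" if "t < card A" for t
    using c[OF that] h that unfolding bij_betw_def by (metis imageI lessThan_iff)
  then show False using v(1) by blast
qed

lemma finite_galois_group: "finite galois_group"
proof (rule ccontr)
  assume "infinite galois_group"
  then obtain A where A: "finite A" "card A = Suc d" "A \<subseteq> galois_group"
    using infinite_arbitrarily_large by blast
  show False using card_galois_subset_le[OF A(3,1)] A(2) by simp
qed

lemma galois_group_comp: "\<sigma> \<in> galois_group \<Longrightarrow> \<tau> \<in> galois_group \<Longrightarrow> \<sigma> \<circ> \<tau> \<in> galois_group"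
  unfolding field_automorphisms_UNIV_iff by (auto intro: bij_comp)

lemma galois_group_inv: "\<sigma> \<in> galois_group \<Longrightarrow> inv_into UNIV \<sigma> \<in> galois_group"
proof -
  assume \<sigma>: "\<sigma> \<in> galois_group"
  note b = galois_groupD(1)[OF \<sigma>]
  have eq: "inv_into UNIV \<sigma> x = y" if "\<sigma> y = x" for x y
    using that b by (metis bij_inv_eq_iff)
  have s: "\<sigma> (inv_into UNIV \<sigma> x) = x" for x using b by (simp add: bij_is_surj surj_f_inv_f)
  show ?thesis unfolding field_automorphisms_UNIV_iff
    by (intro conjI allI ballI eq) (use b in \<open>auto simp: galois_groupD[OF \<sigma>] s intro: bij_imp_bij_inv\<close>)
qed

lemma galois_group_id: "id \<in> galois_group"
  unfolding field_automorphisms_UNIV_iff by auto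

text \<open>Artin's argument. The lower bound is where the fixed field matters: fewer than
  \<open>d\<close> automorphisms would force the sum of all of them to vanish identically, against
  their independence.\<close>

theorem card_galois_group: "card galois_group = d"
proof (rule antisym)
  show "card galois_group \<le> d" using card_galois_subset_le[OF subset_refl finite_galois_group] .
  show "d \<le> card galois_group"
  proof (rule ccontr)
    let ?n = "card galois_group"
    assume "\<not> d \<le> ?n"
    then have "?n < d" by simp
    obtain h where h: "bij_betw h {..<?n} galois_group"
      using ex_bij_betw_nat_finite[OF finite_galois_group] by (auto simp: lessThan_atLeast0)
    obtain v where v: "\<exists>t<d. v t \<noteq> 0" "\<And>s. s < ?n \<Longrightarrow> (\<Sum>t<d. h s (w t) * v t) = 0"
      using homogeneous_system_nontrivial_solution[OF \<open>?n < d\<close>, of "\<lambda>s t. h s (w t)"] by blast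
    have v0: "(\<Sum>t<d. \<sigma> (w t) * v t) = 0" if "\<sigma> \<in> galois_group" for \<sigma>
    proof -
      have "\<sigma> \<in> h ` {..<?n}" using h that unfolding bij_betw_def by simp
      then show ?thesis using v(2) by auto
    qed
    \<comment> \<open>The Galois trace. Composition with an automorphism permutes the summands, so
      its values are fixed and hence lie in \<open>K\<close>.\<close>
    define T where "T x = (\<Sum>\<tau>\<in>galois_group. \<tau> x)" for x
    have "T x \<in> range i" for x
    proof (rule fixed_field)
      fix \<sigma> assume \<sigma>: "\<sigma> \<in> galois_group"
      have "\<sigma> (T x) = (\<Sum>\<tau>\<in>galois_group. (\<sigma> \<circ> \<tau>) x)" unfolding T_def by (simp add: galois_groupD[OF \<sigma>])
      also have "\<dots> = T x" unfolding T_def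
      proof (rule sum.reindex_bij_betw)
        note b = galois_groupD(1)[OF \<sigma>]
        have *: "\<sigma> \<circ> inv_into UNIV \<sigma> = id" "inv_into UNIV \<sigma> \<circ> \<sigma> = id"
          using b by (auto simp: fun_eq_iff bij_is_surj surj_f_inv_f bij_is_inj)
        show "bij_betw ((\<circ>) \<sigma>) galois_group galois_group"
          by (rule bij_betw_byWitness[where f' = "(\<circ>) (inv_into UNIV \<sigma>)"])
            (auto simp: comp_assoc[symmetric] * intro: galois_group_comp \<sigma> galois_group_inv)
      qed
      finally show "\<sigma> (T x) = T x" .
    qed
    then have "\<forall>x. \<exists>c. T x = i c" by blast
    then obtain T' where T': "\<And>x. T x = i (T' x)" by metis
    \<comment> \<open>Applying \<tau> to the relation for its inverse moves the action from the
      basis vectors to the solution \<open>v\<close>. Summing over the group leaves a relation among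
      the basis vectors with coefficients in \<open>K\<close>, which must all be 0.\<close>
    have "T (a * v t) = 0" if t: "t < d" for a t
    proof -
      have "(\<Sum>t<d. w t * \<tau> (a * v t)) = 0" if \<tau>: "\<tau> \<in> galois_group" for \<tau>
      proof -
        note b = galois_groupD(1)[OF \<tau>]
        have s: "\<tau> (inv_into UNIV \<tau> x) = x" for x using b by (simp add: bij_is_surj surj_f_inv_f)
        have "\<tau> (a * (\<Sum>t<d. inv_into UNIV \<tau> (w t) * v t)) = (\<Sum>t<d. \<tau> a * (w t * \<tau> (v t)))"
          by (simp add: galois_groupD(3,7)[OF \<tau>] s sum_distrib_left)
        then have "(\<Sum>t<d. w t * \<tau> (a * v t)) = \<tau> (a * (\<Sum>t<d. inv_into UNIV \<tau> (w t) * v t))"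
          by (simp add: galois_groupD(3)[OF \<tau>] mult.left_commute)
        also have "\<dots> = 0" using v0[OF galois_group_inv[OF \<tau>]] by (simp add: galois_groupD(6)[OF \<tau>])
        finally show ?thesis .
      qed
      then have "(\<Sum>\<tau>\<in>galois_group. \<Sum>t<d. w t * \<tau> (a * v t)) = 0" by simp
      then have "(\<Sum>t<d. w t * T (a * v t)) = 0"
        unfolding T_def by (subst (asm) sum.swap) (simp add: sum_distrib_left)
      then have "(\<Sum>t<d. i (T' (a * v t)) * w t) = 0" by (simp add: T' mult.commute)
      from coord_eqI[OF this t] show ?thesis by (simp add: T' coord_0[OF t])
    qed
    then have "T y = 0" for y
    proof -
      obtain t where "t < d" "v t \<noteq> 0" using v(1) by blast
      then show ?thesis using \<open>\<And>t a. t < d \<Longrightarrow> T (a * v t) = 0\<close>[of t "y / v t"] by simp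
    qed
    then show False
      using galois_independence[OF subset_refl finite_galois_group, of "\<lambda>_. 1"] galois_group_id
      unfolding T_def by fastforce
  qed
qed

end

section \<open>Tensor products\<close>

lemma hom_finprod_comm_group:
  assumes "comm_group G" "comm_group H" "f \<in> hom G H" "g \<in> A \<rightarrow> carrier G"
  shows "f (finprod G g A) = finprod H (\<lambda>t. f (g t)) A"
proof -
  interpret G: comm_group G by fact
  interpret H: comm_group H by fact
  interpret f: group_hom G H f by unfold_locales fact
  show ?thesis using assms(4)
  proof (induction A rule: infinite_finite_induct)
    case (insert a A)
    then have "g \<in> A \<rightarrow> carrier G" "g a \<in> carrier G" "(\<lambda>t. f (g t)) \<in> A \<rightarrow> carrier H" "f (g a) \<in> carrier H"
      by (auto simp: Pi_iff)
    then show ?case using insert by simp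
  qed auto
qed

lemma hom_finprod_pointwise:
  assumes "comm_group G" "comm_group H" "\<And>t. t \<in> A \<Longrightarrow> f t \<in> hom G H"
  shows "(\<lambda>x. finprod H (\<lambda>t. f t x) A) \<in> hom G H"
proof (rule homI)
  interpret H: comm_group H by fact
  interpret G: comm_group G by fact
  have c: "f t x \<in> carrier H" if "t \<in> A" "x \<in> carrier G" for t x
    using hom_in_carrier[OF assms(3)[OF that(1)] that(2)] .
  then show "finprod H (\<lambda>t. f t x) A \<in> carrier H" if "x \<in> carrier G" for x
    using that by (intro H.finprod_closed) auto
  fix x y assume xy: "x \<in> carrier G" "y \<in> carrier G"
  have "finprod H (\<lambda>t. f t (x \<otimes>\<^bsub>G\<^esub> y)) A = finprod H (\<lambda>t. f t x \<otimes>\<^bsub>H\<^esub> f t y) A"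
    using assms(3) xy c by (intro H.finprod_cong') (auto simp: hom_mult)
  also have "\<dots> = finprod H (\<lambda>t. f t x) A \<otimes>\<^bsub>H\<^esub> finprod H (\<lambda>t. f t y) A"
    using c xy by (intro H.finprod_multf) auto
  finally show "finprod H (\<lambda>t. f t (x \<otimes>\<^bsub>G\<^esub> y)) A = \<dots>" .
qed

text \<open>A multiplicatively written copy of the additive group, to serve as target of
  homomorphisms from the tensor product, which is a quotient group in multiplicative
  notation.\<close>

definition add_group :: "'a::ab_group_add monoid" where
  "add_group = \<lparr>carrier = UNIV, monoid.mult = (+), one = 0\<rparr>"

lemma add_group_simps [simp]:
  "carrier add_group = UNIV" "x \<otimes>\<^bsub>add_group\<^esub> y = x + y" "\<one>\<^bsub>add_group\<^esub> = 0"
  unfolding add_group_def by simp_all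

lemma comm_group_add_group: "comm_group (add_group :: 'a::ab_group_add monoid)"
proof (rule comm_groupI)
  fix x :: 'a
  show "\<exists>y\<in>carrier add_group. y \<otimes>\<^bsub>add_group\<^esub> x = \<one>\<^bsub>add_group\<^esub>"
    by (intro bexI[of _ "- x"]) simp_all
qed (simp_all add: algebra_simps)

lemma finprod_add_group: "finprod add_group f A = sum f A"
proof -
  interpret comm_group "add_group :: 'a monoid" by (rule comm_group_add_group)
  show ?thesis by (induction A rule: infinite_finite_induct) auto
qed

text \<open>Matrices need a numbered basis, so a finite basis is enumerated. The coordinates are
  chosen, and their linearity follows from uniqueness.\<close>

lemma fin_dim_coordinates:
  fixes V :: "('K::field, 'v) module"
  assumes "vectorspace class_ring V" "vectorspace.fin_dim class_ring V"
  defines "r \<equiv> vectorspace.dim class_ring V"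
  obtains b co where "\<And>s. s < r \<Longrightarrow> b s \<in> carrier V"
    "\<And>x. x \<in> carrier V \<Longrightarrow> x = finsum V (\<lambda>s. co x s \<odot>\<^bsub>V\<^esub> b s) {..<r}"
    "\<And>c s. s < r \<Longrightarrow> co (finsum V (\<lambda>s. c s \<odot>\<^bsub>V\<^esub> b s) {..<r}) s = c s"
    "\<And>x y s. x \<in> carrier V \<Longrightarrow> y \<in> carrier V \<Longrightarrow> s < r \<Longrightarrow> co (x \<oplus>\<^bsub>V\<^esub> y) s = co x s + co y s"
    "\<And>c x s. x \<in> carrier V \<Longrightarrow> s < r \<Longrightarrow> co (c \<odot>\<^bsub>V\<^esub> x) s = c * co x s"
proof -
  interpret V: vectorspace class_ring V by fact
  obtain A where A: "finite A" "V.basis A" using V.finite_basis_exists[OF assms(2)] by blast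
  have AV: "A \<subseteq> carrier V" using A(2) unfolding V.basis_def by blast
  have r: "r = card A" unfolding r_def by (rule V.dim_basis[OF A])
  obtain h where h: "bij_betw h {..<r} A"
    using ex_bij_betw_nat_finite[OF A(1)] unfolding r by (auto simp: lessThan_atLeast0)
  have hV: "h s \<in> carrier V" if "s < r" for s using h AV that unfolding bij_betw_def by auto
  have hi: "inv_into {..<r} h (h s) = s" if "s < r" for s using h that unfolding bij_betw_def by simp
  have ih: "inv_into {..<r} h a < r" "h (inv_into {..<r} h a) = a" if "a \<in> A" for a
    using h that unfolding bij_betw_def by (metis inv_into_into lessThan_iff, metis f_inv_into_f)
  define L where "L c = finsum V (\<lambda>s. c s \<odot>\<^bsub>V\<^esub> h s) {..<r}" for c
  have LV: "L c \<in> carrier V" for c unfolding L_def using hV by (intro V.finsum_closed) auto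
  have lincomb: "V.lincomb a A = L (\<lambda>s. a (h s))" for a
  proof -
    have "finsum V (\<lambda>v. a v \<odot>\<^bsub>V\<^esub> v) (h ` {..<r}) = finsum V (\<lambda>s. a (h s) \<odot>\<^bsub>V\<^esub> h s) {..<r}"
      using h hV by (intro V.add.finprod_reindex) (auto simp: bij_betw_def)
    then show ?thesis unfolding V.lincomb_def L_def using h by (simp add: bij_betw_def)
  qed
  have ex1: "\<exists>!a. a \<in> A \<rightarrow>\<^sub>E carrier (class_ring :: 'K ring) \<and> V.lincomb a A = v" if "v \<in> carrier V" for v
    using A(2) V.basis_criterion[OF A(1) AV] that by blast
  have ex: "\<exists>c. L c = v" if "v \<in> carrier V" for v
    using ex1[OF that] lincomb by metis
  have uniq: "c s = c' s" if "L c = L c'" "s < r" for c c' s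
  proof -
    define a where "a c = (\<lambda>v\<in>A. c (inv_into {..<r} h v))" for c :: "nat \<Rightarrow> 'K"
    have aL: "V.lincomb (a c) A = L c" for c
    proof -
      have "a c (h s) = c s" if "s < r" for s
        using h that hi[OF that] unfolding a_def bij_betw_def by auto
      then show ?thesis unfolding lincomb L_def using hV by (intro V.add.finprod_cong') auto
    qed
    have "a c = a c'"
      using ex1[OF LV[of c]] aL that(1) unfolding a_def by (auto simp: class_ring_simps)
    then have "a c (h s) = a c' (h s)" by simp
    then show ?thesis using h that(2) hi unfolding a_def bij_betw_def by auto
  qed
  define co where "co v = (SOME c. L c = v)" for v
  have co: "L (co v) = v" if "v \<in> carrier V" for v
    unfolding co_def using ex[OF that] by (rule someI_ex)
  show thesis
  proof (rule that[of h co])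
    show "x = finsum V (\<lambda>s. co x s \<odot>\<^bsub>V\<^esub> h s) {..<r}" if "x \<in> carrier V" for x
      using co[OF that] unfolding L_def by simp
    show "co (finsum V (\<lambda>s. c s \<odot>\<^bsub>V\<^esub> h s) {..<r}) s = c s" if "s < r" for c s
      using uniq[OF co[OF LV] that] unfolding L_def .
    show "co (x \<oplus>\<^bsub>V\<^esub> y) s = co x s + co y s" if xy: "x \<in> carrier V" "y \<in> carrier V" and s: "s < r" for x y s
    proof (rule uniq[of _ "\<lambda>s. co x s + co y s", OF _ s])
      have "L (\<lambda>s. co x s + co y s) = finsum V (\<lambda>s. co x s \<odot>\<^bsub>V\<^esub> h s \<oplus>\<^bsub>V\<^esub> co y s \<odot>\<^bsub>V\<^esub> h s) {..<r}"
        unfolding L_def using V.smult_l_distr hV by (intro V.add.finprod_cong') auto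
      also have "\<dots> = L (co x) \<oplus>\<^bsub>V\<^esub> L (co y)"
        unfolding L_def using hV by (intro V.finsum_addf) auto
      finally show "L (co (x \<oplus>\<^bsub>V\<^esub> y)) = L (\<lambda>s. co x s + co y s)" using xy co by simp
    qed
    show "co (c \<odot>\<^bsub>V\<^esub> x) s = c * co x s" if x: "x \<in> carrier V" and s: "s < r" for c x s
    proof (rule uniq[of _ "\<lambda>s. c * co x s", OF _ s])
      have "L (\<lambda>s. c * co x s) = finsum V (\<lambda>s. c \<odot>\<^bsub>V\<^esub> (co x s \<odot>\<^bsub>V\<^esub> h s)) {..<r}"
        unfolding L_def using V.smult_assoc1 hV by (intro V.add.finprod_cong') auto
      also have "\<dots> = c \<odot>\<^bsub>V\<^esub> L (co x)"
        unfolding L_def using hV by (intro V.finsum_smult[symmetric]) auto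
      finally show "L (co (c \<odot>\<^bsub>V\<^esub> x)) = L (\<lambda>s. c * co x s)"
        using x co[OF x] co[of "c \<odot>\<^bsub>V\<^esub> x"] by (simp add: V.smult_closed)
    qed
  qed (use hV in blast)
qed

lemma (in left_module) zero_smult: "x \<in> carrier M \<Longrightarrow> \<zero> \<odot>\<^bsub>M\<^esub> x = \<zero>\<^bsub>M\<^esub>"
proof -
  assume x: "x \<in> carrier M"
  then have c: "\<zero> \<odot>\<^bsub>M\<^esub> x \<in> carrier M" using smult_closed by simp
  have "\<zero> \<odot>\<^bsub>M\<^esub> x \<oplus>\<^bsub>M\<^esub> \<zero> \<odot>\<^bsub>M\<^esub> x = \<zero> \<odot>\<^bsub>M\<^esub> x"
    using smult_l_distr[of \<zero> \<zero> x] x by simp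
  then show ?thesis using c by (metis M.add.r_cancel_one')
qed

lemma diff_op_ring_simps:
  "carrier (diff_op_ring j) = (\<Union>n. diff_ops_of_order j n)"
  "P \<otimes>\<^bsub>diff_op_ring j\<^esub> Q = P \<circ> Q" "\<one>\<^bsub>diff_op_ring j\<^esub> = id" "\<zero>\<^bsub>diff_op_ring j\<^esub> = (\<lambda>x. 0)"
  "P \<oplus>\<^bsub>diff_op_ring j\<^esub> Q = (\<lambda>x. P x + Q x)"
  unfolding diff_op_ring_def by simp_all

lemma underlying_space_simps:
  "carrier (underlying_space M) = carrier M" "x \<oplus>\<^bsub>underlying_space M\<^esub> y = x \<oplus>\<^bsub>M\<^esub> y"
  "\<zero>\<^bsub>underlying_space M\<^esub> = \<zero>\<^bsub>M\<^esub>" "c \<odot>\<^bsub>underlying_space M\<^esub> x = (\<lambda>z. c * z) \<odot>\<^bsub>M\<^esub> x"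
  unfolding underlying_space_def by simp_all

lemma mult_in_diff_op_ring: "field_hom j \<Longrightarrow> (\<lambda>z. c * z) \<in> carrier (diff_op_ring j)"
  unfolding diff_op_ring_simps using diff_ops_mult by blast

lemma vectorspace_underlying_space:
  fixes j :: "'k::field \<Rightarrow> 'a::field" and M :: "('a \<Rightarrow> 'a, 'm) module"
  assumes j: "field_hom j" and M: "left_module (diff_op_ring j) M"
  shows "vectorspace class_ring (underlying_space M)"
proof -
  interpret M: left_module "diff_op_ring j" M by fact
  note mult = mult_in_diff_op_ring[OF j]
  show ?thesis
  proof (rule vs_criteria, unfold underlying_space_simps class_ring_simps)
    show "field (class_ring :: 'a ring)" by (rule class_field)
    show "\<forall>v\<in>carrier M. \<exists>neg_v\<in>carrier M. v \<oplus>\<^bsub>M\<^esub> neg_v = \<zero>\<^bsub>M\<^esub>"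
      by (metis M.M.r_neg M.M.a_inv_closed)
    show "\<forall>c v. c \<in> UNIV \<and> v \<in> carrier M \<longrightarrow> (*) c \<odot>\<^bsub>M\<^esub> v \<in> carrier M"
      using M.smult_closed mult by blast
    show "\<forall>a b v. a \<in> UNIV \<and> b \<in> UNIV \<and> v \<in> carrier M \<longrightarrow> (*) (a * b) \<odot>\<^bsub>M\<^esub> v = (*) a \<odot>\<^bsub>M\<^esub> ((*) b \<odot>\<^bsub>M\<^esub> v)"
    proof -
      have "(*) (a * b) = (*) a \<circ> (*) b" for a b :: 'a by (simp add: fun_eq_iff mult.assoc)
      then show ?thesis using M.smult_assoc[OF mult mult] by (simp add: diff_op_ring_simps)
    qed
    show "\<forall>v\<in>carrier M. (*) 1 \<odot>\<^bsub>M\<^esub> v = v"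
    proof -
      have "(*) (1 :: 'a) = id" by (simp add: fun_eq_iff)
      then show ?thesis using M.smult_one by (simp add: diff_op_ring_simps)
    qed
    show "\<forall>a b v. a \<in> UNIV \<and> b \<in> UNIV \<and> v \<in> carrier M \<longrightarrow>
        (*) (a + b) \<odot>\<^bsub>M\<^esub> v = (*) a \<odot>\<^bsub>M\<^esub> v \<oplus>\<^bsub>M\<^esub> (*) b \<odot>\<^bsub>M\<^esub> v"
    proof -
      have "(*) (a + b) = (\<lambda>x. a * x + b * x)" for a b :: 'a by (simp add: fun_eq_iff distrib_right)
      then show ?thesis using M.smult_l_distr[OF mult mult] by (simp add: diff_op_ring_simps)
    qed
    show "\<forall>a v w. a \<in> UNIV \<and> v \<in> carrier M \<and> w \<in> carrier M \<longrightarrow>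
        (*) a \<odot>\<^bsub>M\<^esub> (v \<oplus>\<^bsub>M\<^esub> w) = (*) a \<odot>\<^bsub>M\<^esub> v \<oplus>\<^bsub>M\<^esub> (*) a \<odot>\<^bsub>M\<^esub> w"
      using M.smult_r_distr[OF mult] by blast
  qed (auto simp: M.M.a_ac)
qed

section \<open>The tensor product as a quotient and its universal property\<close>

locale tensor_base = field_hom i
  for i :: "'K::field \<Rightarrow> 'L::field" +
  fixes V :: "('K, 'v) module"
  assumes V: "vectorspace class_ring V"
begin

sublocale V: vectorspace "class_ring :: 'K ring" V by (rule V)

abbreviation "free \<equiv> (tensor_free V :: ('L \<times> 'v \<Rightarrow>\<^sub>0 int) monoid)"
abbreviation "T \<equiv> tensor_group i V"
abbreviation "pt \<equiv> pure_tensor i V"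

lemma comm_group_free: "comm_group free"
  unfolding tensor_free_def by (rule abelian_free_Abelian_group)

sublocale free: comm_group free by (rule comm_group_free)

lemma free_simps:
  "carrier free = {z. Poly_Mapping.keys z \<subseteq> UNIV \<times> carrier V}" "z \<otimes>\<^bsub>free\<^esub> z' = z + z'" "\<one>\<^bsub>free\<^esub> = 0"
  unfolding tensor_free_def by auto

lemma frag_of_in_free: "x \<in> carrier V \<Longrightarrow> frag_of (a, x) \<in> carrier free"
  by (simp add: free_simps)

lemma diff_in_free: "z \<in> carrier free \<Longrightarrow> z' \<in> carrier free \<Longrightarrow> z - z' \<in> carrier free"
  unfolding free_simps using keys_diff[of z z'] by blast

lemma smult_V: "x \<in> carrier V \<Longrightarrow> c \<odot>\<^bsub>V\<^esub> x \<in> carrier V"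
  using V.smult_closed by simp

lemma tensor_relations_subset: "tensor_relations i V \<subseteq> carrier free"
proof
  fix z assume "z \<in> tensor_relations i V"
  then show "z \<in> carrier free" unfolding tensor_relations_def
    by (elim UnE CollectE exE conjE) (auto simp only: intro!: diff_in_free frag_of_in_free V.a_closed smult_V)
qed

lemma subgroup_kernel: "subgroup (tensor_kernel i V) free"
  unfolding tensor_kernel_def by (rule free.generate_is_subgroup[OF tensor_relations_subset])

lemma normal_kernel: "tensor_kernel i V \<lhd> free"
  by (rule free.subgroup_imp_normal[OF subgroup_kernel])

lemma comm_group_T: "comm_group T"
  unfolding tensor_group_def by (rule free.abelian_FactGroup[OF subgroup_kernel])

sublocale T: comm_group T by (rule comm_group_T)

lemma pt_closed: "x \<in> carrier V \<Longrightarrow> pt a x \<in> carrier T"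
  unfolding tensor_group_def pure_tensor_def carrier_FactGroup
  using frag_of_in_free by blast

lemma coset_mult:
  assumes "z \<in> carrier free" "z' \<in> carrier free"
  shows "(tensor_kernel i V #>\<^bsub>free\<^esub> z) \<otimes>\<^bsub>T\<^esub> (tensor_kernel i V #>\<^bsub>free\<^esub> z') = tensor_kernel i V #>\<^bsub>free\<^esub> (z + z')"
  unfolding tensor_group_def using normal.rcos_sum[OF normal_kernel assms] by (simp add: free_simps)

lemma coset_eqI:
  assumes "z - z' \<in> tensor_kernel i V" "z' \<in> carrier free"
  shows "tensor_kernel i V #>\<^bsub>free\<^esub> z = tensor_kernel i V #>\<^bsub>free\<^esub> z'"
proof (rule free.repr_independence[symmetric, OF _ assms(2) subgroup_kernel])
  have "(z - z') \<otimes>\<^bsub>free\<^esub> z' \<in> tensor_kernel i V #>\<^bsub>free\<^esub> z'"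
    using assms(1) unfolding r_coset_def by blast
  then show "z \<in> tensor_kernel i V #>\<^bsub>free\<^esub> z'" by (simp add: free_simps)
qed

lemma relation_in_kernel: "z \<in> tensor_relations i V \<Longrightarrow> z \<in> tensor_kernel i V"
  unfolding tensor_kernel_def by (rule generate.incl)

lemma pt_add_left: "x \<in> carrier V \<Longrightarrow> pt (a + b) x = pt a x \<otimes>\<^bsub>T\<^esub> pt b x"
  unfolding pure_tensor_def coset_mult[OF frag_of_in_free frag_of_in_free]
  by (intro coset_eqI relation_in_kernel free.m_closed[unfolded free_simps(2)] frag_of_in_free)
    (auto simp: tensor_relations_def diff_diff_eq[symmetric])

lemma pt_add_right: "x \<in> carrier V \<Longrightarrow> y \<in> carrier V \<Longrightarrow> pt a (x \<oplus>\<^bsub>V\<^esub> y) = pt a x \<otimes>\<^bsub>T\<^esub> pt a y"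
  unfolding pure_tensor_def coset_mult[OF frag_of_in_free frag_of_in_free]
  by (intro coset_eqI relation_in_kernel free.m_closed[unfolded free_simps(2)] frag_of_in_free)
    (auto simp: tensor_relations_def diff_diff_eq[symmetric])

lemma pt_balanced: "x \<in> carrier V \<Longrightarrow> pt (a * i c) x = pt a (c \<odot>\<^bsub>V\<^esub> x)"
  unfolding pure_tensor_def
  by (intro coset_eqI relation_in_kernel frag_of_in_free smult_V) (auto simp: tensor_relations_def)

lemma tensor_hom_eqI:
  assumes f: "f \<in> hom T H" and g: "g \<in> hom T H" and H: "group H"
    and eq: "\<And>a x. x \<in> carrier V \<Longrightarrow> f (pt a x) = g (pt a x)" and t: "t \<in> carrier T"
  shows "f t = g t"
proof -
  interpret f: group_hom T H f using f H by (intro group_hom.intro group_hom_axioms.intro T.is_group)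
  interpret g: group_hom T H g using g H by (intro group_hom.intro group_hom_axioms.intro T.is_group)
  let ?c = "\<lambda>z. tensor_kernel i V #>\<^bsub>free\<^esub> z"
  have c: "?c z \<in> carrier T" if "z \<in> carrier free" for z
    unfolding tensor_group_def carrier_FactGroup using that by blast
  have main: "f (?c z) = g (?c z)" if "Poly_Mapping.keys z \<subseteq> UNIV \<times> carrier V" for z
  proof (rule free_Abelian_group_induct[OF that, of "\<lambda>z. f (?c z) = g (?c z)"])
    have "?c 0 = \<one>\<^bsub>T\<^esub>"
      unfolding tensor_group_def using free.coset_mult_one[of "tensor_kernel i V"] subgroup.subset[OF subgroup_kernel]
      by (simp add: free_simps)
    then show "f (?c 0) = g (?c 0)" by simp
  next
    fix z z' :: "'L \<times> 'v \<Rightarrow>\<^sub>0 int"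
    assume zz: "Poly_Mapping.keys z \<subseteq> UNIV \<times> carrier V" "Poly_Mapping.keys z' \<subseteq> UNIV \<times> carrier V"
      and eq: "f (?c z) = g (?c z)" "f (?c z') = g (?c z')"
    from zz have zz: "z \<in> carrier free" "z' \<in> carrier free" by (auto simp: free_simps)
    have "?c z = ?c (z - z') \<otimes>\<^bsub>T\<^esub> ?c z'"
      using coset_mult[OF diff_in_free[OF zz] zz(2)] by simp
    then have "f (?c (z - z')) \<otimes>\<^bsub>H\<^esub> f (?c z') = g (?c (z - z')) \<otimes>\<^bsub>H\<^esub> g (?c z')"
      using eq(1) c[OF zz(2)] c[OF diff_in_free[OF zz]] by (metis f.hom_mult g.hom_mult)
    then show "f (?c (z - z')) = g (?c (z - z'))" using eq(2) c[OF zz(2)] c[OF diff_in_free[OF zz]]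
      by (metis f.H.r_cancel f.hom_closed g.hom_closed)
  next
    fix p :: "'L \<times> 'v" assume "p \<in> UNIV \<times> carrier V"
    then show "f (?c (frag_of p)) = g (?c (frag_of p))" using eq unfolding pure_tensor_def by (cases p) auto
  qed
  obtain z where "z \<in> carrier free" "t = ?c z"
    using t unfolding tensor_group_def carrier_FactGroup by blast
  then show ?thesis using main by (simp add: free_simps)
qed

text \<open>The source of all maps out of the tensor product below: its coordinates in
  \<open>L\<close> and the operators of \<open>D_L\<close> on it.\<close>

lemma tensor_universal:
  assumes H: "comm_group H" and \<psi>: "\<And>a x. x \<in> carrier V \<Longrightarrow> \<psi> a x \<in> carrier H"
    and add_left: "\<And>a b x. x \<in> carrier V \<Longrightarrow> \<psi> (a + b) x = \<psi> a x \<otimes>\<^bsub>H\<^esub> \<psi> b x"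
    and add_right: "\<And>a x y. x \<in> carrier V \<Longrightarrow> y \<in> carrier V \<Longrightarrow> \<psi> a (x \<oplus>\<^bsub>V\<^esub> y) = \<psi> a x \<otimes>\<^bsub>H\<^esub> \<psi> a y"
    and balanced: "\<And>a c x. x \<in> carrier V \<Longrightarrow> \<psi> (a * i c) x = \<psi> a (c \<odot>\<^bsub>V\<^esub> x)"
  obtains f where "f \<in> hom T H" "\<And>a x. x \<in> carrier V \<Longrightarrow> f (pt a x) = \<psi> a x"
proof -
  interpret H: comm_group H by fact
  have "case_prod \<psi> ` (UNIV \<times> carrier V) \<subseteq> carrier H" using \<psi> by auto
  from H.free_Abelian_group_universal[OF this] obtain h where
    h: "h \<in> hom free H" and hf: "\<And>a x. x \<in> carrier V \<Longrightarrow> h (frag_of (a, x)) = \<psi> a x"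
    unfolding tensor_free_def by (metis (no_types, lifting) SigmaI UNIV_I case_prod_conv)
  interpret h: group_hom free H h using h by unfold_locales
  have hdiff: "h (z - z') = h z \<otimes>\<^bsub>H\<^esub> inv\<^bsub>H\<^esub> (h z')" if zz: "z \<in> carrier free" "z' \<in> carrier free" for z z'
  proof -
    have "h z = h (z - z') \<otimes>\<^bsub>H\<^esub> h z'"
      using h.hom_mult[OF diff_in_free[OF zz] zz(2)] by (simp add: free_simps)
    then show ?thesis using zz diff_in_free[OF zz] by (simp add: H.m_assoc)
  qed
  have cancel: "u \<otimes>\<^bsub>H\<^esub> v \<otimes>\<^bsub>H\<^esub> inv\<^bsub>H\<^esub> u \<otimes>\<^bsub>H\<^esub> inv\<^bsub>H\<^esub> v = \<one>\<^bsub>H\<^esub>"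
    if "u \<in> carrier H" "v \<in> carrier H" for u v
    using that H.r_inv[of "u \<otimes>\<^bsub>H\<^esub> v"] by (simp add: H.inv_mult H.m_assoc)
  have "tensor_relations i V \<subseteq> kernel free H h"
  proof
    fix z assume z: "z \<in> tensor_relations i V"
    then have "h z = \<one>\<^bsub>H\<^esub>" unfolding tensor_relations_def
      by (elim UnE CollectE exE conjE)
        (simp_all add: hdiff frag_of_in_free diff_in_free smult_V hf add_left add_right balanced \<psi> cancel)
    then show "z \<in> kernel free H h" using z tensor_relations_subset unfolding kernel_def by blast
  qed
  then have "tensor_kernel i V \<subseteq> kernel free H h"
    unfolding tensor_kernel_def by (rule free.generate_subgroup_incl[OF _ h.subgroup_kernel])
  from h.FactGroup_universal_kernel[OF normal_kernel this] obtain g where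
    "g \<in> hom T H" "\<And>z. z \<in> carrier free \<Longrightarrow> g (tensor_kernel i V #>\<^bsub>free\<^esub> z) = h z"
    unfolding tensor_group_def by blast
  then show thesis using that[of g] hf frag_of_in_free unfolding pure_tensor_def by simp
qed

lemma pt_zero_right: "pt a \<zero>\<^bsub>V\<^esub> = \<one>\<^bsub>T\<^esub>"
  using pt_add_right[of "\<zero>\<^bsub>V\<^esub>" "\<zero>\<^bsub>V\<^esub>" a] pt_closed[of "\<zero>\<^bsub>V\<^esub>" a] by simp

lemma pt_finsum:
  "g \<in> A \<rightarrow> carrier V \<Longrightarrow> pt a (finsum V g A) = finprod T (\<lambda>t. pt a (g t)) A"
proof (induction A rule: infinite_finite_induct)
  case (insert s A)
  then have c: "g \<in> A \<rightarrow> carrier V" "g s \<in> carrier V" "(\<lambda>t. pt a (g t)) \<in> A \<rightarrow> carrier T" "pt a (g s) \<in> carrier T"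
    by (auto intro: pt_closed)
  then show ?case using insert pt_add_right[OF c(2) V.finsum_closed[OF c(1)]] by simp
qed (auto simp: pt_zero_right)

end


section \<open>The inverse image of a module\<close>

text \<open>The elements \<open>b\<close> form a \<open>K\<close>-basis of \<open>N\<close> with
  coordinates \<open>co\<close>. The assumption \<open>ring_DL\<close> is met in the application
  through the module \<Lambda>, since \<open>left_module\<close> includes the ring axioms.\<close>

locale inverse_image_base = diff_op_extension i w \<phi> d j
  for i :: "'K::field \<Rightarrow> 'L::field" and w \<phi> d and j :: "'k::field \<Rightarrow> 'K" +
  fixes N :: "('K \<Rightarrow> 'K, 'n) module" and b :: "nat \<Rightarrow> 'n" and co :: "'n \<Rightarrow> nat \<Rightarrow> 'K" and r :: nat
  assumes N: "left_module (diff_op_ring j) N" and ring_DL: "ring (diff_op_ring (i \<circ> j))"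
    and b_closed: "s < r \<Longrightarrow> b s \<in> carrier N"
    and co_expand: "x \<in> carrier N \<Longrightarrow>
      x = finsum (underlying_space N) (\<lambda>s. co x s \<odot>\<^bsub>underlying_space N\<^esub> b s) {..<r}"
    and co_coord: "s < r \<Longrightarrow>
      co (finsum (underlying_space N) (\<lambda>s. c s \<odot>\<^bsub>underlying_space N\<^esub> b s) {..<r}) s = c s"
    and co_add: "x \<in> carrier N \<Longrightarrow> y \<in> carrier N \<Longrightarrow> s < r \<Longrightarrow> co (x \<oplus>\<^bsub>N\<^esub> y) s = co x s + co y s"
    and co_smult: "x \<in> carrier N \<Longrightarrow> s < r \<Longrightarrow> co ((\<lambda>z. k * z) \<odot>\<^bsub>N\<^esub> x) s = k * co x s"
begin

abbreviation smult_N (infixl "\<star>" 70) where "P \<star> x \<equiv> P \<odot>\<^bsub>N\<^esub> x"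

sublocale N: left_module "diff_op_ring j" N by (rule N)

sublocale tensor_base i "underlying_space N"
  by (intro tensor_base.intro tensor_base_axioms.intro field_hom_axioms vectorspace_underlying_space[OF j_hom N])

abbreviation "DK \<equiv> carrier (diff_op_ring j)"
abbreviation "DL \<equiv> carrier (diff_op_ring (i \<circ> j))"

lemma pt_closed_N: "x \<in> carrier N \<Longrightarrow> pt a x \<in> carrier T"
  using pt_closed by (simp add: underlying_space_simps)

text \<open>The coordinate in \<open>L\<close> belonging to the basis vector
  \<open>1 \<otimes> b s\<close>. Equality in the tensor product can thereby be decided by computing
  in \<open>L\<close>.\<close>

definition tensor_coord :: "nat \<Rightarrow> ('L \<times> 'n \<Rightarrow>\<^sub>0 int) set \<Rightarrow> 'L" where
  "tensor_coord s = (SOME f. f \<in> hom T add_group \<and> (\<forall>a. \<forall>x\<in>carrier N. f (pt a x) = a * i (co x s)))"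

lemma tensor_coord:
  assumes s: "s < r"
  shows "tensor_coord s \<in> hom T add_group" "x \<in> carrier N \<Longrightarrow> tensor_coord s (pt a x) = a * i (co x s)"
proof -
  obtain f where "f \<in> hom T (add_group :: 'L monoid)"
    "\<And>a x. x \<in> carrier (underlying_space N) \<Longrightarrow> f (pt a x) = a * i (co x s)"
    by (rule tensor_universal[OF comm_group_add_group, of "\<lambda>a x. a * i (co x s)"])
      (use s in \<open>simp_all add: underlying_space_simps co_add co_smult hom_distribs algebra_simps\<close>)
  then have "\<exists>f. f \<in> hom T add_group \<and> (\<forall>a. \<forall>x\<in>carrier N. f (pt a x) = a * i (co x s))"
    by (auto simp: underlying_space_simps)
  then have "tensor_coord s \<in> hom T add_group \<and> (\<forall>a. \<forall>x\<in>carrier N. tensor_coord s (pt a x) = a * i (co x s))"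
    unfolding tensor_coord_def by (rule someI_ex)
  then show "tensor_coord s \<in> hom T add_group" "x \<in> carrier N \<Longrightarrow> tensor_coord s (pt a x) = a * i (co x s)" by auto
qed

lemma tensor_coord_finprod: "s < r \<Longrightarrow> g \<in> A \<rightarrow> carrier T \<Longrightarrow> tensor_coord s (finprod T g A) = (\<Sum>t\<in>A. tensor_coord s (g t))"
  using hom_finprod_comm_group[OF comm_group_T comm_group_add_group tensor_coord(1)] by (simp add: finprod_add_group)

lemma tensor_expand:
  assumes "t \<in> carrier T"
  shows "t = finprod T (\<lambda>s. pt (tensor_coord s t) (b s)) {..<r}"
proof (rule tensor_hom_eqI[of "\<lambda>t. t", OF _ _ T.is_group _ assms])
  show "(\<lambda>t. t) \<in> hom T T" by (simp add: hom_def)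
  show "(\<lambda>t. finprod T (\<lambda>s. pt (tensor_coord s t) (b s)) {..<r}) \<in> hom T T"
  proof (rule hom_finprod_pointwise[OF comm_group_T comm_group_T])
    fix s assume "s \<in> {..<r}"
    then have s: "s < r" by simp
    have bs: "b s \<in> carrier (underlying_space N)" using b_closed[OF s] by (simp add: underlying_space_simps)
    show "(\<lambda>t. pt (tensor_coord s t) (b s)) \<in> hom T T"
      by (rule homI) (simp_all add: pt_closed[OF bs] pt_add_left[OF bs] Group.hom_mult[OF tensor_coord(1)[OF s]])
  qed
  fix a x assume x: "x \<in> carrier (underlying_space N)"
  then have xN: "x \<in> carrier N" by (simp add: underlying_space_simps)
  have bs: "b s \<in> carrier (underlying_space N)" if "s < r" for s
    using b_closed[OF that] by (simp add: underlying_space_simps)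
  have "pt a x = finprod T (\<lambda>s. pt a (co x s \<odot>\<^bsub>underlying_space N\<^esub> b s)) {..<r}"
    by (subst co_expand[OF xN], subst pt_finsum) (use bs smult_V in auto)
  also have "\<dots> = finprod T (\<lambda>s. pt (tensor_coord s (pt a x)) (b s)) {..<r}"
    using bs by (intro T.finprod_cong') (auto simp: tensor_coord(2) xN pt_balanced pt_closed)
  finally show "pt a x = finprod T (\<lambda>s. pt (tensor_coord s (pt a x)) (b s)) {..<r}" .
qed

lemma tensor_eqI:
  assumes "t \<in> carrier T" "t' \<in> carrier T" "\<And>s. s < r \<Longrightarrow> tensor_coord s t = tensor_coord s t'"
  shows "t = t'"
proof -
  have eq: "finprod T (\<lambda>s. pt (tensor_coord s t) (b s)) {..<r} = finprod T (\<lambda>s. pt (tensor_coord s t') (b s)) {..<r}"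
    using assms(3) b_closed by (intro T.finprod_cong') (auto simp: pt_closed_N)
  show ?thesis
    by (rule trans[OF tensor_expand[OF assms(1)] trans[OF eq tensor_expand[OF assms(2), symmetric]]])
qed

lemma co_basis:
  assumes "s < r" "t < r"
  shows "co (b t) s = (if s = t then 1 else 0)"
proof -
  let ?V = "underlying_space N"
  have bs: "b s \<in> carrier ?V" if "s < r" for s
    using b_closed[OF that] by (simp add: underlying_space_simps)
  have "b t = finsum ?V (\<lambda>s. if t = s then b s else \<zero>\<^bsub>?V\<^esub>) {..<r}"
    using assms(2) bs by (intro V.add.finprod_singleton[symmetric]) auto
  also have "\<dots> = finsum ?V (\<lambda>s. (if s = t then 1 else 0) \<odot>\<^bsub>?V\<^esub> b s) {..<r}"
    using V.smult_one V.smult_l_null bs by (intro V.add.finprod_cong') (auto simp: class_ring_simps)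
  finally have eq: "b t = \<dots>" .
  show ?thesis unfolding eq using co_coord[OF assms(1)] .
qed

lemma tensor_coord_combination:
  assumes "s < r"
  shows "tensor_coord s (finprod T (\<lambda>s. pt (c s) (b s)) {..<r}) = c s"
proof -
  have "tensor_coord s (finprod T (\<lambda>s. pt (c s) (b s)) {..<r}) = (\<Sum>t<r. c t * i (co (b t) s))"
    using assms b_closed by (subst tensor_coord_finprod) (auto simp: tensor_coord(2) pt_closed_N)
  also have "\<dots> = (\<Sum>t<r. if t = s then c t else 0)"
    using assms by (intro sum.cong) (auto simp: co_basis)
  finally show ?thesis using assms by simp
qed

section \<open>Canonical decompositions of operators and the action on the tensor product\<close>

definition component :: "('L \<Rightarrow> 'L) \<Rightarrow> 'L \<Rightarrow> nat \<Rightarrow> 'K \<Rightarrow> 'K" where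
  "component Q a t = (\<lambda>c. \<phi> (Q (a * i c)) t)"

lemma component_closed:
  assumes "Q \<in> DL" "t < d"
  shows "component Q a t \<in> DK"
proof -
  interpret DL: ring "diff_op_ring (i \<circ> j)" by (rule ring_DL)
  have "Q \<circ> (\<lambda>z. a * z) \<in> DL"
    using DL.m_closed[OF assms(1) mult_in_diff_op_ring[OF ij_hom]] by (simp add: diff_op_ring_simps)
  then obtain n where "Q \<circ> (\<lambda>z. a * z) \<in> diff_ops_of_order (i \<circ> j) n" by (auto simp: diff_op_ring_simps)
  from diff_ops_coord[OF assms(2) this] show ?thesis
    unfolding component_def diff_op_ring_simps by (simp add: o_def) blast
qed

lemma component_expand: "(\<Sum>t<d. w t * i (component Q a t c)) = Q (a * i c)"
  unfolding component_def using expand[of "Q (a * i c)"] by (simp add: mult.commute)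

lemma DK_smult_closed: "P \<in> DK \<Longrightarrow> x \<in> carrier N \<Longrightarrow> P \<star> x \<in> carrier N"
  by (rule N.smult_closed)

lemma co_zero: "s < r \<Longrightarrow> co \<zero>\<^bsub>N\<^esub> s = 0"
  using co_add[of "\<zero>\<^bsub>N\<^esub>" "\<zero>\<^bsub>N\<^esub>" s]
  by (simp only: N.M.zero_closed N.M.l_zero) (metis add.right_neutral add_left_cancel)

lemma operator_sum:
  fixes m :: nat
  assumes "\<And>l. l < m \<Longrightarrow> P l \<in> DK"
  shows "(\<lambda>c. \<Sum>l<m. k l * P l c) \<in> DK"
    and "x \<in> carrier N \<Longrightarrow> s < r \<Longrightarrow>
      co ((\<lambda>c. \<Sum>l<m. k l * P l c) \<star> x) s = (\<Sum>l<m. k l * co (P l \<star> x) s)"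
proof -
  have "(\<lambda>c. \<Sum>l<m. k l * P l c) \<in> DK \<and> (\<forall>x\<in>carrier N. \<forall>s<r.
      co ((\<lambda>c. \<Sum>l<m. k l * P l c) \<star> x) s = (\<Sum>l<m. k l * co (P l \<star> x) s))"
    using assms
  proof (induction m)
    case 0
    show ?case using N.R.zero_closed N.zero_smult co_zero by (simp add: diff_op_ring_simps)
  next
    case (Suc m)
    let ?P = "\<lambda>c. \<Sum>l<m. k l * P l c" and ?R = "(\<lambda>z. k m * z) \<circ> P m"
    note km = mult_in_diff_op_ring[OF j_hom, of "k m"]
    have Pm: "P m \<in> DK" using Suc(2) by simp
    have P: "?P \<in> DK" "\<And>x s. x \<in> carrier N \<Longrightarrow> s < r \<Longrightarrow> co (?P \<star> x) s = (\<Sum>l<m. k l * co (P l \<star> x) s)"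
      using Suc by auto
    have R: "?R \<in> DK" using N.R.m_closed[OF km Pm] by (simp add: diff_op_ring_simps)
    have eq: "(\<lambda>c. \<Sum>l<Suc m. k l * P l c) = ?P \<oplus>\<^bsub>diff_op_ring j\<^esub> ?R"
      by (simp add: diff_op_ring_simps fun_eq_iff)
    have "co ((?P \<oplus>\<^bsub>diff_op_ring j\<^esub> ?R) \<star> x) s = (\<Sum>l<Suc m. k l * co (P l \<star> x) s)"
      if x: "x \<in> carrier N" and s: "s < r" for x s
    proof -
      have "?R \<star> x = (\<lambda>z. k m * z) \<star> (P m \<star> x)"
        using N.smult_assoc[OF km Pm x] by (simp add: diff_op_ring_simps)
      then have "co (?R \<star> x) s = k m * co (P m \<star> x) s"
        using co_smult[OF DK_smult_closed[OF Pm x] s] by simp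
      moreover have "co ((?P \<oplus>\<^bsub>diff_op_ring j\<^esub> ?R) \<star> x) s = co (?P \<star> x) s + co (?R \<star> x) s"
        using N.smult_l_distr[OF P(1) R x] co_add[OF DK_smult_closed[OF P(1) x] DK_smult_closed[OF R x] s] by simp
      ultimately show ?thesis using P(2)[OF x s] by simp
    qed
    then show ?case unfolding eq using N.R.a_closed[OF P(1) R] by blast
  qed
  then show "(\<lambda>c. \<Sum>l<m. k l * P l c) \<in> DK" "x \<in> carrier N \<Longrightarrow> s < r \<Longrightarrow>
      co ((\<lambda>c. \<Sum>l<m. k l * P l c) \<star> x) s = (\<Sum>l<m. k l * co (P l \<star> x) s)" by blast+
qed

text \<open>Independence of the decomposition. Expanding each \<open>y l\<close> in the basis
  \<open>w\<close> regroups a given decomposition into the canonical one, whose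
  \<open>K\<close>-operators are determined by \<open>Q\<close>; the right-hand side no longer
  mentions \<open>y\<close> and \<open>P\<close>.\<close>

lemma tensor_coord_decomposition:
  fixes P :: "nat \<Rightarrow> 'K \<Rightarrow> 'K" and m :: nat
  assumes P: "\<And>l. l < m \<Longrightarrow> P l \<in> DK" and Q: "\<And>c. Q (a * i c) = (\<Sum>l<m. y l * i (P l c))"
    and x: "x \<in> carrier N" and s: "s < r"
  shows "tensor_coord s (finprod T (\<lambda>l. pt (y l) (P l \<star> x)) {..<m}) =
    (\<Sum>t<d. w t * i (co (component Q a t \<star> x) s))"
proof -
  have "tensor_coord s (finprod T (\<lambda>l. pt (y l) (P l \<star> x)) {..<m}) = (\<Sum>l<m. y l * i (co (P l \<star> x) s))"
    using P x s DK_smult_closed by (subst tensor_coord_finprod) (auto simp: tensor_coord(2) pt_closed_N)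
  also have "\<dots> = (\<Sum>l<m. \<Sum>t<d. w t * i (\<phi> (y l) t * co (P l \<star> x) s))"
  proof (rule sum.cong)
    fix l
    have "y l * z = (\<Sum>t<d. w t * (i (\<phi> (y l) t) * z))" for z
      by (subst expand[of "y l", symmetric], subst sum_distrib_right) (simp add: ac_simps)
    then show "y l * i (co (P l \<star> x) s) = (\<Sum>t<d. w t * i (\<phi> (y l) t * co (P l \<star> x) s))"
      by (simp add: hom_distribs)
  qed simp
  also have "\<dots> = (\<Sum>t<d. w t * i (\<Sum>l<m. \<phi> (y l) t * co (P l \<star> x) s))"
    by (subst sum.swap) (simp add: hom_distribs sum_distrib_left)
  also have "\<dots> = (\<Sum>t<d. w t * i (co (component Q a t \<star> x) s))"
  proof (rule sum.cong)
    fix t assume "t \<in> {..<d}"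
    then have t: "t < d" by simp
    have "component Q a t = (\<lambda>c. \<Sum>l<m. \<phi> (y l) t * P l c)"
    proof -
      have "\<phi> (y l * i z) t = \<phi> (y l) t * z" for l z
        using coord_mult[OF t, of z "y l"] by (simp add: mult.commute)
      then show ?thesis unfolding component_def Q using t by (simp add: coord_sum)
    qed
    then show "w t * i (\<Sum>l<m. \<phi> (y l) t * co (P l \<star> x) s) = w t * i (co (component Q a t \<star> x) s)"
      using operator_sum(2)[OF P x s, where k = "\<lambda>l. \<phi> (y l) t"] by simp
  qed simp
  finally show ?thesis .
qed

lemma represents_action_iff:
  "represents_action j i N Q f \<longleftrightarrow> f \<in> hom T T \<and>
    (\<forall>a. \<forall>x\<in>carrier N. \<forall>m::nat. \<forall>y P. (\<forall>l<m. P l \<in> DK) \<and> (\<forall>c. Q (a * i c) = (\<Sum>l<m. y l * i (P l c))) \<longrightarrow>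
      f (pt a x) = finprod T (\<lambda>l. pt (y l) (P l \<star> x)) {..<m})"
  unfolding represents_action_def Let_def by blast

text \<open>The canonical decomposition defines a biadditive and balanced map, as is checked on
  coordinates. That the resulting homomorphism is correct for every other decomposition is their
  independence shown before.\<close>

lemma represents_action_exists:
  assumes Q: "Q \<in> DL"
  obtains f where "represents_action j i N Q f"
proof -
  obtain n where n: "Q \<in> diff_ops_of_order (i \<circ> j) n" using Q by (auto simp: diff_op_ring_simps)
  note lin = diff_ops_linear[OF ij_hom n]
  define \<psi> where "\<psi> a x = finprod T (\<lambda>t. pt (w t) (component Q a t \<star> x)) {..<d}" for a x
  have closed: "\<psi> a x \<in> carrier T" if "x \<in> carrier N" for a x
    unfolding \<psi>_def using that component_closed[OF Q] DK_smult_closed pt_closed_N by (intro T.finprod_closed) auto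
  have Crd_\<psi>: "tensor_coord s (\<psi> a x) = (\<Sum>t<d. w t * i (co (component Q a t \<star> x) s))"
    if "x \<in> carrier N" "s < r" for a x s
    unfolding \<psi>_def using that component_closed[OF Q] by (intro tensor_coord_decomposition) (auto simp: component_expand)
  have mult: "tensor_coord s (u \<otimes>\<^bsub>T\<^esub> v) = tensor_coord s u + tensor_coord s v" if "u \<in> carrier T" "v \<in> carrier T" "s < r" for s u v
    using Group.hom_mult[OF tensor_coord(1)[OF that(3)] that(1,2)] by simp
  obtain f where f: "f \<in> hom T T" "\<And>a x. x \<in> carrier N \<Longrightarrow> f (pt a x) = \<psi> a x"
  proof (rule tensor_universal[OF comm_group_T, of \<psi>], unfold underlying_space_simps)
    show "\<psi> (a + a') x = \<psi> a x \<otimes>\<^bsub>T\<^esub> \<psi> a' x" if x: "x \<in> carrier N" for a a' x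
    proof (rule tensor_eqI[OF closed T.m_closed[OF closed closed]])
      fix s assume s: "s < r"
      have "co (component Q (a + a') t \<star> x) s =
          co (component Q a t \<star> x) s + co (component Q a' t \<star> x) s" if t: "t < d" for t
      proof -
        have "component Q (a + a') t = component Q a t \<oplus>\<^bsub>diff_op_ring j\<^esub> component Q a' t"
          unfolding component_def diff_op_ring_simps using t
          by (simp add: distrib_right linear_operatorD[OF lin] coord_add)
        then show ?thesis using N.smult_l_distr[OF component_closed[OF Q t] component_closed[OF Q t] x]
          co_add[OF DK_smult_closed[OF component_closed[OF Q t] x] DK_smult_closed[OF component_closed[OF Q t] x] s]
          by simp
      qed
      then show "tensor_coord s (\<psi> (a + a') x) = tensor_coord s (\<psi> a x \<otimes>\<^bsub>T\<^esub> \<psi> a' x)"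
        using x s by (simp add: mult closed Crd_\<psi> hom_distribs distrib_left sum.distrib)
    qed (use x in auto)
    show "\<psi> a (x \<oplus>\<^bsub>N\<^esub> x') = \<psi> a x \<otimes>\<^bsub>T\<^esub> \<psi> a x'" if x: "x \<in> carrier N" "x' \<in> carrier N" for a x x'
    proof (rule tensor_eqI[OF closed T.m_closed[OF closed closed]])
      fix s assume s: "s < r"
      have "co (component Q a t \<star> (x \<oplus>\<^bsub>N\<^esub> x')) s =
          co (component Q a t \<star> x) s + co (component Q a t \<star> x') s" if t: "t < d" for t
        using N.smult_r_distr[OF component_closed[OF Q t] x]
          co_add[OF DK_smult_closed[OF component_closed[OF Q t] x(1)] DK_smult_closed[OF component_closed[OF Q t] x(2)] s]
        by simp
      then show "tensor_coord s (\<psi> a (x \<oplus>\<^bsub>N\<^esub> x')) = tensor_coord s (\<psi> a x \<otimes>\<^bsub>T\<^esub> \<psi> a x')"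
        using x s by (simp add: mult closed Crd_\<psi> hom_distribs distrib_left sum.distrib)
    qed (use x in auto)
    show "\<psi> (a * i c) x = \<psi> a ((\<lambda>z. c * z) \<star> x)" if x: "x \<in> carrier N" for a c x
    proof (rule tensor_eqI[OF closed closed])
      note cm = mult_in_diff_op_ring[OF j_hom, of c]
      show cx: "(\<lambda>z. c * z) \<star> x \<in> carrier N" using DK_smult_closed[OF cm x] .
      fix s assume s: "s < r"
      have "component Q (a * i c) t \<star> x = component Q a t \<star> ((\<lambda>z. c * z) \<star> x)" if t: "t < d" for t
      proof -
        have "component Q (a * i c) t = component Q a t \<otimes>\<^bsub>diff_op_ring j\<^esub> (\<lambda>z. c * z)"
          unfolding component_def diff_op_ring_simps by (simp add: o_def hom_distribs mult.assoc)
        then show ?thesis using N.smult_assoc[OF component_closed[OF Q t] cm x] by simp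
      qed
      then show "tensor_coord s (\<psi> (a * i c) x) = tensor_coord s (\<psi> a ((\<lambda>z. c * z) \<star> x))"
        using x cx s by (simp add: Crd_\<psi>)
    qed (use x in auto)
  qed (use closed in auto)
  have "represents_action j i N Q f"
    unfolding represents_action_iff
  proof (intro conjI allI ballI impI)
    fix a x y P and m :: nat
    assume x: "x \<in> carrier N" and P: "(\<forall>l<m. P l \<in> DK) \<and> (\<forall>c. Q (a * i c) = (\<Sum>l<m. y l * i (P l c)))"
    show "f (pt a x) = finprod T (\<lambda>l. pt (y l) (P l \<star> x)) {..<m}"
      unfolding f(2)[OF x]
    proof (rule tensor_eqI[OF closed[OF x]])
      show "finprod T (\<lambda>l. pt (y l) (P l \<star> x)) {..<m} \<in> carrier T"
        using P x DK_smult_closed pt_closed_N by (intro T.finprod_closed) auto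
      fix s assume s: "s < r"
      then show "tensor_coord s (\<psi> a x) = tensor_coord s (finprod T (\<lambda>l. pt (y l) (P l \<star> x)) {..<m})"
        using tensor_coord_decomposition[of m P Q a y x s] P x Crd_\<psi> by simp
    qed
  qed (rule f(1))
  then show thesis using that by blast
qed

lemma represents_action_component:
  assumes Q: "Q \<in> DL" and f: "represents_action j i N Q f" and x: "x \<in> carrier N"
  shows "f (pt a x) = finprod T (\<lambda>t. pt (w t) (component Q a t \<star> x)) {..<d}"
proof -
  have "(\<forall>l<d. component Q a l \<in> DK) \<and> (\<forall>c. Q (a * i c) = (\<Sum>l<d. w l * i (component Q a l c)))"
    using component_closed[OF Q] component_expand by auto
  then show ?thesis using f x unfolding represents_action_iff by blast
qed

lemma smult_inverse_image_eq:
  "Q \<odot>\<^bsub>inverse_image j i N\<^esub> t = (THE s. \<exists>f. represents_action j i N Q f \<and> s = f t)"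
  unfolding inverse_image_def Let_def module.select_convs by (rule refl)

text \<open>A representing homomorphism is determined on pure tensors by the canonical
  decomposition, and pure tensors generate. So the description in the definition of the scalar
  action has exactly one solution.\<close>

lemma smult_inverse_image:
  assumes Q: "Q \<in> DL" and f: "represents_action j i N Q f" and t: "t \<in> carrier T"
  shows "Q \<odot>\<^bsub>inverse_image j i N\<^esub> t = f t"
proof -
  have uniq: "f' t = f t" if f': "represents_action j i N Q f'" for f'
  proof (rule tensor_hom_eqI[OF _ _ T.is_group _ t])
    show "f' \<in> hom T T" "f \<in> hom T T" using f f' unfolding represents_action_iff by auto
    show "f' (pt a x) = f (pt a x)" if "x \<in> carrier (underlying_space N)" for a x
      using that represents_action_component[OF Q f] represents_action_component[OF Q f']
      by (simp add: underlying_space_simps)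
  qed
  show ?thesis unfolding smult_inverse_image_eq
  proof (rule the_equality)
    show "\<exists>f'. represents_action j i N Q f' \<and> f t = f' t" using f by blast
    fix s assume "\<exists>f'. represents_action j i N Q f' \<and> s = f' t"
    then obtain f' where "represents_action j i N Q f'" "s = f' t" by blast
    then show "s = f t" using uniq[of f'] by simp
  qed
qed

lemma inverse_image_simps:
  "carrier (inverse_image j i N) = carrier T" "x \<oplus>\<^bsub>inverse_image j i N\<^esub> y = x \<otimes>\<^bsub>T\<^esub> y"
  unfolding inverse_image_def Let_def by simp_all

lemma smult_pure_tensor:
  fixes m :: nat
  assumes Q: "Q \<in> DL" and x: "x \<in> carrier N" and P: "\<And>l. l < m \<Longrightarrow> P l \<in> DK"
    and eq: "\<And>c. Q (a * i c) = (\<Sum>l<m. y l * i (P l c))"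
  shows "Q \<odot>\<^bsub>inverse_image j i N\<^esub> pt a x = finprod T (\<lambda>l. pt (y l) (P l \<star> x)) {..<m}"
proof -
  obtain f where f: "represents_action j i N Q f" using represents_action_exists[OF Q] by blast
  then have "f (pt a x) = finprod T (\<lambda>l. pt (y l) (P l \<star> x)) {..<m}"
    using P eq x unfolding represents_action_iff by blast
  then show ?thesis using smult_inverse_image[OF Q f pt_closed_N[OF x]] by simp
qed

end

section \<open>Periods: coordinates of N in copies of a module of rank 1\<close>

locale isotypic_inverse_image = inverse_image_base i w \<phi> d j N b co r
  for i :: "'K::field \<Rightarrow> 'L::field" and w \<phi> d and j :: "'k::field \<Rightarrow> 'K"
    and N :: "('K \<Rightarrow> 'K, 'n) module" and b co r +
  fixes \<Lambda> :: "('L \<Rightarrow> 'L, 'm) module" and e :: nat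
    and f :: "('L \<times> 'n \<Rightarrow>\<^sub>0 int) set \<Rightarrow> nat \<Rightarrow> 'm" and lam :: 'm and \<kappa> :: "'m \<Rightarrow> 'L"
  assumes \<Lambda>: "left_module (diff_op_ring (i \<circ> j)) \<Lambda>"
    and f: "f \<in> iso (add_monoid (inverse_image j i N)) (add_monoid (power_module \<Lambda> e))"
    and f_smult: "Q \<in> carrier (diff_op_ring (i \<circ> j)) \<Longrightarrow> t \<in> carrier (inverse_image j i N) \<Longrightarrow>
      f (Q \<odot>\<^bsub>inverse_image j i N\<^esub> t) = Q \<odot>\<^bsub>power_module \<Lambda> e\<^esub> f t"
    and lam: "lam \<in> carrier \<Lambda>"
    and \<kappa>_expand: "v \<in> carrier \<Lambda> \<Longrightarrow> (\<lambda>z. \<kappa> v * z) \<odot>\<^bsub>\<Lambda>\<^esub> lam = v"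
    and \<kappa>_coord: "\<kappa> ((\<lambda>z. y * z) \<odot>\<^bsub>\<Lambda>\<^esub> lam) = y"
begin

sublocale \<Lambda>: left_module "diff_op_ring (i \<circ> j)" \<Lambda> by (rule \<Lambda>)

lemmas mult_DL = mult_in_diff_op_ring[OF ij_hom]

lemma scaled_lam_closed: "(\<lambda>z. y * z) \<odot>\<^bsub>\<Lambda>\<^esub> lam \<in> carrier \<Lambda>"
  by (rule \<Lambda>.smult_closed[OF mult_DL lam])

lemma scaled_lam_add:
  "(\<lambda>z. (y + y') * z) \<odot>\<^bsub>\<Lambda>\<^esub> lam = (\<lambda>z. y * z) \<odot>\<^bsub>\<Lambda>\<^esub> lam \<oplus>\<^bsub>\<Lambda>\<^esub> (\<lambda>z. y' * z) \<odot>\<^bsub>\<Lambda>\<^esub> lam"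
  using \<Lambda>.smult_l_distr[OF mult_DL mult_DL lam, of y y'] by (simp add: diff_op_ring_simps distrib_right)

lemma \<kappa>_add: "v \<in> carrier \<Lambda> \<Longrightarrow> v' \<in> carrier \<Lambda> \<Longrightarrow> \<kappa> (v \<oplus>\<^bsub>\<Lambda>\<^esub> v') = \<kappa> v + \<kappa> v'"
  using scaled_lam_add[of "\<kappa> v" "\<kappa> v'"] \<kappa>_coord[of "\<kappa> v + \<kappa> v'"] by (simp only: \<kappa>_expand)

text \<open>The action on \<Lambda> transported to \<open>L\<close> along the generator
  \<open>lam\<close>. Multiplications act as usual, but \<open>act Q 1\<close> need not be
  \<open>Q 1\<close>: it records how \<open>Q\<close> acts on the generator.\<close>

definition act :: "('L \<Rightarrow> 'L) \<Rightarrow> 'L \<Rightarrow> 'L" where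
  "act Q y = \<kappa> (Q \<odot>\<^bsub>\<Lambda>\<^esub> ((\<lambda>z. y * z) \<odot>\<^bsub>\<Lambda>\<^esub> lam))"

lemma \<kappa>_smult: "v \<in> carrier \<Lambda> \<Longrightarrow> \<kappa> (Q \<odot>\<^bsub>\<Lambda>\<^esub> v) = act Q (\<kappa> v)"
  unfolding act_def by (simp only: \<kappa>_expand)

lemma act_mult: "act (\<lambda>z. a * z) y = a * y"
proof -
  have "(\<lambda>z. a * z) \<otimes>\<^bsub>diff_op_ring (i \<circ> j)\<^esub> (\<lambda>z. y * z) = (\<lambda>z. (a * y) * z)"
    by (simp add: diff_op_ring_simps fun_eq_iff mult.assoc)
  then show ?thesis unfolding act_def using \<Lambda>.smult_assoc[OF mult_DL mult_DL lam, of a y] \<kappa>_coord[of "a * y"]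
    by simp
qed

lemma act_compose:
  assumes "Q \<in> DL" "R \<in> DL"
  shows "act (\<lambda>z. Q (R z)) y = act Q (act R y)"
proof -
  have "(\<lambda>z. Q (R z)) = Q \<otimes>\<^bsub>diff_op_ring (i \<circ> j)\<^esub> R" by (simp add: diff_op_ring_simps fun_eq_iff)
  then have "act (\<lambda>z. Q (R z)) y = \<kappa> (Q \<odot>\<^bsub>\<Lambda>\<^esub> (R \<odot>\<^bsub>\<Lambda>\<^esub> ((\<lambda>z. y * z) \<odot>\<^bsub>\<Lambda>\<^esub> lam)))"
    unfolding act_def using \<Lambda>.smult_assoc[OF assms scaled_lam_closed] by simp
  also have "\<dots> = act Q (act R y)"
    using \<kappa>_smult[OF \<Lambda>.smult_closed[OF assms(2) scaled_lam_closed]] by (simp only: act_def)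
  finally show ?thesis .
qed

lemma act_add_op:
  assumes "Q \<in> DL" "R \<in> DL"
  shows "act (\<lambda>z. Q z + R z) y = act Q y + act R y"
proof -
  have "(\<lambda>z. Q z + R z) = Q \<oplus>\<^bsub>diff_op_ring (i \<circ> j)\<^esub> R" by (simp add: diff_op_ring_simps fun_eq_iff)
  then show ?thesis unfolding act_def
    using \<Lambda>.smult_l_distr[OF assms scaled_lam_closed, of y]
      \<kappa>_add[OF \<Lambda>.smult_closed[OF assms(1) scaled_lam_closed] \<Lambda>.smult_closed[OF assms(2) scaled_lam_closed]]
    by simp
qed

lemma act_add:
  assumes "Q \<in> DL"
  shows "act Q (y + y') = act Q y + act Q y'"
  unfolding act_def scaled_lam_add
  using \<Lambda>.smult_r_distr[OF assms scaled_lam_closed scaled_lam_closed]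
    \<kappa>_add[OF \<Lambda>.smult_closed[OF assms scaled_lam_closed] \<Lambda>.smult_closed[OF assms scaled_lam_closed]]
  by simp

lemma act_0: "Q \<in> DL \<Longrightarrow> act Q 0 = 0"
  using act_add[of Q 0 0] by (metis add.right_neutral add_left_cancel)

lemma act_sum: "Q \<in> DL \<Longrightarrow> act Q (sum g I) = (\<Sum>t\<in>I. act Q (g t))"
  by (induction I rule: infinite_finite_induct) (auto simp: act_0 act_add)

lemma power_module_simps:
  "carrier (power_module \<Lambda> e) = {..<e} \<rightarrow>\<^sub>E carrier \<Lambda>"
  "v \<oplus>\<^bsub>power_module \<Lambda> e\<^esub> v' = (\<lambda>l\<in>{..<e}. v l \<oplus>\<^bsub>\<Lambda>\<^esub> v' l)"
  "Q \<odot>\<^bsub>power_module \<Lambda> e\<^esub> v = (\<lambda>l\<in>{..<e}. Q \<odot>\<^bsub>\<Lambda>\<^esub> v l)"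
  unfolding power_module_def by simp_all

lemma f_bij: "bij_betw f (carrier T) ({..<e} \<rightarrow>\<^sub>E carrier \<Lambda>)"
  using f unfolding iso_def by (simp add: inverse_image_simps power_module_simps)

lemma f_closed: "t \<in> carrier T \<Longrightarrow> f t \<in> {..<e} \<rightarrow>\<^sub>E carrier \<Lambda>"
  using f_bij unfolding bij_betw_def by blast

lemma f_component_closed: "t \<in> carrier T \<Longrightarrow> m < e \<Longrightarrow> f t m \<in> carrier \<Lambda>"
  using f_closed by (auto simp: PiE_iff)

lemma f_mult: "t \<in> carrier T \<Longrightarrow> t' \<in> carrier T \<Longrightarrow> m < e \<Longrightarrow> f (t \<otimes>\<^bsub>T\<^esub> t') m = f t m \<oplus>\<^bsub>\<Lambda>\<^esub> f t' m"
  using f unfolding iso_def hom_def by (simp add: inverse_image_simps power_module_simps)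

definition summand_coord :: "nat \<Rightarrow> ('L \<times> 'n \<Rightarrow>\<^sub>0 int) set \<Rightarrow> 'L" where "summand_coord m t = \<kappa> (f t m)"

lemma summand_coord_hom: "m < e \<Longrightarrow> summand_coord m \<in> hom T add_group"
  unfolding summand_coord_def by (rule homI) (simp_all add: f_mult \<kappa>_add f_component_closed)

lemma summand_coord_finprod: "m < e \<Longrightarrow> g \<in> A \<rightarrow> carrier T \<Longrightarrow> summand_coord m (finprod T g A) = (\<Sum>t\<in>A. summand_coord m (g t))"
  using hom_finprod_comm_group[OF comm_group_T comm_group_add_group summand_coord_hom] by (simp add: finprod_add_group)

lemma summand_coord_smult:
  "Q \<in> DL \<Longrightarrow> t \<in> carrier T \<Longrightarrow> m < e \<Longrightarrow> summand_coord m (Q \<odot>\<^bsub>inverse_image j i N\<^esub> t) = act Q (summand_coord m t)"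
  unfolding summand_coord_def by (simp add: f_smult inverse_image_simps power_module_simps \<kappa>_smult f_component_closed)

text \<open>The coordinate with respect to \<open>lam\<close> of \<open>1 \<otimes> x\<close> in the
  \<open>m\<close>-th copy of \<Lambda>. Since \<open>N\<close> spans the tensor product over
  \<open>L\<close>, these numbers determine the isomorphism \<open>f\<close>.\<close>

definition period :: "'n \<Rightarrow> nat \<Rightarrow> 'L" where "period x m = summand_coord m (pt 1 x)"

lemma summand_coord_pt:
  assumes x: "x \<in> carrier N" and m: "m < e"
  shows "summand_coord m (pt a x) = a * period x m"
proof -
  have "(\<lambda>z. a * z) \<odot>\<^bsub>inverse_image j i N\<^esub> pt 1 x = finprod T (\<lambda>l. pt a (id \<star> x)) {..<1::nat}"
  proof (rule smult_pure_tensor[OF mult_DL x])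
    show "id \<in> DK" using N.R.one_closed by (simp add: diff_op_ring_simps)
  qed simp
  also have "\<dots> = pt a x"
    using N.smult_one[OF x] pt_closed_N[OF x] by (simp add: diff_op_ring_simps lessThan_Suc)
  finally have "summand_coord m (pt a x) = act (\<lambda>z. a * z) (summand_coord m (pt 1 x))"
    using summand_coord_smult[OF mult_DL pt_closed_N[OF x] m] by metis
  then show ?thesis unfolding act_mult period_def .
qed

lemma period_expand:
  assumes x: "x \<in> carrier N" and m: "m < e"
  shows "period x m = (\<Sum>s<r. i (co x s) * period (b s) m)"
proof -
  have "period x m = summand_coord m (finprod T (\<lambda>s. pt (tensor_coord s (pt 1 x)) (b s)) {..<r})"
    unfolding period_def using tensor_expand[OF pt_closed_N[OF x], of 1] by simp
  also have "\<dots> = (\<Sum>s<r. i (co x s) * period (b s) m)"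
    using m b_closed by (subst summand_coord_finprod) (auto simp: summand_coord_pt tensor_coord(2)[OF _ x] pt_closed_N)
  finally show ?thesis .
qed

text \<open>Linearity of \<open>f\<close> over \<open>D_L\<close> allows \<open>Q\<close> to be
  applied to \<open>1 \<otimes> x\<close> on either side: in the tensor product by a decomposition
  of \<open>Q\<close> on \<open>K\<close>, in the copies of \<Lambda> by \<open>act\<close>.\<close>

lemma period_act:
  fixes n :: nat
  assumes Q: "Q \<in> DL" and x: "x \<in> carrier N" and P: "\<And>l. l < n \<Longrightarrow> P l \<in> DK"
    and eq: "\<And>c. Q (i c) = (\<Sum>l<n. y l * i (P l c))" and m: "m < e"
  shows "act Q (period x m) = (\<Sum>l<n. y l * period (P l \<star> x) m)"
proof -
  have "act Q (period x m) = summand_coord m (Q \<odot>\<^bsub>inverse_image j i N\<^esub> pt 1 x)"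
    unfolding period_def using summand_coord_smult[OF Q pt_closed_N[OF x] m] by simp
  also have "\<dots> = summand_coord m (finprod T (\<lambda>l. pt (y l) (P l \<star> x)) {..<n})"
    using smult_pure_tensor[OF Q x, of n P 1 y] P eq by simp
  also have "\<dots> = (\<Sum>l<n. y l * period (P l \<star> x) m)"
    using m P DK_smult_closed[OF _ x] by (subst summand_coord_finprod) (auto simp: summand_coord_pt pt_closed_N)
  finally show ?thesis .
qed

lemma summand_coord_combination:
  "m < e \<Longrightarrow> summand_coord m (finprod T (\<lambda>s. pt (c s) (b s)) {..<r}) = (\<Sum>s<r. c s * period (b s) m)"
  using b_closed by (subst summand_coord_finprod) (auto simp: summand_coord_pt pt_closed_N)

lemma period_surj: "\<exists>c. \<forall>m<e. (\<Sum>s<r. c s * period (b s) m) = y m"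
proof -
  define v where "v = (\<lambda>m\<in>{..<e}. (\<lambda>z. y m * z) \<odot>\<^bsub>\<Lambda>\<^esub> lam)"
  have "v \<in> {..<e} \<rightarrow>\<^sub>E carrier \<Lambda>" unfolding v_def using scaled_lam_closed by auto
  then have "v \<in> f ` carrier T" using f_bij unfolding bij_betw_def by simp
  then obtain t where t: "t \<in> carrier T" "f t = v" by blast
  have "y m = (\<Sum>s<r. tensor_coord s t * period (b s) m)" if m: "m < e" for m
  proof -
    have "y m = summand_coord m t" unfolding summand_coord_def t(2) v_def using m \<kappa>_coord by simp
    also have "\<dots> = summand_coord m (finprod T (\<lambda>s. pt (tensor_coord s t) (b s)) {..<r})"
      using tensor_expand[OF t(1)] by simp
    finally show ?thesis unfolding summand_coord_combination[OF m] .
  qed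
  then show ?thesis by (intro exI[of _ "\<lambda>s. tensor_coord s t"]) simp
qed

lemma period_inj:
  assumes "\<And>m. m < e \<Longrightarrow> (\<Sum>s<r. c s * period (b s) m) = 0" "s < r"
  shows "c s = 0"
proof -
  let ?t = "finprod T (\<lambda>s. pt (c s) (b s)) {..<r}"
  have t: "?t \<in> carrier T" using b_closed by (intro T.finprod_closed) (auto simp: pt_closed_N)
  have one: "summand_coord m \<one>\<^bsub>T\<^esub> = 0" if "m < e" for m
    using summand_coord_finprod[OF that, of "\<lambda>_. \<one>\<^bsub>T\<^esub>" "{} :: nat set"] by simp
  have "f ?t m = f \<one>\<^bsub>T\<^esub> m" for m
  proof (cases "m < e")
    case True
    have "\<kappa> (f ?t m) = \<kappa> (f \<one>\<^bsub>T\<^esub> m)"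
      using one[OF True] summand_coord_combination[OF True] assms(1)[OF True] unfolding summand_coord_def by simp
    then show ?thesis
      using \<kappa>_expand f_component_closed[OF t True] f_component_closed[OF T.one_closed True] by metis
  next
    \<comment> \<open>Elements of the power are extensional functions, so both values are
      \<open>undefined\<close> outside \<open>{..<e}\<close>.\<close>
    case False
    then show ?thesis using f_closed[OF t] f_closed[OF T.one_closed] by (auto simp: PiE_iff extensional_def)
  qed
  then have "f ?t = f \<one>\<^bsub>T\<^esub>" by blast
  then have "?t = \<one>\<^bsub>T\<^esub>" using f_bij t unfolding bij_betw_def inj_on_def by blast
  moreover have "tensor_coord s \<one>\<^bsub>T\<^esub> = 0"
    using tensor_coord_finprod[OF assms(2), of "\<lambda>_. \<one>\<^bsub>T\<^esub>" "{} :: nat set"] by simp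
  ultimately show ?thesis using tensor_coord_combination[OF assms(2), of c] by simp
qed

end

section \<open>Galois descent of an isotypic inverse image\<close>

lemma sum_mult_swap:
  fixes a :: "_ \<Rightarrow> _ \<Rightarrow> 'a::comm_ring"
  shows "(\<Sum>s\<in>S. (\<Sum>m\<in>M. a m s * x m) * y s) = (\<Sum>m\<in>M. (\<Sum>s\<in>S. a m s * y s) * x m)"
    and "(\<Sum>s\<in>S. (\<Sum>m\<in>M. x m * a m s) * y s) = (\<Sum>m\<in>M. x m * (\<Sum>s\<in>S. a m s * y s))"
  by (simp_all only: sum_distrib_right sum_distrib_left) (subst sum.swap, simp only: ac_simps)+

lemma index_mult_mat_vec_sum:
  assumes "M \<in> carrier_mat n r" "m < n"
  shows "(M *\<^sub>v vec r g) $ m = (\<Sum>t<r. M $$ (m, t) * g t)"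
  using assms by (simp add: scalar_prod_def lessThan_atLeast0)

lemma map_mat_smult:
  assumes "\<And>x y. g (x * y) = g x * g y"
  shows "map_mat g (a \<cdot>\<^sub>m M) = g a \<cdot>\<^sub>m map_mat g M"
  by (rule eq_matI) (auto simp: assms)

locale isotypic_galois_descent =
  isotypic_inverse_image i w \<phi> d j N b co r \<Lambda> e f lam \<kappa> + galois_basis i w \<phi> d
  for i :: "'K::field \<Rightarrow> 'L::field" and w \<phi> d
    and j :: "'k::{alg_closed_field, field_char_0} \<Rightarrow> 'K"
    and N :: "('K \<Rightarrow> 'K, 'n) module" and b co r
    and \<Lambda> :: "('L \<Rightarrow> 'L, 'm) module" and e f lam \<kappa> +
  assumes simple: "simple_left_module (diff_op_ring j) N"
begin

abbreviation h :: "'k \<Rightarrow> 'L" where "h \<equiv> i \<circ> j"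

sublocale h: field_hom h by (rule ij_hom)

sublocale j: field_hom j by (rule j_hom)

text \<open>Surjectivity solves for an inverse on one side. Its defect on the other side lies in the
  kernel of the period map, so injectivity removes it. At this stage \<open>e\<close> and
  \<open>r\<close> may still differ, which excludes square matrices.\<close>

lemma bij_period_coefficients:
  obtains c where "\<And>m m'. m < e \<Longrightarrow> m' < e \<Longrightarrow> (\<Sum>s<r. period (b s) m * c s m') = (if m = m' then 1 else 0)"
    "\<And>s s'. s < r \<Longrightarrow> s' < r \<Longrightarrow> (\<Sum>m<e. c s m * period (b s') m) = (if s = s' then 1 else 0)"
proof -
  have "\<exists>c. \<forall>m<e. (\<Sum>s<r. c s * period (b s) m) = (if m = m' then 1 else 0)" for m'
    using period_surj[of "\<lambda>m. if m = m' then 1 else 0"] by blast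
  then obtain c where c: "\<And>m m'. m < e \<Longrightarrow> (\<Sum>s<r. c m' s * period (b s) m) = (if m = m' then 1 else 0)"
    by metis
  show thesis
  proof (rule that[of "\<lambda>s m. c m s"])
    show "(\<Sum>s<r. period (b s) m * c m' s) = (if m = m' then 1 else 0)" if "m < e" for m m'
      using c[OF that, of m'] by (simp add: mult.commute)
    fix s s' assume s: "s < r" "s' < r"
    have "(\<Sum>m<e. c m s * period (b s') m) - (if s = s' then 1 else 0) = 0"
    proof (rule period_inj[OF _ s(1), of "\<lambda>s. (\<Sum>m<e. c m s * period (b s') m) - (if s = s' then 1 else 0)"])
      fix m assume m: "m < e"
      have "(\<Sum>s<r. (\<Sum>m'<e. c m' s * period (b s') m') * period (b s) m) =
          (\<Sum>m'<e. (\<Sum>s<r. c m' s * period (b s) m) * period (b s') m')"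
        by (rule sum_mult_swap(1))
      also have "\<dots> = (\<Sum>m'<e. if m = m' then period (b s') m' else 0)"
        using c[OF m] by (intro sum.cong) auto
      also have "\<dots> = period (b s') m" using m by simp
      finally have 1: "(\<Sum>s<r. (\<Sum>m'<e. c m' s * period (b s') m') * period (b s) m) = period (b s') m" .
      have "(\<Sum>s<r. (if s = s' then 1 else 0) * period (b s) m) = (\<Sum>s<r. if s = s' then period (b s) m else 0)"
        by (intro sum.cong) auto
      also have "\<dots> = period (b s') m" using s by simp
      finally show "(\<Sum>s<r. ((\<Sum>m<e. c m s * period (b s') m) - (if s = s' then 1 else 0)) * period (b s) m) = 0"
        using 1 by (simp add: left_diff_distrib sum_subtractf)
    qed
    then show "(\<Sum>m<e. c m s * period (b s') m) = (if s = s' then 1 else 0)" by simp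
  qed
qed

lemma of_nat_L_inject: "(of_nat n :: 'L) = of_nat m \<Longrightarrow> n = m"
proof -
  assume "(of_nat n :: 'L) = of_nat m"
  then have "h (of_nat n) = h (of_nat m)" by (simp only: h.hom_of_nat)
  then have "(of_nat n :: 'k) = of_nat m" by (rule h.injectivity)
  then show ?thesis by simp
qed

text \<open>The trace of the identity matrix computes both \<open>e\<close> and \<open>r\<close> in \<open>L\<close>.\<close>
lemma e_eq_r: "e = r"
proof -
  obtain c where c: "\<And>m m'. m < e \<Longrightarrow> m' < e \<Longrightarrow> (\<Sum>s<r. period (b s) m * c s m') = (if m = m' then 1 else 0)"
    "\<And>s s'. s < r \<Longrightarrow> s' < r \<Longrightarrow> (\<Sum>m<e. c s m * period (b s') m) = (if s = s' then 1 else 0)"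
    using bij_period_coefficients by blast
  have "(of_nat e :: 'L) = (\<Sum>m<e. \<Sum>s<r. period (b s) m * c s m)" using c(1) by simp
  also have "\<dots> = (\<Sum>s<r. \<Sum>m<e. c s m * period (b s) m)"
    by (subst sum.swap) (simp add: mult.commute)
  also have "\<dots> = of_nat r" using c(2) by simp
  finally show ?thesis by (rule of_nat_L_inject)
qed

lemmas period_expand_r = period_expand[unfolded e_eq_r]
lemmas period_act_r = period_act[unfolded e_eq_r]

definition period_mat :: "'L mat" where "period_mat = mat r r (\<lambda>(m, s). period (b s) m)"

definition period_inv :: "'L mat" where
  "period_inv = (SOME M. M \<in> carrier_mat r r \<and> period_mat * M = 1\<^sub>m r \<and> M * period_mat = 1\<^sub>m r)"

lemma period_mat_carrier: "period_mat \<in> carrier_mat r r" unfolding period_mat_def by simp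

lemma period_mat_index: "m < r \<Longrightarrow> s < r \<Longrightarrow> period_mat $$ (m, s) = period (b s) m" unfolding period_mat_def by simp

lemma period_inv: "period_inv \<in> carrier_mat r r" "period_mat * period_inv = 1\<^sub>m r" "period_inv * period_mat = 1\<^sub>m r"
proof -
  obtain c where c: "\<And>m m'. m < r \<Longrightarrow> m' < r \<Longrightarrow> (\<Sum>s<r. period (b s) m * c s m') = (if m = m' then 1 else 0)"
    "\<And>s s'. s < r \<Longrightarrow> s' < r \<Longrightarrow> (\<Sum>m<r. c s m * period (b s') m) = (if s = s' then 1 else 0)"
    using bij_period_coefficients[unfolded e_eq_r] by blast
  define C' where "C' = mat r r (\<lambda>(s, m). c s m)"
  have C': "C' \<in> carrier_mat r r" unfolding C'_def by simp
  have "(period_mat * C') $$ (m, m') = 1\<^sub>m r $$ (m, m')" if "m < r" "m' < r" for m m'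
    using index_mult_mat_sum[OF period_mat_carrier C' that] c(1)[OF that] that by (simp add: period_mat_index C'_def)
  then have "period_mat * C' = 1\<^sub>m r" using period_mat_carrier C' by (intro eq_matI) auto
  moreover have "(C' * period_mat) $$ (s, s') = 1\<^sub>m r $$ (s, s')" if "s < r" "s' < r" for s s'
    using index_mult_mat_sum[OF C' period_mat_carrier that] c(2)[OF that] that by (simp add: period_mat_index C'_def)
  then have "C' * period_mat = 1\<^sub>m r" using period_mat_carrier C' by (intro eq_matI) auto
  ultimately have "C' \<in> carrier_mat r r \<and> period_mat * C' = 1\<^sub>m r \<and> C' * period_mat = 1\<^sub>m r" using C' by blast
  then have "period_inv \<in> carrier_mat r r \<and> period_mat * period_inv = 1\<^sub>m r \<and> period_inv * period_mat = 1\<^sub>m r" unfolding period_inv_def by (rule someI)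
  then show "period_inv \<in> carrier_mat r r" "period_mat * period_inv = 1\<^sub>m r" "period_inv * period_mat = 1\<^sub>m r" by auto
qed

lemma r_pos: "r > 0"
proof (rule ccontr)
  assume "\<not> r > 0"
  have "x = \<zero>\<^bsub>N\<^esub>" if "x \<in> carrier N" for x
    using co_expand[OF that] \<open>\<not> r > 0\<close> by (simp add: underlying_space_simps)
  then show False using simple unfolding simple_left_module_def by blast
qed

lemma galois_hom: "\<sigma> \<in> galois_group \<Longrightarrow> field_hom \<sigma>"
  by unfold_locales (simp_all add: galois_groupD)

section \<open>The Galois cocycle of the period matrix\<close>

definition conjugate :: "('L \<Rightarrow> 'L) \<Rightarrow> ('L \<Rightarrow> 'L) \<Rightarrow> 'L \<Rightarrow> 'L" where
  "conjugate \<sigma> Q = (\<lambda>x. \<sigma> (Q (inv_into UNIV \<sigma> x)))"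

lemma galois_inv:
  assumes "\<sigma> \<in> galois_group"
  shows "\<sigma> (inv_into UNIV \<sigma> x) = x" "inv_into UNIV \<sigma> (\<sigma> x) = x"
  using galois_groupD(1)[OF assms] by (simp_all add: bij_is_surj surj_f_inv_f bij_is_inj)

lemma conjugate_DL:
  assumes \<sigma>: "\<sigma> \<in> galois_group" and Q: "Q \<in> DL"
  shows "conjugate \<sigma> Q \<in> DL"
proof -
  obtain n where "Q \<in> diff_ops_of_order h n" using Q by (auto simp: diff_op_ring_simps)
  from diff_ops_conjugate[OF ij_hom _ _ _ _ _ this, of \<sigma> "inv_into UNIV \<sigma>"]
  have "conjugate \<sigma> Q \<in> diff_ops_of_order h n"
    unfolding conjugate_def by (simp add: galois_groupD[OF \<sigma>] galois_inv[OF \<sigma>])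
  then show ?thesis by (auto simp: diff_op_ring_simps)
qed

lemma compose_mult_DL: "Q \<in> DL \<Longrightarrow> (\<lambda>z. Q (a * z)) \<in> DL"
  using \<Lambda>.R.m_closed[OF _ mult_DL, of Q a] by (simp add: diff_op_ring_simps o_def)

lemma act_compose_mult: "Q \<in> DL \<Longrightarrow> act (\<lambda>z. Q (a * z)) y = act Q (a * y)"
  using act_compose[OF _ mult_DL] by (simp add: act_mult)

text \<open>The coefficient of \<open>1 \<otimes> b t\<close> in the image of
  \<open>1 \<otimes> b s\<close> under \<open>Q\<close>.\<close>

definition period_action :: "('L \<Rightarrow> 'L) \<Rightarrow> nat \<Rightarrow> nat \<Rightarrow> 'L" where
  "period_action Q t s = (\<Sum>u<d. w u * i (co (component Q 1 u \<star> b s) t))"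

text \<open>As \<sigma> fixes \<open>K\<close>, the conjugated operator decomposes on
  \<open>K\<close> with the same \<open>K\<close>-operators and with coefficients
  \<open>\<sigma> (w u)\<close>. Its matrix on the basis is thus \<sigma> applied to the matrix of
  \<open>Q\<close>, while the periods outside remain unconjugated.\<close>

lemma act_conjugate_period:
  assumes \<sigma>: "\<sigma> \<in> galois_group" and Q: "Q \<in> DL" and m: "m < r" and s: "s < r"
  shows "act (conjugate \<sigma> Q) (period (b s) m) = (\<Sum>t<r. period (b t) m * \<sigma> (period_action Q t s))"
proof -
  note P = component_closed[OF Q]
  have "act (conjugate \<sigma> Q) (period (b s) m) = (\<Sum>u<d. \<sigma> (w u) * period (component Q 1 u \<star> b s) m)"
  proof (rule period_act_r[OF conjugate_DL[OF \<sigma> Q] b_closed[OF s] P _ m])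
    show "conjugate \<sigma> Q (i c) = (\<Sum>u<d. \<sigma> (w u) * i (component Q 1 u c))" for c
    proof -
      have "inv_into UNIV \<sigma> (i c) = i c" using galois_inv(2)[OF \<sigma>, of "i c"] galois_groupD(5)[OF \<sigma>] by simp
      then have "conjugate \<sigma> Q (i c) = \<sigma> (Q (1 * i c))" unfolding conjugate_def by simp
      also have "\<dots> = \<sigma> (\<Sum>u<d. w u * i (component Q 1 u c))" unfolding component_expand ..
      finally show ?thesis by (simp add: galois_groupD[OF \<sigma>])
    qed
  qed
  also have "\<dots> = (\<Sum>u<d. \<sigma> (w u) * (\<Sum>t<r. i (co (component Q 1 u \<star> b s) t) * period (b t) m))"
    using period_expand_r[OF DK_smult_closed[OF P b_closed[OF s]] m] by simp
  also have "\<dots> = (\<Sum>t<r. \<Sum>u<d. period (b t) m * (\<sigma> (w u) * i (co (component Q 1 u \<star> b s) t)))"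
    by (subst sum.swap) (simp add: sum_distrib_left ac_simps)
  also have "\<dots> = (\<Sum>t<r. period (b t) m * \<sigma> (period_action Q t s))"
    unfolding period_action_def by (simp add: galois_groupD[OF \<sigma>] sum_distrib_left)
  finally show ?thesis .
qed

lemma act_period:
  assumes "Q \<in> DL" "m < r" "s < r"
  shows "act Q (period (b s) m) = (\<Sum>t<r. period (b t) m * period_action Q t s)"
proof -
  have "conjugate id Q = Q" unfolding conjugate_def by simp
  then show ?thesis using act_conjugate_period[OF galois_group_id assms] by simp
qed

definition cocycle :: "('L \<Rightarrow> 'L) \<Rightarrow> 'L mat" where "cocycle \<sigma> = period_mat * map_mat \<sigma> period_inv"

lemma cocycle_carrier: "cocycle \<sigma> \<in> carrier_mat r r" unfolding cocycle_def using period_mat_carrier period_inv(1) by simp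

lemma cocycle_index: "m < r \<Longrightarrow> l < r \<Longrightarrow> cocycle \<sigma> $$ (m, l) = (\<Sum>s<r. period (b s) m * \<sigma> (period_inv $$ (s, l)))"
  unfolding cocycle_def using period_inv(1)
  by (subst index_mult_mat_sum[OF period_mat_carrier, of _ r]) (auto simp: period_mat_index)

lemma period_inv_mat_index: "s < r \<Longrightarrow> s' < r \<Longrightarrow> (\<Sum>m<r. period_inv $$ (s, m) * period (b s') m) = (if s = s' then 1 else 0)"
  using index_mult_mat_sum[OF period_inv(1) period_mat_carrier, of s s'] period_inv(3) by (simp add: period_mat_index)

lemma period_mat_inv_index: "m < r \<Longrightarrow> l < r \<Longrightarrow> (\<Sum>s<r. period (b s) m * period_inv $$ (s, l)) = (if m = l then 1 else 0)"
  using index_mult_mat_sum[OF period_mat_carrier period_inv(1), of m l] period_inv(2) by (simp add: period_mat_index)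

text \<open>\<open>act Q\<close> is not \<open>L\<close>-linear, so it is applied to the product of
  \<open>period_mat\<close> and its inverse through the operators \<open>?Q s\<close>, in which an
  entry of the inverse is absorbed. Their matrices add up to a column of the inverse times
  \<open>act Q 1\<close>; conjugation applies \<sigma> to this sum only. The resulting factor
  \<open>\<sigma> (act Q 1)\<close> is the same for all entries \<open>(m, l)\<close>.\<close>

lemma act_conjugate_cocycle:
  assumes \<sigma>: "\<sigma> \<in> galois_group" and Q: "Q \<in> DL" and m: "m < r" and l: "l < r"
  shows "act (conjugate \<sigma> Q) (cocycle \<sigma> $$ (m, l)) = cocycle \<sigma> $$ (m, l) * \<sigma> (act Q 1)"
proof -
  let ?Q = "\<lambda>s z. Q (period_inv $$ (s, l) * z)"
  note cQ = conjugate_DL[OF \<sigma> Q]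
  have Qs: "?Q s \<in> DL" for s by (rule compose_mult_DL[OF Q])
  have "(\<Sum>s<r. period_action (?Q s) t s) = period_inv $$ (t, l) * act Q 1" if t: "t < r" for t
  proof -
    \<comment> \<open>The claim is first established after multiplication by the period matrix,
      where it is \<open>act Q\<close> of the identity matrix; that matrix is then inverted.\<close>
    have row: "(\<Sum>t'<r. period (b t') m' * (\<Sum>s<r. period_action (?Q s) t' s)) = (if m' = l then act Q 1 else 0)"
      if m': "m' < r" for m'
    proof -
      have "(\<Sum>t'<r. period (b t') m' * (\<Sum>s<r. period_action (?Q s) t' s)) =
          (\<Sum>s<r. \<Sum>t'<r. period (b t') m' * period_action (?Q s) t' s)"
        by (simp add: sum_distrib_left) (rule sum.swap)
      also have "\<dots> = (\<Sum>s<r. act Q (period_inv $$ (s, l) * period (b s) m'))"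
        using act_period[OF Qs m'] act_compose_mult[OF Q] by simp
      also have "\<dots> = act Q (\<Sum>s<r. period (b s) m' * period_inv $$ (s, l))"
        by (simp add: act_sum[OF Q] mult.commute)
      finally show ?thesis using period_mat_inv_index[OF m' l] act_0[OF Q] by simp
    qed
    have "(\<Sum>s<r. period_action (?Q s) t s) =
        (\<Sum>t'<r. if t = t' then \<Sum>s<r. period_action (?Q s) t' s else 0)" using t by simp
    also have "\<dots> = (\<Sum>t'<r. (\<Sum>m'<r. period_inv $$ (t, m') * period (b t') m') * (\<Sum>s<r. period_action (?Q s) t' s))"
      using period_inv_mat_index[OF t] by (intro sum.cong) auto
    also have "\<dots> = (\<Sum>m'<r. period_inv $$ (t, m') * (\<Sum>t'<r. period (b t') m' * (\<Sum>s<r. period_action (?Q s) t' s)))"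
      by (rule sum_mult_swap(2))
    also have "\<dots> = (\<Sum>m'<r. if m' = l then period_inv $$ (t, m') * act Q 1 else 0)"
      using row by (intro sum.cong) auto
    finally show ?thesis using l by simp
  qed
  note cols = this
  have "act (conjugate \<sigma> Q) (cocycle \<sigma> $$ (m, l)) = (\<Sum>s<r. act (conjugate \<sigma> Q) (\<sigma> (period_inv $$ (s, l)) * period (b s) m))"
    unfolding cocycle_index[OF m l] by (simp add: act_sum[OF cQ] mult.commute)
  also have "\<dots> = (\<Sum>s<r. act (conjugate \<sigma> (?Q s)) (period (b s) m))"
  proof (rule sum.cong)
    fix s
    have "inv_into UNIV \<sigma> (\<sigma> x * z) = x * inv_into UNIV \<sigma> z" for x z
      using galois_groupD(3)[OF galois_group_inv[OF \<sigma>]] galois_inv[OF \<sigma>] by simp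
    then have "conjugate \<sigma> (?Q s) = (\<lambda>z. conjugate \<sigma> Q (\<sigma> (period_inv $$ (s, l)) * z))"
      unfolding conjugate_def by (simp add: fun_eq_iff)
    then show "act (conjugate \<sigma> Q) (\<sigma> (period_inv $$ (s, l)) * period (b s) m) = act (conjugate \<sigma> (?Q s)) (period (b s) m)"
      using act_compose_mult[OF cQ] by simp
  qed simp
  also have "\<dots> = (\<Sum>s<r. \<Sum>t<r. period (b t) m * \<sigma> (period_action (?Q s) t s))"
    using act_conjugate_period[OF \<sigma> Qs m] by simp
  also have "\<dots> = (\<Sum>t<r. period (b t) m * \<sigma> (\<Sum>s<r. period_action (?Q s) t s))"
    by (subst sum.swap) (simp add: galois_groupD[OF \<sigma>] sum_distrib_left)
  also have "\<dots> = (\<Sum>t<r. period (b t) m * \<sigma> (period_inv $$ (t, l)) * \<sigma> (act Q 1))"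
    using cols by (simp add: galois_groupD[OF \<sigma>] mult.assoc)
  finally show ?thesis unfolding cocycle_index[OF m l] by (simp add: sum_distrib_right)
qed

text \<open>If c = a' / a is not constant, some derivation \<theta> has
  \<open>\<theta> c = 1\<close>. As operators, \<theta> after multiplication by c equals c times
  \<theta> plus the identity, so \<theta> acts on a' with an extra summand a. The common factor q of
  a and a' excludes this.\<close>

lemma constant_ratio:
  assumes "a \<noteq> 0" "\<And>Q. Q \<in> DL \<Longrightarrow> \<exists>q. act Q a = a * q \<and> act Q a' = a' * q"
  shows "\<exists>k. a' = a * h k"
proof (rule ccontr)
  assume "\<not> ?thesis"
  moreover have "a' = a * (a' / a)" using assms(1) by simp
  ultimately have "a' / a \<notin> range h" by (metis imageE)
  then obtain \<theta> where \<theta>: "\<And>x y. \<theta> (x + y) = \<theta> x + \<theta> y" "\<And>x y. \<theta> (x * y) = x * \<theta> y + \<theta> x * y"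
    "\<And>a. \<theta> (h a) = 0" "\<theta> (a' / a) = 1"
    using derivation_exists[OF ij_hom] by blast
  let ?c = "a' / a"
  have DL: "\<theta> \<in> DL" using diff_ops_derivation[OF ij_hom \<theta>(1-3)] unfolding diff_op_ring_simps by blast
  have cDL: "(\<lambda>z. ?c * \<theta> z) \<in> DL"
    using \<Lambda>.R.m_closed[OF mult_DL DL, of ?c] by (simp add: diff_op_ring_simps o_def)
  have idDL: "(\<lambda>z. z) \<in> DL" using mult_DL[of 1] by simp
  have "act \<theta> (?c * a) = act (\<lambda>z. \<theta> (?c * z)) a" by (rule act_compose_mult[OF DL, symmetric])
  also have "(\<lambda>z. \<theta> (?c * z)) = (\<lambda>z. ?c * \<theta> z + z)"
    by (rule ext) (simp only: \<theta>(2,4) mult_1_left)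
  also have "act \<dots> a = act (\<lambda>z. ?c * \<theta> z) a + act (\<lambda>z. z) a"
    by (rule act_add_op[OF cDL idDL])
  also have "act (\<lambda>z. ?c * \<theta> z) a = ?c * act \<theta> a"
    using act_compose[OF mult_DL DL, of ?c a] unfolding act_mult .
  also have "act (\<lambda>z. z) a = a" using act_mult[of 1 a] by simp
  finally have 1: "act \<theta> a' = ?c * act \<theta> a + a" using assms(1) by simp
  obtain q where "act \<theta> a = a * q" "act \<theta> a' = a' * q" using assms(2)[OF DL] by blast
  then have "a = 0" using 1 assms(1) by simp
  then show False using assms(1) by simp
qed

section \<open>The projective representation over the constants\<close>

lemma cocycle_compose:
  assumes \<sigma>: "\<sigma> \<in> galois_group" and \<tau>: "\<tau> \<in> galois_group"
  shows "cocycle (\<sigma> \<circ> \<tau>) = cocycle \<sigma> * map_mat \<sigma> (cocycle \<tau>)"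
proof -
  interpret \<sigma>: field_hom \<sigma> by (rule galois_hom[OF \<sigma>])
  have c: "map_mat \<sigma> period_inv \<in> carrier_mat r r" "map_mat \<sigma> period_mat \<in> carrier_mat r r" "map_mat \<tau> period_inv \<in> carrier_mat r r"
    "map_mat \<sigma> (map_mat \<tau> period_inv) \<in> carrier_mat r r"
    using period_mat_carrier period_inv(1) by auto
  have "cocycle \<sigma> * map_mat \<sigma> (cocycle \<tau>) = period_mat * map_mat \<sigma> period_inv * (map_mat \<sigma> period_mat * map_mat \<sigma> (map_mat \<tau> period_inv))"
    unfolding cocycle_def using \<sigma>.mat_hom_mult[OF period_mat_carrier c(3)] by simp
  also have "\<dots> = period_mat * (map_mat \<sigma> period_inv * map_mat \<sigma> period_mat) * map_mat \<sigma> (map_mat \<tau> period_inv)"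
    using period_mat_carrier c by (simp add: assoc_mult_mat[of _ r r _ r _ r])
  also have "map_mat \<sigma> period_inv * map_mat \<sigma> period_mat = 1\<^sub>m r"
    using \<sigma>.mat_hom_mult[OF period_inv(1) period_mat_carrier] period_inv(3) \<sigma>.mat_hom_one by simp
  also have "map_mat \<sigma> (map_mat \<tau> period_inv) = map_mat (\<sigma> \<circ> \<tau>) period_inv" by (rule eq_matI) auto
  also have "period_mat * 1\<^sub>m r * map_mat (\<sigma> \<circ> \<tau>) period_inv = cocycle (\<sigma> \<circ> \<tau>)"
    unfolding cocycle_def using period_mat_carrier by simp
  finally show ?thesis by simp
qed

lemma cocycle_id: "cocycle id = 1\<^sub>m r"
proof -
  have "map_mat id period_inv = period_inv" by (rule eq_matI) auto
  then show ?thesis unfolding cocycle_def using period_inv(2) by simp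
qed

lemma det_cocycle: "\<sigma> \<in> galois_group \<Longrightarrow> det (cocycle \<sigma>) \<noteq> 0"
proof -
  assume \<sigma>: "\<sigma> \<in> galois_group"
  have "\<sigma> \<circ> inv_into UNIV \<sigma> = id" using galois_inv[OF \<sigma>] by auto
  then have "cocycle \<sigma> * map_mat \<sigma> (cocycle (inv_into UNIV \<sigma>)) = 1\<^sub>m r"
    using cocycle_compose[OF \<sigma> galois_group_inv[OF \<sigma>]] cocycle_id by simp
  moreover have "map_mat \<sigma> (cocycle (inv_into UNIV \<sigma>)) \<in> carrier_mat r r" using cocycle_carrier by simp
  ultimately have "det (cocycle \<sigma>) * det (map_mat \<sigma> (cocycle (inv_into UNIV \<sigma>))) = 1"
    using det_mult[OF cocycle_carrier] by (metis det_one)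
  then show ?thesis by auto
qed

lemma nonzero_entry:
  fixes M :: "'x::field mat"
  assumes "M \<in> carrier_mat r r" "det M \<noteq> 0"
  obtains p q where "p < r" "q < r" "M $$ (p, q) \<noteq> 0"
proof -
  have "M \<noteq> 0\<^sub>m r r" using assms(2) r_pos by auto
  then show thesis using that assms(1) by (metis carrier_matD eq_matI index_zero_mat)
qed

text \<open>Every operator \<open>Q\<close> is the \<sigma>-conjugate of another one, so the
  intertwining relation gives all entries of the cocycle the same factor under \<open>act Q\<close>.
  Their ratios to a fixed nonzero entry are therefore constants.\<close>

lemma cocycle_constant:
  assumes \<sigma>: "\<sigma> \<in> galois_group"
  shows "\<exists>a M. a \<noteq> 0 \<and> M \<in> carrier_mat r r \<and> cocycle \<sigma> = a \<cdot>\<^sub>m map_mat h M"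
proof -
  obtain p q where pq: "p < r" "q < r" "cocycle \<sigma> $$ (p, q) \<noteq> 0"
    using nonzero_entry[OF cocycle_carrier det_cocycle[OF \<sigma>]] by blast
  let ?a = "cocycle \<sigma> $$ (p, q)"
  have "\<exists>k. cocycle \<sigma> $$ (m, l) = ?a * h k" if ml: "m < r" "l < r" for m l
  proof (rule constant_ratio[OF pq(3)])
    fix Q assume Q: "Q \<in> DL"
    let ?R = "conjugate (inv_into UNIV \<sigma>) Q"
    have R: "?R \<in> DL" by (rule conjugate_DL[OF galois_group_inv[OF \<sigma>] Q])
    have "inv_into UNIV (inv_into UNIV \<sigma>) = \<sigma>" by (rule inv_inv_eq[OF galois_groupD(1)[OF \<sigma>]])
    then have "conjugate \<sigma> ?R = Q" unfolding conjugate_def by (simp add: galois_inv[OF \<sigma>])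
    then show "\<exists>q'. act Q ?a = ?a * q' \<and> act Q (cocycle \<sigma> $$ (m, l)) = cocycle \<sigma> $$ (m, l) * q'"
      using act_conjugate_cocycle[OF \<sigma> R pq(1,2)] act_conjugate_cocycle[OF \<sigma> R ml] by metis
  qed
  then obtain u where u: "\<And>m l. m < r \<Longrightarrow> l < r \<Longrightarrow> cocycle \<sigma> $$ (m, l) = ?a * h (u m l)" by metis
  have "cocycle \<sigma> = ?a \<cdot>\<^sub>m map_mat h (mat r r (\<lambda>(m, l). u m l))"
    by (rule eq_matI) (use cocycle_carrier[of \<sigma>] u in auto)
  then show ?thesis using pq(3) by (intro exI[of _ ?a] exI[of _ "mat r r (\<lambda>(m, l). u m l)"]) simp
qed

definition proj_scale :: "('L \<Rightarrow> 'L) \<Rightarrow> 'L" where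
  "proj_scale \<sigma> = (SOME a. \<exists>M. a \<noteq> 0 \<and> M \<in> carrier_mat r r \<and> cocycle \<sigma> = a \<cdot>\<^sub>m map_mat h M)"

definition proj_rep :: "('L \<Rightarrow> 'L) \<Rightarrow> 'k mat" where
  "proj_rep \<sigma> = (SOME M. proj_scale \<sigma> \<noteq> 0 \<and> M \<in> carrier_mat r r \<and> cocycle \<sigma> = proj_scale \<sigma> \<cdot>\<^sub>m map_mat h M)"

lemma proj_rep:
  assumes "\<sigma> \<in> galois_group"
  shows "proj_scale \<sigma> \<noteq> 0" "proj_rep \<sigma> \<in> carrier_mat r r" "cocycle \<sigma> = proj_scale \<sigma> \<cdot>\<^sub>m map_mat h (proj_rep \<sigma>)" "det (proj_rep \<sigma>) \<noteq> 0"
proof -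
  have "\<exists>M. proj_scale \<sigma> \<noteq> 0 \<and> M \<in> carrier_mat r r \<and> cocycle \<sigma> = proj_scale \<sigma> \<cdot>\<^sub>m map_mat h M"
    unfolding proj_scale_def by (rule someI_ex[OF cocycle_constant[OF assms]])
  from someI_ex[OF this]
  show proj_rep: "proj_scale \<sigma> \<noteq> 0" "proj_rep \<sigma> \<in> carrier_mat r r" "cocycle \<sigma> = proj_scale \<sigma> \<cdot>\<^sub>m map_mat h (proj_rep \<sigma>)"
    unfolding proj_rep_def by blast+
  have "det (cocycle \<sigma>) = proj_scale \<sigma> ^ r * h (det (proj_rep \<sigma>))"
    unfolding proj_rep(3) using proj_rep(2) h.hom_det[of "proj_rep \<sigma>"] by simp
  then show "det (proj_rep \<sigma>) \<noteq> 0" using det_cocycle[OF assms] by auto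
qed

text \<open>Automorphisms fix the constants, so the twist in the cocycle relation affects only the
  scale factors. This gives proportionality over \<open>L\<close>; a nonzero entry shows that the
  factor is the quotient of two constants.\<close>

lemma proj_rep_projective:
  assumes \<sigma>: "\<sigma> \<in> galois_group" and \<tau>: "\<tau> \<in> galois_group"
  shows "\<exists>c. proj_rep \<sigma> * proj_rep \<tau> = c \<cdot>\<^sub>m proj_rep (\<sigma> \<circ> \<tau>)"
proof -
  interpret \<sigma>: field_hom \<sigma> by (rule galois_hom[OF \<sigma>])
  note \<sigma>\<tau> = galois_group_comp[OF \<sigma> \<tau>]
  have \<sigma>h: "map_mat \<sigma> (map_mat h M) = map_mat h M" for M
    by (rule eq_matI) (auto simp: galois_groupD(5)[OF \<sigma>])
  let ?H = "map_mat h"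
  have Hc: "?H (proj_rep \<sigma>) \<in> carrier_mat r r" "?H (proj_rep \<tau>) \<in> carrier_mat r r" using proj_rep(2) \<sigma> \<tau> by auto
  have "proj_scale (\<sigma> \<circ> \<tau>) \<cdot>\<^sub>m ?H (proj_rep (\<sigma> \<circ> \<tau>)) = (proj_scale \<sigma> \<cdot>\<^sub>m ?H (proj_rep \<sigma>)) * map_mat \<sigma> (proj_scale \<tau> \<cdot>\<^sub>m ?H (proj_rep \<tau>))"
    using cocycle_compose[OF \<sigma> \<tau>] proj_rep(3) \<sigma> \<tau> \<sigma>\<tau> by simp
  also have "map_mat \<sigma> (proj_scale \<tau> \<cdot>\<^sub>m ?H (proj_rep \<tau>)) = \<sigma> (proj_scale \<tau>) \<cdot>\<^sub>m ?H (proj_rep \<tau>)"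
    using map_mat_smult[of \<sigma>, OF \<sigma>.hom_mult] \<sigma>h by simp
  also have "(proj_scale \<sigma> \<cdot>\<^sub>m ?H (proj_rep \<sigma>)) * (\<sigma> (proj_scale \<tau>) \<cdot>\<^sub>m ?H (proj_rep \<tau>)) = (proj_scale \<sigma> * \<sigma> (proj_scale \<tau>)) \<cdot>\<^sub>m (?H (proj_rep \<sigma>) * ?H (proj_rep \<tau>))"
    using Hc by (simp add: mult_smult_assoc_mat[of _ r r _ r] mult_smult_distrib[of _ r r _ r] smult_smult_mat mult.commute)
  also have "?H (proj_rep \<sigma>) * ?H (proj_rep \<tau>) = ?H (proj_rep \<sigma> * proj_rep \<tau>)"
    using h.mat_hom_mult[OF proj_rep(2)[OF \<sigma>] proj_rep(2)[OF \<tau>]] by simp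
  finally have eq: "proj_scale (\<sigma> \<circ> \<tau>) \<cdot>\<^sub>m ?H (proj_rep (\<sigma> \<circ> \<tau>)) = (proj_scale \<sigma> * \<sigma> (proj_scale \<tau>)) \<cdot>\<^sub>m ?H (proj_rep \<sigma> * proj_rep \<tau>)" .
  define c where "c = proj_scale (\<sigma> \<circ> \<tau>) / (proj_scale \<sigma> * \<sigma> (proj_scale \<tau>))"
  have nz: "proj_scale \<sigma> * \<sigma> (proj_scale \<tau>) \<noteq> 0" using proj_rep(1)[OF \<sigma>] proj_rep(1)[OF \<tau>] by simp
  have entry: "h ((proj_rep \<sigma> * proj_rep \<tau>) $$ (m, l)) = c * h (proj_rep (\<sigma> \<circ> \<tau>) $$ (m, l))" if "m < r" "l < r" for m l
    using arg_cong[OF eq, of "\<lambda>M. M $$ (m, l)"] that proj_rep(2)[OF \<sigma>] proj_rep(2)[OF \<tau>] proj_rep(2)[OF \<sigma>\<tau>] nz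
    unfolding c_def by (simp add: field_simps)
  obtain p q where pq: "p < r" "q < r" "proj_rep (\<sigma> \<circ> \<tau>) $$ (p, q) \<noteq> 0"
    using nonzero_entry[OF proj_rep(2,4)[OF \<sigma>\<tau>]] by blast
  define k where "k = (proj_rep \<sigma> * proj_rep \<tau>) $$ (p, q) / proj_rep (\<sigma> \<circ> \<tau>) $$ (p, q)"
  have "h (proj_rep (\<sigma> \<circ> \<tau>) $$ (p, q)) \<noteq> 0" using pq(3) by (simp only: h.hom_0_iff not_False_eq_True)
  then have ck: "c = h k" unfolding k_def h.hom_div using entry[OF pq(1,2)] by simp
  have "proj_rep \<sigma> * proj_rep \<tau> = k \<cdot>\<^sub>m proj_rep (\<sigma> \<circ> \<tau>)"
  proof (rule eq_matI)
    fix m l assume "m < dim_row (k \<cdot>\<^sub>m proj_rep (\<sigma> \<circ> \<tau>))" "l < dim_col (k \<cdot>\<^sub>m proj_rep (\<sigma> \<circ> \<tau>))"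
    then have ml: "m < r" "l < r" using proj_rep(2)[OF \<sigma>\<tau>] by auto
    have "h ((proj_rep \<sigma> * proj_rep \<tau>) $$ (m, l)) = h (k * proj_rep (\<sigma> \<circ> \<tau>) $$ (m, l))"
      unfolding h.hom_mult entry[OF ml] ck ..
    then show "(proj_rep \<sigma> * proj_rep \<tau>) $$ (m, l) = (k \<cdot>\<^sub>m proj_rep (\<sigma> \<circ> \<tau>)) $$ (m, l)"
      using ml proj_rep(2)[OF \<sigma>\<tau>] h.injectivity by simp
  qed (use proj_rep(2)[OF \<sigma>] proj_rep(2)[OF \<tau>] proj_rep(2)[OF \<sigma>\<tau>] in auto)
  then show ?thesis by blast
qed

section \<open>From matrices over the constants to endomorphisms of N\<close>

lemma period_add: "x \<in> carrier N \<Longrightarrow> y \<in> carrier N \<Longrightarrow> m < r \<Longrightarrow> period (x \<oplus>\<^bsub>N\<^esub> y) m = period x m + period y m"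
  by (simp add: period_expand_r N.M.a_closed co_add hom_distribs distrib_right sum.distrib)

lemma period_smult:
  assumes "x \<in> carrier N" "m < r"
  shows "period ((\<lambda>z. c * z) \<star> x) m = i c * period x m"
  using assms DK_smult_closed[OF mult_in_diff_op_ring[OF j_hom] assms(1)]
  by (simp add: period_expand_r co_smult hom_distribs sum_distrib_left mult.assoc)

lemma period_zero: "m < r \<Longrightarrow> period \<zero>\<^bsub>N\<^esub> m = 0"
  using period_add[of "\<zero>\<^bsub>N\<^esub>" "\<zero>\<^bsub>N\<^esub>" m] by (simp only: N.M.zero_closed N.M.l_zero) (metis add.right_neutral add_left_cancel)

lemma period_eqI:
  assumes x: "x \<in> carrier N" and y: "y \<in> carrier N" and eq: "\<And>m. m < r \<Longrightarrow> period x m = period y m"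
  shows "x = y"
proof -
  have co: "co x s = co y s" if s: "s < r" for s
  proof -
    have "i (co x s) - i (co y s) = 0"
    proof (rule period_inj[OF _ s, of "\<lambda>s. i (co x s) - i (co y s)"])
      fix m assume "m < e"
      then show "(\<Sum>s<r. (i (co x s) - i (co y s)) * period (b s) m) = 0"
        using eq[of m] period_expand[OF x, of m] period_expand[OF y, of m]
        by (simp add: left_diff_distrib sum_subtractf e_eq_r)
    qed
    then show ?thesis using injectivity by simp
  qed
  have "finsum (underlying_space N) (\<lambda>s. co x s \<odot>\<^bsub>underlying_space N\<^esub> b s) {..<r} =
      finsum (underlying_space N) (\<lambda>s. co y s \<odot>\<^bsub>underlying_space N\<^esub> b s) {..<r}"
    using co b_closed smult_V by (intro V.add.finprod_cong') (auto simp: underlying_space_simps)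
  then show ?thesis using co_expand[OF x] co_expand[OF y] by simp
qed

definition combination :: "(nat \<Rightarrow> 'K) \<Rightarrow> 'n" where
  "combination c = finsum (underlying_space N) (\<lambda>s. c s \<odot>\<^bsub>underlying_space N\<^esub> b s) {..<r}"

lemma combination_closed: "combination c \<in> carrier N"
proof -
  have "combination c \<in> carrier (underlying_space N)"
    unfolding combination_def using b_closed smult_V
    by (intro V.finsum_closed) (auto simp: underlying_space_simps)
  then show ?thesis by (simp add: underlying_space_simps)
qed

lemma co_combination: "s < r \<Longrightarrow> co (combination c) s = c s"
  unfolding combination_def by (rule co_coord)

lemma period_vec:
  assumes "x \<in> carrier N"
  shows "vec r (period x) = period_mat *\<^sub>v vec r (\<lambda>s. i (co x s))"
proof (rule eq_vecI)
  fix m assume "m < dim_vec (period_mat *\<^sub>v vec r (\<lambda>s. i (co x s)))"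
  then have m: "m < r" using period_mat_carrier by simp
  show "vec r (period x) $ m = (period_mat *\<^sub>v vec r (\<lambda>s. i (co x s))) $ m"
    unfolding index_mult_mat_vec_sum[OF period_mat_carrier m] using m
    by (simp add: period_expand_r[OF assms m] period_mat_index mult.commute)
qed (use period_mat_carrier in simp)

lemma commutant_scalar:
  assumes Y: "Y \<in> carrier_mat r r" and comm: "\<And>\<sigma>. \<sigma> \<in> galois_group \<Longrightarrow> proj_rep \<sigma> * Y = Y * proj_rep \<sigma>"
  shows "\<exists>c. Y = c \<cdot>\<^sub>m 1\<^sub>m r"
proof -
  let ?Y = "map_mat h Y"
  have HY: "?Y \<in> carrier_mat r r" using Y by simp
  note carriers = period_mat_carrier period_inv(1) HY
  define E where "E = period_inv * ?Y * period_mat"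
  have E: "E \<in> carrier_mat r r" unfolding E_def using carriers by simp
  have BE: "period_mat * E = ?Y * period_mat"
  proof -
    have "period_mat * E = (period_mat * period_inv) * ?Y * period_mat"
      unfolding E_def using carriers by (simp add: assoc_mult_mat[of _ r r _ r _ r])
    then show ?thesis unfolding period_inv(2) using carriers by simp
  qed
  \<comment> \<open>With B for \<open>period_mat\<close> and A for \<open>cocycle \<sigma>\<close>
    one has \<sigma>(B) = A^-1 B, so \<sigma>(E) = B^-1 A Y A^-1 B. As A is a multiple of
    \<open>proj_rep \<sigma>\<close>, it commutes with Y.\<close>
  have fixed: "map_mat \<sigma> E = E" if \<sigma>: "\<sigma> \<in> galois_group" for \<sigma>
  proof -
    interpret \<sigma>: field_hom \<sigma> by (rule galois_hom[OF \<sigma>])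
    let ?period_inv = "map_mat \<sigma> period_inv" and ?period_mat = "map_mat \<sigma> period_mat"
    have cs: "?period_inv \<in> carrier_mat r r" "?period_mat \<in> carrier_mat r r" using carriers by auto
    have "map_mat \<sigma> ?Y = ?Y" by (rule eq_matI) (auto simp: galois_groupD(5)[OF \<sigma>])
    then have 1: "map_mat \<sigma> E = ?period_inv * ?Y * ?period_mat"
      unfolding E_def using \<sigma>.mat_hom_mult[OF _ period_mat_carrier, of "period_inv * ?Y" r] \<sigma>.mat_hom_mult[OF period_inv(1) HY] carriers by simp
    have AY: "cocycle \<sigma> * ?Y = ?Y * cocycle \<sigma>"
    proof -
      have "map_mat h (proj_rep \<sigma>) * ?Y = ?Y * map_mat h (proj_rep \<sigma>)"
        using h.mat_hom_mult[OF proj_rep(2)[OF \<sigma>] Y] h.mat_hom_mult[OF Y proj_rep(2)[OF \<sigma>]] comm[OF \<sigma>] by simp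
      moreover have "map_mat h (proj_rep \<sigma>) \<in> carrier_mat r r" using proj_rep(2)[OF \<sigma>] by simp
      ultimately show ?thesis unfolding proj_rep(3)[OF \<sigma>] using HY
        by (simp add: mult_smult_assoc_mat[of _ r r _ r] mult_smult_distrib[of _ r r _ r])
    qed
    have BC\<sigma>: "?period_mat * ?period_inv = 1\<^sub>m r" "?period_inv * ?period_mat = 1\<^sub>m r"
      by (simp_all only: \<sigma>.mat_hom_mult[OF period_mat_carrier period_inv(1), symmetric] period_inv(2,3)
          \<sigma>.mat_hom_mult[OF period_inv(1) period_mat_carrier, symmetric] \<sigma>.mat_hom_one)
    have "?period_inv * ?Y * ?period_mat = (period_inv * period_mat) * ?period_inv * ?Y * ?period_mat" unfolding period_inv(3) using cs by simp
    also have "\<dots> = period_inv * (cocycle \<sigma> * ?Y) * ?period_mat"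
      unfolding cocycle_def using carriers cs by (simp add: assoc_mult_mat[of _ r r _ r _ r])
    also have "\<dots> = period_inv * ?Y * period_mat * (?period_inv * ?period_mat)"
      unfolding AY unfolding cocycle_def using carriers cs by (simp add: assoc_mult_mat[of _ r r _ r _ r])
    also have "\<dots> = E" unfolding BC\<sigma> E_def using carriers by simp
    finally show ?thesis unfolding 1 .
  qed
  have "\<exists>k. E $$ (s, t) = i k" if "s < r" "t < r" for s t
  proof -
    have "E $$ (s, t) \<in> range i"
    proof (rule fixed_field)
      fix \<sigma> assume "\<sigma> \<in> galois_group"
      then show "\<sigma> (E $$ (s, t)) = E $$ (s, t)"
        using arg_cong[OF fixed, of \<sigma> "\<lambda>M. M $$ (s, t)"] E that by simp
    qed
    then show ?thesis by blast
  qed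
  then obtain e' where e': "\<And>s t. s < r \<Longrightarrow> t < r \<Longrightarrow> E $$ (s, t) = i (e' s t)" by metis
  define E' where "E' = mat r r (\<lambda>(s, t). e' s t)"
  have E': "E' \<in> carrier_mat r r" unfolding E'_def by simp
  have EE': "map_mat i E' = E" by (rule eq_matI) (use E e' in \<open>auto simp: E'_def\<close>)
  \<comment> \<open>The \<open>K\<close>-linear endomorphism of \<open>N\<close> with matrix
    \<open>E'\<close>. On periods it is multiplication by \<open>Y\<close>, which is how it is
    compared with the operators.\<close>
  define op where "op x = combination (\<lambda>s. \<Sum>t<r. E' $$ (s, t) * co x t)" for x
  have op_closed: "op x \<in> carrier N" for x unfolding op_def by (rule combination_closed)
  have period_op: "period (op x) m = (\<Sum>l<r. h (Y $$ (m, l)) * period x l)" if x: "x \<in> carrier N" and m: "m < r" for x m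
  proof -
    let ?v = "vec r (\<lambda>s. i (co x s))"
    have "vec r (\<lambda>s. i (co (op x) s)) = E *\<^sub>v ?v"
    proof (rule eq_vecI)
      fix s assume "s < dim_vec (E *\<^sub>v ?v)"
      then have s: "s < r" using E by simp
      show "vec r (\<lambda>s. i (co (op x) s)) $ s = (E *\<^sub>v ?v) $ s"
        unfolding index_mult_mat_vec_sum[OF E s] using s E'
        by (simp add: op_def co_combination hom_distribs EE'[symmetric])
    qed (use E in simp)
    then have "vec r (period (op x)) = period_mat *\<^sub>v (E *\<^sub>v ?v)" using period_vec[OF op_closed] by simp
    also have "\<dots> = (period_mat * E) *\<^sub>v ?v" by (rule assoc_mult_mat_vec[symmetric, OF period_mat_carrier E]) simp
    also have "\<dots> = ?Y *\<^sub>v (period_mat *\<^sub>v ?v)" unfolding BE by (rule assoc_mult_mat_vec[OF HY period_mat_carrier]) simp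
    also have "\<dots> = ?Y *\<^sub>v vec r (period x)" using period_vec[OF x] by simp
    finally have "vec r (period (op x)) $ m = (?Y *\<^sub>v vec r (period x)) $ m" by simp
    then show ?thesis unfolding index_mult_mat_vec_sum[OF HY m] using m Y by simp
  qed
  have op_zero: "op \<zero>\<^bsub>N\<^esub> = \<zero>\<^bsub>N\<^esub>"
    by (rule period_eqI[OF op_closed]) (simp_all add: period_op period_zero)
  \<comment> \<open>Strong induction on the order. The lift \<open>Q\<close> sees \<open>P\<close>
    together with lower terms \<open>R s\<close>; \<open>act Q\<close> commutes with
    \<open>Y\<close>, the lower terms commute with \<open>op\<close> by induction, so
    \<open>P\<close> does too.\<close>
  have op_commute: "\<forall>x\<in>carrier N. op (P \<star> x) = P \<star> op x" if "P \<in> diff_ops_of_order j n" for P n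
    using that
  proof (induction n arbitrary: P rule: less_induct)
    case (less n)
    obtain Q R where Q: "Q \<in> diff_ops_of_order (i \<circ> j) n" and R: "\<And>s. s < d \<Longrightarrow> R s \<in> lower_ops n"
      and QR: "\<And>c. Q (i c) = i (P c) + (\<Sum>s<d. w s * i (R s c))"
      using diff_op_lift_mod_lower[OF less(2)] by blast
    have QDL: "Q \<in> DL" using Q by (auto simp: diff_op_ring_simps)
    have P: "P \<in> DK" using less(2) by (auto simp: diff_op_ring_simps)
    have RDK: "R s \<in> DK" if s: "s < d" for s
    proof (cases n)
      case 0
      then show ?thesis using R[OF s] N.R.zero_closed by (simp add: lower_ops_def diff_op_ring_simps)
    next
      case (Suc n')
      then show ?thesis using R[OF s] by (auto simp: lower_ops_def diff_op_ring_simps)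
    qed
    have op_R: "op (R s \<star> x) = R s \<star> op x" if s: "s < d" and x: "x \<in> carrier N" for s x
    proof (cases n)
      case 0
      then have "R s = \<zero>\<^bsub>diff_op_ring j\<^esub>" using R[OF s] by (simp add: lower_ops_def diff_op_ring_simps)
      then show ?thesis using N.zero_smult[OF x] N.zero_smult[OF op_closed] op_zero by simp
    next
      case (Suc n')
      then show ?thesis using less(1)[of n' "R s"] R[OF s] x by (simp add: lower_ops_def)
    qed
    have act_Q: "act Q (period x m) = period (P \<star> x) m + (\<Sum>s<d. w s * period (R s \<star> x) m)"
      if x: "x \<in> carrier N" and m: "m < r" for x m
    proof -
      \<comment> \<open>Index 0 carries \<open>P\<close> with coefficient 1, index
        \<open>Suc s\<close> the lower term \<open>R s\<close> with coefficient
        \<open>w s\<close>.\<close>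
      define p where "p l = (case l of 0 \<Rightarrow> P | Suc s \<Rightarrow> R s)" for l
      define y where "y l = (case l of 0 \<Rightarrow> 1 | Suc s \<Rightarrow> w s)" for l
      have "act Q (period x m) = (\<Sum>l<Suc d. y l * period (p l \<star> x) m)"
      proof (rule period_act_r[OF QDL x _ _ m])
        show "p l \<in> DK" if "l < Suc d" for l using that P RDK unfolding p_def by (cases l) auto
        show "Q (i c) = (\<Sum>l<Suc d. y l * i (p l c))" for c
          unfolding QR y_def p_def by (simp add: sum.lessThan_Suc_shift del: sum.lessThan_Suc)
      qed
      then show ?thesis unfolding y_def p_def by (simp add: sum.lessThan_Suc_shift del: sum.lessThan_Suc)
    qed
    \<comment> \<open>Linearity of \<open>Q\<close> over \<open>k\<close> passes to
      \<open>act Q\<close>. Since \<open>Y\<close> has entries in \<open>k\<close>, it can be pulled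
      through \<open>act Q\<close>.\<close>
    have act_h: "act Q (h k * y) = h k * act Q y" for k y
    proof -
      have "(\<lambda>z. Q (h k * z)) = (\<lambda>z. h k * Q z)"
        using linear_operatorD(2)[OF diff_ops_linear[OF ij_hom Q]] by blast
      then have "act Q (h k * y) = act (\<lambda>z. h k * Q z) y"
        using act_compose_mult[OF QDL, of "h k" y] by simp
      also have "\<dots> = h k * act Q y" using act_compose[OF mult_DL QDL, of "h k" y] act_mult by simp
      finally show ?thesis .
    qed
    show ?case
    proof
      fix x assume x: "x \<in> carrier N"
      note Px = DK_smult_closed[OF P x]
      show "op (P \<star> x) = P \<star> op x"
      proof (rule period_eqI[OF op_closed DK_smult_closed[OF P op_closed]])
        fix m assume m: "m < r"
        have "period (P \<star> op x) m + (\<Sum>s<d. w s * period (R s \<star> op x) m) = act Q (period (op x) m)"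
          using act_Q[OF op_closed m] by simp
        also have "\<dots> = (\<Sum>l<r. h (Y $$ (m, l)) * act Q (period x l))"
          unfolding period_op[OF x m] act_sum[OF QDL] act_h ..
        also have "\<dots> = (\<Sum>l<r. h (Y $$ (m, l)) * period (P \<star> x) l) +
            (\<Sum>l<r. h (Y $$ (m, l)) * (\<Sum>s<d. w s * period (R s \<star> x) l))"
          using act_Q[OF x] by (simp add: distrib_left sum.distrib)
        also have "(\<Sum>l<r. h (Y $$ (m, l)) * (\<Sum>s<d. w s * period (R s \<star> x) l)) =
            (\<Sum>s<d. w s * (\<Sum>l<r. h (Y $$ (m, l)) * period (R s \<star> x) l))"
          unfolding sum_distrib_left by (subst sum.swap) (simp only: ac_simps)
        also have "\<dots> = (\<Sum>s<d. w s * period (op (R s \<star> x)) m)"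
          using period_op[OF DK_smult_closed[OF RDK x] m] by simp
        also have "\<dots> = (\<Sum>s<d. w s * period (R s \<star> op x) m)" using op_R[OF _ x] by simp
        also have "(\<Sum>l<r. h (Y $$ (m, l)) * period (P \<star> x) l) = period (op (P \<star> x)) m"
          using period_op[OF Px m] by simp
        finally show "period (op (P \<star> x)) m = period (P \<star> op x) m" by simp
      qed
    qed
  qed
  have "degree (char_poly Y) = r" using degree_monic_char_poly[OF Y] by simp
  then obtain \<mu> where \<mu>: "poly (char_poly Y) \<mu> = 0"
    using alg_closed_imp_poly_has_root[of "char_poly Y"] r_pos by auto
  \<comment> \<open>By similarity \<open>E'\<close> and \<open>Y\<close> have the same
    characteristic polynomial in \<open>L\<close>, so a root in \<open>k\<close> is an eigenvalue of
    \<open>E'\<close> already over \<open>K\<close>.\<close>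
  have similar: "similar_mat E ?Y"
    unfolding similar_mat_def similar_mat_wit_def Let_def E_def using carriers period_inv(2,3)
    by (intro exI[of _ period_inv] exI[of _ period_mat]) auto
  have "map_poly i (char_poly E') = map_poly h (char_poly Y)"
    using char_poly_similar[OF similar] char_poly_hom[OF E'] h.char_poly_hom[OF Y] EE' by simp
  then have "poly (map_poly i (char_poly E')) (i (j \<mu>)) = poly (map_poly h (char_poly Y)) (h \<mu>)" by simp
  then have "i (poly (char_poly E') (j \<mu>)) = h (poly (char_poly Y) \<mu>)"
    by (simp only: poly_map_poly h.poly_map_poly)
  then have "poly (char_poly E') (j \<mu>) = 0" unfolding \<mu> by simp
  then obtain v where v: "v \<in> carrier_vec r" "v \<noteq> 0\<^sub>v r" "E' *\<^sub>v v = j \<mu> \<cdot>\<^sub>v v"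
    using eigenvalue_root_char_poly[OF E', of "j \<mu>"] E' unfolding eigenvalue_def eigenvector_def by auto
  \<comment> \<open>The eigenspace of \<open>op\<close> for \<open>j \<mu>\<close>, expressed by
    periods. It will be a nonzero submodule, hence all of \<open>N\<close>.\<close>
  define S where "S = {x \<in> carrier N. \<forall>m<r. period (op x) m = h \<mu> * period x m}"
  have SI: "x \<in> S" if "x \<in> carrier N" "\<And>m. m < r \<Longrightarrow> period (op x) m = h \<mu> * period x m" for x
    using that unfolding S_def by blast
  have period_uminus: "period (\<ominus>\<^bsub>N\<^esub> x) m = - period x m" if x: "x \<in> carrier N" and m: "m < r" for x m
    using period_add[OF x N.M.a_inv_closed[OF x] m] period_zero[OF m] x by (simp add: N.M.r_neg eq_neg_iff_add_eq_0 add.commute)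
  have op_scalar: "op x = (\<lambda>z. j \<mu> * z) \<star> x" if x: "x \<in> S" for x
  proof (rule period_eqI[OF op_closed DK_smult_closed[OF mult_in_diff_op_ring[OF j_hom]]])
    show xN: "x \<in> carrier N" using x unfolding S_def by blast
    show "period (op x) m = period ((\<lambda>z. j \<mu> * z) \<star> x) m" if "m < r" for m
      using x that period_smult[OF xN that] unfolding S_def by simp
  qed
  have "left_submodule S (diff_op_ring j) N"
    unfolding left_submodule_def
  proof (intro conjI ballI)
    show "additive_subgroup S N"
    proof (rule additive_subgroup.intro, rule group.subgroupI[OF N.M.a_group])
      show "S \<subseteq> carrier (add_monoid N)" unfolding S_def by auto
      show "S \<noteq> {}" using SI[of "\<zero>\<^bsub>N\<^esub>"] op_zero period_zero by auto
      show "inv\<^bsub>add_monoid N\<^esub> x \<in> S" if "x \<in> S" for x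
      proof -
        have x: "x \<in> carrier N" "\<And>m. m < r \<Longrightarrow> period (op x) m = h \<mu> * period x m" using that unfolding S_def by auto
        have "\<ominus>\<^bsub>N\<^esub> x \<in> S"
          using x(2) period_op[OF x(1)] period_uminus[OF x(1)] period_op[OF N.M.a_inv_closed[OF x(1)]] N.M.a_inv_closed[OF x(1)]
          by (intro SI) (simp_all add: sum_negf)
        then show ?thesis by (simp add: a_inv_def)
      qed
      show "x \<otimes>\<^bsub>add_monoid N\<^esub> y \<in> S" if "x \<in> S" "y \<in> S" for x y
      proof -
        have x: "x \<in> carrier N" "\<And>m. m < r \<Longrightarrow> period (op x) m = h \<mu> * period x m" using that(1) unfolding S_def by auto
        have y: "y \<in> carrier N" "\<And>m. m < r \<Longrightarrow> period (op y) m = h \<mu> * period y m" using that(2) unfolding S_def by auto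
        have xy: "x \<oplus>\<^bsub>N\<^esub> y \<in> carrier N" using x y by simp
        have "period (op (x \<oplus>\<^bsub>N\<^esub> y)) m = period (op x) m + period (op y) m" if m: "m < r" for m
          unfolding period_op[OF xy m] period_op[OF x(1) m] period_op[OF y(1) m]
          using period_add[OF x(1) y(1)] by (simp add: distrib_left sum.distrib)
        then have "x \<oplus>\<^bsub>N\<^esub> y \<in> S" using x y xy period_add[OF x(1) y(1)] by (intro SI) (simp_all add: distrib_left)
        then show ?thesis by simp
      qed
    qed
    fix P x assume P: "P \<in> DK" and x: "x \<in> S"
    have xN: "x \<in> carrier N" using x unfolding S_def by blast
    note Px = DK_smult_closed[OF P xN]
    note \<mu>DK = mult_in_diff_op_ring[OF j_hom, of "j \<mu>"]
    obtain n where n: "P \<in> diff_ops_of_order j n" using P by (auto simp: diff_op_ring_simps)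
    show "P \<star> x \<in> S"
    proof (rule SI[OF Px])
      fix m assume m: "m < r"
      \<comment> \<open>The eigenspace is stable because the eigenvalue is a constant and operators
        are \<open>k\<close>-linear; an eigenvalue merely in \<open>K\<close> would not do.\<close>
      have "P \<otimes>\<^bsub>diff_op_ring j\<^esub> (\<lambda>z. j \<mu> * z) = (\<lambda>z. j \<mu> * z) \<otimes>\<^bsub>diff_op_ring j\<^esub> P"
        using linear_operatorD(2)[OF diff_ops_linear[OF j_hom n]] by (simp add: diff_op_ring_simps fun_eq_iff)
      then have "P \<star> op x = (\<lambda>z. j \<mu> * z) \<star> (P \<star> x)"
        unfolding op_scalar[OF x] using N.smult_assoc[OF P \<mu>DK xN] N.smult_assoc[OF \<mu>DK P xN] by simp
      then have "op (P \<star> x) = (\<lambda>z. j \<mu> * z) \<star> (P \<star> x)" using op_commute[OF n] xN by simp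
      then show "period (op (P \<star> x)) m = h \<mu> * period (P \<star> x) m" using period_smult[OF Px m] by simp
    qed
  qed
  moreover have "S \<noteq> {\<zero>\<^bsub>N\<^esub>}"
  proof
    assume S0: "S = {\<zero>\<^bsub>N\<^esub>}"
    \<comment> \<open>The eigenvector of \<open>E'\<close> is read as the coordinate vector of an
      element of \<open>N\<close>.\<close>
    let ?x = "combination (\<lambda>s. v $ s)"
    note xN = combination_closed[of "\<lambda>s. v $ s"]
    have v_eq: "vec r (\<lambda>s. v $ s) = v" using v(1) by (intro eq_vecI) auto
    have "op ?x = (\<lambda>z. j \<mu> * z) \<star> ?x"
    proof (rule period_eqI[OF op_closed DK_smult_closed[OF mult_in_diff_op_ring[OF j_hom] xN]])
      fix m assume m: "m < r"
      have "co (op ?x) s = j \<mu> * co ?x s" if s: "s < r" for s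
      proof -
        have "co (op ?x) s = (E' *\<^sub>v v) $ s"
          using index_mult_mat_vec_sum[OF E' s, of "\<lambda>s. v $ s"] s unfolding v_eq op_def
          by (simp add: co_combination)
        then show ?thesis using v s by (simp add: co_combination)
      qed
      then show "period (op ?x) m = period ((\<lambda>z. j \<mu> * z) \<star> ?x) m"
        using period_smult[OF xN m] period_expand_r[OF op_closed m] period_expand_r[OF xN m]
        by (simp add: hom_distribs sum_distrib_left mult.assoc)
    qed
    then have "?x \<in> S" using xN period_smult[OF xN] by (intro SI) simp_all
    then have "?x = \<zero>\<^bsub>N\<^esub>" using S0 by simp
    then have "v $ s = 0" if "s < r" for s
      using co_combination[OF that, of "\<lambda>s. v $ s"] co_zero[OF that] by simp
    then show False using v(1,2) by (auto intro: eq_vecI)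
  qed
  ultimately have SN: "S = carrier N" using simple unfolding simple_left_module_def by blast
  have E'_scalar: "E' $$ (s, t) = (if s = t then j \<mu> else 0)" if s: "s < r" and t: "t < r" for s t
  proof -
    have bt: "b t \<in> carrier N" by (rule b_closed[OF t])
    have "E' $$ (s, t) = (\<Sum>q<r. if q = t then E' $$ (s, q) else 0)" using t by simp
    also have "\<dots> = (\<Sum>q<r. E' $$ (s, q) * co (b t) q)" using t by (intro sum.cong) (auto simp: co_basis)
    also have "\<dots> = co (op (b t)) s" unfolding op_def co_combination[OF s] ..
    also have "\<dots> = j \<mu> * co (b t) s" using op_scalar[of "b t"] SN bt co_smult[OF bt s] by simp
    finally show ?thesis using s t by (simp add: co_basis)
  qed
  have "E = h \<mu> \<cdot>\<^sub>m 1\<^sub>m r"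
    by (rule eq_matI) (use E' E'_scalar in \<open>auto simp: EE'[symmetric]\<close>)
  then have "?Y * period_mat = h \<mu> \<cdot>\<^sub>m period_mat"
    using BE period_mat_carrier by (simp add: mult_smult_distrib[of _ r r _ r])
  then have "?Y * period_mat * period_inv = h \<mu> \<cdot>\<^sub>m (period_mat * period_inv)"
    using period_mat_carrier period_inv(1) by (simp add: mult_smult_assoc_mat[of _ r r _ r])
  then have YY: "?Y = h \<mu> \<cdot>\<^sub>m 1\<^sub>m r"
    using carriers period_inv(2) by (simp add: assoc_mult_mat[of _ r r _ r _ r])
  have "Y = \<mu> \<cdot>\<^sub>m 1\<^sub>m r"
  proof (rule eq_matI)
    fix m l assume "m < dim_row (\<mu> \<cdot>\<^sub>m 1\<^sub>m r)" "l < dim_col (\<mu> \<cdot>\<^sub>m 1\<^sub>m r)"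
    then have ml: "m < r" "l < r" by auto
    have "h (Y $$ (m, l)) = h (if m = l then \<mu> else 0)"
      using arg_cong[OF YY, of "\<lambda>M. M $$ (m, l)"] ml Y by simp
    then show "Y $$ (m, l) = (\<mu> \<cdot>\<^sub>m 1\<^sub>m r) $$ (m, l)" using h.injectivity ml by simp
  qed (use Y in auto)
  then show ?thesis by blast
qed

theorem r_dvd_d: "r dvd d"
proof -
  let ?G = "\<lparr>carrier = galois_group, monoid.mult = (\<circ>), one = id\<rparr>"
  have "group ?G"
  proof (rule groupI)
    fix \<sigma> assume "\<sigma> \<in> carrier ?G"
    then have \<sigma>: "\<sigma> \<in> galois_group" by simp
    have "inv_into UNIV \<sigma> \<circ> \<sigma> = id" using galois_inv[OF \<sigma>] by auto
    then show "\<exists>\<tau>\<in>carrier ?G. \<tau> \<otimes>\<^bsub>?G\<^esub> \<sigma> = \<one>\<^bsub>?G\<^esub>"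
      using galois_group_inv[OF \<sigma>] by auto
  qed (auto simp: galois_group_comp galois_group_id comp_assoc)
  from projective_representation_degree_dvd[OF this, of r proj_rep]
  have "r dvd card (carrier ?G)"
    using finite_galois_group r_pos proj_rep(2,4) proj_rep_projective commutant_scalar by simp
  then show ?thesis by (simp add: card_galois_group)
qed

end

section \<open>The extension field as a vector space, and the divisibility of the degree\<close>

lemma vectorspace_extension_space:
  assumes "field_hom i"
  shows "vectorspace class_ring (extension_space i)"
proof -
  interpret field_hom i by fact
  show ?thesis
  proof (rule vs_criteria)
    show "field (class_ring :: 'a ring)" by (rule class_field)
    show "\<forall>v\<in>carrier (extension_space i). \<exists>u\<in>carrier (extension_space i). v \<oplus>\<^bsub>extension_space i\<^esub> u = \<zero>\<^bsub>extension_space i\<^esub>"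
      unfolding extension_space_def by (auto intro: exI[of _ "- _"] simp: eq_neg_iff_add_eq_0[symmetric])
  qed (auto simp: extension_space_def hom_distribs algebra_simps)
qed

lemma extension_space_simps:
  "carrier (extension_space i) = UNIV" "x \<oplus>\<^bsub>extension_space i\<^esub> y = x + y"
  "\<zero>\<^bsub>extension_space i\<^esub> = 0" "c \<odot>\<^bsub>extension_space i\<^esub> x = i c * x"
  unfolding extension_space_def by simp_all

lemma finsum_extension_space:
  assumes "field_hom i"
  shows "finsum (extension_space i) g I = sum g I"
proof -
  interpret V: vectorspace class_ring "extension_space i" by (rule vectorspace_extension_space[OF assms])
  show ?thesis
    by (induction I rule: infinite_finite_induct)
      (simp_all add: V.finsum_infinite extension_space_simps)
qed

theorem corollary3p18:
  fixes j :: "'k::{alg_closed_field, field_char_0} \<Rightarrow> 'K::field"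
    and i :: "'K \<Rightarrow> 'L::field"
    and N :: "('K \<Rightarrow> 'K, 'n) module"
    and \<Lambda> :: "('L \<Rightarrow> 'L, 'm) module"
    and e n :: nat
    and F :: "nat \<Rightarrow> 'L set"
  assumes "field_hom j"
    and "finitely_generated_field j"
    and "simple_left_module (diff_op_ring j) N"
    and "vectorspace.fin_dim class_ring (underlying_space N)"
    and "field_hom i"
    and "vectorspace.fin_dim class_ring (extension_space i)"
    and "galois_extension (range i) UNIV"
    and "left_module (diff_op_ring (i \<circ> j)) \<Lambda>"
    and "vectorspace.fin_dim class_ring (underlying_space \<Lambda>)"
    and "vectorspace.dim class_ring (underlying_space \<Lambda>) = 1"
    and "left_module_isomorphic (diff_op_ring (i \<circ> j)) (inverse_image j i N) (power_module \<Lambda> e)"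
    and "F 0 = range i" and "F n = UNIV"
    and "\<And>l. l < n \<Longrightarrow> galois_extension (F l) (F (Suc l))"
  shows "vectorspace.dim class_ring (underlying_space N) dvd vectorspace.dim class_ring (extension_space i)"
proof -
  interpret j: field_hom j by fact
  interpret i: field_hom i by fact
  have ij: "field_hom (i \<circ> j)" by unfold_locales (auto simp: hom_distribs)
  have N: "left_module (diff_op_ring j) N" using assms(3) unfolding simple_left_module_def by blast
  note \<Lambda> = \<open>left_module (diff_op_ring (i \<circ> j)) \<Lambda>\<close>
  interpret N: left_module "diff_op_ring j" N by (rule N)
  interpret \<Lambda>: left_module "diff_op_ring (i \<circ> j)" \<Lambda> by (rule \<Lambda>)
  define d where "d = vectorspace.dim class_ring (extension_space i)"
  define r where "r = vectorspace.dim class_ring (underlying_space N)"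
  let ?X = "extension_space i"
  obtain w \<phi> where w:
    "\<And>y. y \<in> carrier ?X \<Longrightarrow> y = finsum ?X (\<lambda>s. \<phi> y s \<odot>\<^bsub>?X\<^esub> w s) {..<d}"
    "\<And>c s. s < d \<Longrightarrow> \<phi> (finsum ?X (\<lambda>s. c s \<odot>\<^bsub>?X\<^esub> w s) {..<d}) s = c s"
  proof (rule fin_dim_coordinates[OF vectorspace_extension_space[OF assms(5)] assms(6), folded d_def])
    fix w \<phi>
    assume w: "\<And>y. y \<in> carrier ?X \<Longrightarrow> y = finsum ?X (\<lambda>s. \<phi> y s \<odot>\<^bsub>?X\<^esub> w s) {..<d}"
      "\<And>c s. s < d \<Longrightarrow> \<phi> (finsum ?X (\<lambda>s. c s \<odot>\<^bsub>?X\<^esub> w s) {..<d}) s = c s"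
    show thesis by (rule that[of \<phi> w, OF w])
  qed
  interpret fb: field_basis i w \<phi> d
  proof
    show "(\<Sum>s<d. i (\<phi> y s) * w s) = y" for y
      using w(1)[of y] unfolding finsum_extension_space[OF assms(5)] by (simp add: extension_space_simps)
    show "\<phi> (\<Sum>t<d. i (c t) * w t) s = c s" if "s < d" for c s
      using w(2)[OF that, of c] unfolding finsum_extension_space[OF assms(5)] by (simp add: extension_space_simps)
  qed
  obtain b co where b: "\<And>s. s < r \<Longrightarrow> b s \<in> carrier N"
    "\<And>x. x \<in> carrier N \<Longrightarrow> x = finsum (underlying_space N) (\<lambda>s. co x s \<odot>\<^bsub>underlying_space N\<^esub> b s) {..<r}"
    "\<And>c s. s < r \<Longrightarrow> co (finsum (underlying_space N) (\<lambda>s. c s \<odot>\<^bsub>underlying_space N\<^esub> b s) {..<r}) s = c s"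
    "\<And>x y s. x \<in> carrier N \<Longrightarrow> y \<in> carrier N \<Longrightarrow> s < r \<Longrightarrow> co (x \<oplus>\<^bsub>N\<^esub> y) s = co x s + co y s"
    "\<And>c x s. x \<in> carrier N \<Longrightarrow> s < r \<Longrightarrow> co ((\<lambda>z. c * z) \<odot>\<^bsub>N\<^esub> x) s = c * co x s"
    using fin_dim_coordinates[OF vectorspace_underlying_space[OF assms(1) N] assms(4)]
    unfolding r_def[symmetric] underlying_space_simps by blast
  let ?Y = "underlying_space \<Lambda>"
  obtain lb :: "nat \<Rightarrow> 'm" and lco :: "'m \<Rightarrow> nat \<Rightarrow> 'L" where lam: "\<And>s. s < 1 \<Longrightarrow> lb s \<in> carrier ?Y"
    "\<And>x. x \<in> carrier ?Y \<Longrightarrow> x = finsum ?Y (\<lambda>s. lco x s \<odot>\<^bsub>?Y\<^esub> lb s) {..<1}"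
    "\<And>c s. s < 1 \<Longrightarrow> lco (finsum ?Y (\<lambda>s. c s \<odot>\<^bsub>?Y\<^esub> lb s) {..<1}) s = c s"
  proof (rule fin_dim_coordinates[OF vectorspace_underlying_space[OF ij \<Lambda>] assms(9), unfolded assms(10)])
    fix lb :: "nat \<Rightarrow> 'm" and lco :: "'m \<Rightarrow> nat \<Rightarrow> 'L"
    assume lam: "\<And>s. s < 1 \<Longrightarrow> lb s \<in> carrier ?Y"
      "\<And>x. x \<in> carrier ?Y \<Longrightarrow> x = finsum ?Y (\<lambda>s. lco x s \<odot>\<^bsub>?Y\<^esub> lb s) {..<1}"
      "\<And>c s. s < 1 \<Longrightarrow> lco (finsum ?Y (\<lambda>s. c s \<odot>\<^bsub>?Y\<^esub> lb s) {..<1}) s = c s"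
    show thesis by (rule that[of lb lco, OF lam])
  qed
  note lam = lam[unfolded underlying_space_simps(1)]
  interpret V\<Lambda>: vectorspace class_ring "underlying_space \<Lambda>" by (rule vectorspace_underlying_space[OF ij \<Lambda>])
  \<comment> \<open>Rank 1 leaves a single basis vector with index 0, so expansions over
    \<open>{..<1}\<close> collapse to multiples of \<open>lb 0\<close>.\<close>
  have single: "finsum (underlying_space \<Lambda>) g {..<1::nat} = g 0" if "g 0 \<in> carrier \<Lambda>" for g
    using that by (simp add: lessThan_Suc underlying_space_simps)
  have scaled: "(\<lambda>z. y * z) \<odot>\<^bsub>\<Lambda>\<^esub> lb 0 \<in> carrier \<Lambda>" for y
    using \<Lambda>.smult_closed[OF mult_in_diff_op_ring[OF ij] lam(1)] by simp
  obtain f where f: "f \<in> iso (add_monoid (inverse_image j i N)) (add_monoid (power_module \<Lambda> e))"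
    "\<And>Q t. Q \<in> carrier (diff_op_ring (i \<circ> j)) \<Longrightarrow> t \<in> carrier (inverse_image j i N) \<Longrightarrow>
      f (Q \<odot>\<^bsub>inverse_image j i N\<^esub> t) = Q \<odot>\<^bsub>power_module \<Lambda> e\<^esub> f t"
    using assms(11) unfolding left_module_isomorphic_def by blast
  interpret isotypic_galois_descent i w \<phi> d j N b co r \<Lambda> e f "lb 0" "\<lambda>v. lco v 0"
  proof unfold_locales
    \<comment> \<open>Characteristic 0 is inherited by \<open>K\<close> from \<open>k\<close> along
      \<open>j\<close>; this makes the trace form nondegenerate.\<close>
    show "of_nat d \<noteq> (0 :: 'K)"
      using fb.d_pos by (metis j.hom_of_nat j.hom_0_iff of_nat_eq_0_iff less_irrefl)
    show "x \<in> range i" if "\<And>\<sigma>. \<sigma> \<in> field_automorphisms (range i) UNIV \<Longrightarrow> \<sigma> x = x" for x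
      using assms(7) that unfolding galois_extension_def by blast
    show "(\<lambda>z. lco v 0 * z) \<odot>\<^bsub>\<Lambda>\<^esub> lb 0 = v" if "v \<in> carrier \<Lambda>" for v
      using lam(2)[OF that] single scaled by (simp add: underlying_space_simps)
    show "lco ((\<lambda>z. y * z) \<odot>\<^bsub>\<Lambda>\<^esub> lb 0) 0 = y" for y
      using lam(3)[of 0 "\<lambda>_. y"] single scaled by (simp add: underlying_space_simps)
  qed (use b f N \<Lambda> lam(1) assms(1,3) \<Lambda>.R.ring_axioms in auto)
  show ?thesis using r_dvd_d unfolding r_def d_def .
qed

end
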